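(* Let $\mathcal F$ be a family of graphs with universally bounded $r$-admissibility. Then $\mathcal F$ is $H$-testable; that is, for every graph $H$, the property of being $H$-free is testable with one-sided error on inputs from $\mathcal F$ in the random neighbour oracle model.
   Context: All graphs are finite, simple and undirected. An ordered graph is a pair $(G,\le)$ with $\le$ a total order on $V(G)$. For an ordered graph $\mathbb G=(G,\le)$ and $v\in V(G)$, a path $v P x$ (from $v$ to $x$, with $P$ the sequence of internal vertices) is $\mathbb G$-admissible if $x<v$ and every internal vertex $w$ of the path satisfies $w>v$; it is $r$-admissible if moreover its length is at most $r$. An $(r,\mathbb G)$-admissible path packing rooted at $v$ is a collection of $r$-admissible paths $vP_ix_i$ such that the paths $P_ix_i$ (the paths with the root $v$ removed) are pairwise vertex-disjoint; $\mathrm{pp}^r_{\mathbb G}(v)$ is the maximum size of such a packing. The $r$-admissibility of $\mathbb G$ is $\mathrm{adm}_r(\mathbb G)=\max_{v}\mathrm{pp}^r_{\mathbb G}(v)$, and of a graph $G$ is $\mathrm{adm}_r(G)=\min \mathrm{adm}_r(\mathbb G)$ over all total orders of $V(G)$. $\mathcal A^p_r$ is the family of all graphs $G$ with $\mathrm{adm}_r(G)\le p$. A family $\mathcal F$ has universally bounded $r$-admissibility if there is a computable function $f:\mathbb N\to\mathbb N$ with $\mathcal F\subseteq \mathcal A^{f(r)}_r$ for every $r\ge 1$. Testing model: a random neighbour oracle for a graph $G$ with $V(G)=[n]$ answers a query $v$ with a neighbour of $v$ chosen independently and uniformly at random. A graph $G$ is $\epsilon$-far from a property $\mathcal P$ (a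 class of graphs closed under isomorphism) if at least $\epsilon|V(G)|$ edges must be added or removed to obtain a graph in $\mathcal P$. A one-sided error tester for $\mathcal P$ on a family $\mathcal G$ is a randomized algorithm that receives $n$, $\epsilon>0$ and random neighbour oracle access to $G=([n],E)\in\mathcal G$, accepts with probability $1$ if $G\in\mathcal P$, and rejects with probability at least $2/3$ if $G$ is $\epsilon$-far from $\mathcal P$. $\mathcal P$ is testable on $\mathcal G$ if it has such a tester whose number of queries is independent of $n$ (it may depend on $\epsilon$, $\mathcal P$ and parameters of $\mathcal G$). A graph is $H$-free if it has no subgraph isomorphic to $H$. A family $\mathcal F$ is $H$-testable if for every graph $H$, $H$-freeness is testable on $\mathcal F$. *)

theory Defs
  imports "HOL-Probability.Probability" "HOL-Library.Nat_Bijection"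
begin

section \<open>Finite simple graphs\<close>

datatype 'a graph = Graph (verts: "'a set") (edges: "'a set set")

definition simple_graph :: "'a graph \<Rightarrow> bool" where
  "simple_graph G \<longleftrightarrow>
     finite (verts G) \<and> (\<forall>e\<in>edges G. e \<subseteq> verts G \<and> card e = 2)"

definition subgraph :: "'a graph \<Rightarrow> 'a graph \<Rightarrow> bool" where
  "subgraph S G \<longleftrightarrow> simple_graph S \<and> verts S \<subseteq> verts G \<and> edges S \<subseteq> edges G"

definition isomorphic :: "'a graph \<Rightarrow> 'b graph \<Rightarrow> bool" where
  "isomorphic G H \<longleftrightarrow>
     (\<exists>\<phi>. bij_betw \<phi> (verts G) (verts H) \<and>
          (\<forall>u\<in>verts G. \<forall>v\<in>verts G. {u, v} \<in> edges G \<longleftrightarrow> {\<phi> u, \<phi> v} \<in> edges H))"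

definition is_path :: "'a graph \<Rightarrow> 'a list \<Rightarrow> bool" where
  "is_path G p \<longleftrightarrow>
     p \<noteq> [] \<and> distinct p \<and> set p \<subseteq> verts G \<and>
     (\<forall>i. Suc i < length p \<longrightarrow> {p ! i, p ! Suc i} \<in> edges G)"


section \<open>Admissibility\<close>

definition less_in :: "'a rel \<Rightarrow> 'a \<Rightarrow> 'a \<Rightarrow> bool" where
  "less_in le x y \<longleftrightarrow> (x, y) \<in> le \<and> x \<noteq> y"

definition admissible_path :: "nat \<Rightarrow> 'a graph \<Rightarrow> 'a rel \<Rightarrow> 'a \<Rightarrow> 'a list \<Rightarrow> bool" where
  "admissible_path r G le v p \<longleftrightarrow>
     is_path G p \<and>
     (\<exists>P x. p = v # P @ [x] \<and> less_in le x v \<and> (\<forall>w\<in>set P. less_in le v w)) \<and>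
     length p - 1 \<le> r"

text \<open>Equal paths share their endpoint, which differs from the root; so sets of paths
  (rather than indexed collections) lose nothing. The tail of a path is the path without its root.\<close>

definition path_packing :: "nat \<Rightarrow> 'a graph \<Rightarrow> 'a rel \<Rightarrow> 'a \<Rightarrow> 'a list set \<Rightarrow> bool" where
  "path_packing r G le v Q \<longleftrightarrow>
     (\<forall>p\<in>Q. admissible_path r G le v p) \<and>
     (\<forall>p\<in>Q. \<forall>p'\<in>Q. p \<noteq> p' \<longrightarrow> set (tl p) \<inter> set (tl p') = {})"

definition pp :: "nat \<Rightarrow> 'a graph \<Rightarrow> 'a rel \<Rightarrow> 'a \<Rightarrow> nat" where
  "pp r G le v = Max {card Q | Q. path_packing r G le v Q}"

text \<open>On \<open>nat\<close>, \<open>SUP\<close> is the maximum of a finite nonempty set and \<open>0\<close> on the empty set (the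
  graph without vertices); \<open>INF\<close> over a nonempty set is its minimum.\<close>

definition adm_ordered :: "nat \<Rightarrow> 'a graph \<Rightarrow> 'a rel \<Rightarrow> nat" where
  "adm_ordered r G le = (SUP v\<in>verts G. pp r G le v)"

definition adm :: "nat \<Rightarrow> 'a graph \<Rightarrow> nat" where
  "adm r G = (INF le\<in>{le. linear_order_on (verts G) le}. adm_ordered r G le)"

definition bounded_adm_class :: "nat \<Rightarrow> nat \<Rightarrow> 'a graph set" where
  "bounded_adm_class p r = {G. simple_graph G \<and> adm r G \<le> p}"


section \<open>Computable functions\<close>

text \<open>General recursive functions: closure of the initial functions under composition, primitive
  recursion and minimisation of regular functions. Argument lists of every length are allowed;
  missing arguments count as \<open>0\<close>.\<close>

definition arg :: "nat \<Rightarrow> nat list \<Rightarrow> nat" where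
  "arg i xs = (if i < length xs then xs ! i else 0)"

inductive general_recursive :: "(nat list \<Rightarrow> nat) \<Rightarrow> bool" where
  zero: "general_recursive (\<lambda>xs. 0)"
| succ: "general_recursive (\<lambda>xs. Suc (arg 0 xs))"
| proj: "general_recursive (arg i)"
| comp: "general_recursive f \<Longrightarrow> (\<forall>g\<in>set gs. general_recursive g) \<Longrightarrow>
         general_recursive (\<lambda>xs. f (map (\<lambda>g. g xs) gs))"
| prim_rec: "general_recursive f \<Longrightarrow> general_recursive g \<Longrightarrow>
         general_recursive
           (\<lambda>xs. rec_nat (f (tl xs)) (\<lambda>m y. g (m # y # tl xs)) (arg 0 xs))"
| minimise: "general_recursive f \<Longrightarrow> (\<forall>xs. \<exists>m. f (m # xs) = 0) \<Longrightarrow>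
         general_recursive (\<lambda>xs. LEAST m. f (m # xs) = 0)"

definition computable :: "(nat \<Rightarrow> nat) \<Rightarrow> bool" where
  "computable f \<longleftrightarrow> (\<exists>F. general_recursive F \<and> (\<forall>x. F [x] = f x))"

definition universally_bounded_admissibility :: "'a graph set \<Rightarrow> bool" where
  "universally_bounded_admissibility \<F> \<longleftrightarrow>
     (\<exists>f. computable f \<and> (\<forall>r\<ge>1. \<F> \<subseteq> bounded_adm_class (f r) r))"


section \<open>Randomized algorithms with a random neighbour oracle\<close>

text \<open>\<open>None\<close> is the answer for a vertex without neighbours.\<close>

definition random_neighbour :: "'a graph \<Rightarrow> 'a \<Rightarrow> 'a option pmf" where
  "random_neighbour G v =
     (let N = {u. {v, u} \<in> edges G}
      in if N = {} then return_pmf None else map_pmf Some (pmf_of_set N))"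

text \<open>A randomized oracle algorithm is given by its next action as a function of the input and of
  the transcript (the results of its random choices and the oracle answers so far, latest first).
  \<open>Draw m\<close> asks for a uniformly random element of \<open>{1..m}\<close>.\<close>

datatype action = Accept | Reject | Draw nat | Query nat

definition decode_action :: "nat \<Rightarrow> action" where
  "decode_action c =
     (if c = 0 then Reject else if c = 1 then Accept
      else if even c then Draw (c div 2) else Query (c div 2))"

definition answer_code :: "nat option \<Rightarrow> nat" where
  "answer_code a = (case a of None \<Rightarrow> 0 | Some w \<Rightarrow> w)"

text \<open>Execution for at most \<open>t\<close> actions. The result is \<open>None\<close> if no verdict was reached, and
  otherwise \<open>Some\<close> of the verdict (\<open>True\<close> for accept) and the number of oracle queries made.\<close>

primrec run ::
  "(nat list \<Rightarrow> action) \<Rightarrow> (nat \<Rightarrow> nat option pmf) \<Rightarrow> nat \<Rightarrow> nat list \<Rightarrow> (bool \<times> nat) option pmf"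
where
  "run \<delta> oracle 0 h = return_pmf None"
| "run \<delta> oracle (Suc t) h =
     (case \<delta> h of
        Accept \<Rightarrow> return_pmf (Some (True, 0))
      | Reject \<Rightarrow> return_pmf (Some (False, 0))
      | Draw m \<Rightarrow> bind_pmf (pmf_of_set {1..m}) (\<lambda>x. run \<delta> oracle t (x # h))
      | Query v \<Rightarrow> bind_pmf (oracle v) (\<lambda>a.
          map_pmf (map_option (\<lambda>(b, k). (b, Suc k))) (run \<delta> oracle t (answer_code a # h))))"

text \<open>The real number \<open>\<epsilon>\<close> is handed to the algorithm as the natural number \<open>\<lceil>1/\<epsilon>\<rceil>\<close>, a finite
  description. This costs nothing: with \<open>k = \<lceil>1/\<epsilon>\<rceil>\<close> we have \<open>1/k \<le> \<epsilon>\<close>, so a graph that is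
  \<open>\<epsilon>\<close>-far from a property is \<open>1/k\<close>-far from it.\<close>

definition execution ::
  "(nat list \<Rightarrow> nat) \<Rightarrow> nat \<Rightarrow> real \<Rightarrow> nat graph \<Rightarrow> nat \<Rightarrow> (bool \<times> nat) option pmf" where
  "execution A n \<epsilon> G t =
     run (\<lambda>h. decode_action (A [n, nat \<lceil>1 / \<epsilon>\<rceil>, list_encode h])) (random_neighbour G) t []"


section \<open>Property testing\<close>

text \<open>Every edge set on \<open>verts G\<close> is reachable by additions and deletions, at a cost of the size of
  the symmetric difference. If no graph on \<open>verts G\<close> has the property, \<open>G\<close> is \<open>\<epsilon>\<close>-far.\<close>

definition far :: "real \<Rightarrow> 'a graph set \<Rightarrow> 'a graph \<Rightarrow> bool" where
  "far \<epsilon> \<P> G \<longleftrightarrow>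
     (\<forall>G'\<in>\<P>. verts G' = verts G \<longrightarrow>
        real (card ((edges G - edges G') \<union> (edges G' - edges G))) \<ge> \<epsilon> * real (card (verts G)))"

text \<open>The algorithm has to halt on every input. As random choices and oracle answers range over
  finite sets, halting on all computation paths amounts to a bound \<open>t\<close> on their lengths; it may
  depend on the input. Inputs have at least one vertex: every graph without vertices would be
  \<open>\<epsilon>\<close>-far from every property, including those that it has.\<close>

definition one_sided_tester ::
  "(nat list \<Rightarrow> nat) \<Rightarrow> nat graph set \<Rightarrow> nat graph set \<Rightarrow> bool" where
  "one_sided_tester A \<P> \<G> \<longleftrightarrow>
     general_recursive A \<and>
     (\<forall>\<epsilon>>0. \<forall>n>0. \<forall>G\<in>\<G>. verts G = {1..n} \<longrightarrow>
        (\<exists>t. None \<notin> set_pmf (execution A n \<epsilon> G t) \<and>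
             (G \<in> \<P> \<longrightarrow>
                measure_pmf.prob (execution A n \<epsilon> G t) {Some (True, k) | k. True} = 1) \<and>
             (far \<epsilon> \<P> G \<longrightarrow>
                measure_pmf.prob (execution A n \<epsilon> G t) {Some (False, k) | k. True} \<ge> 2 / 3)))"

definition query_bound ::
  "(nat list \<Rightarrow> nat) \<Rightarrow> nat graph set \<Rightarrow> (real \<Rightarrow> nat) \<Rightarrow> bool" where
  "query_bound A \<G> q \<longleftrightarrow>
     (\<forall>\<epsilon>>0. \<forall>n>0. \<forall>G\<in>\<G>. verts G = {1..n} \<longrightarrow>
        (\<forall>t b k. Some (b, k) \<in> set_pmf (execution A n \<epsilon> G t) \<longrightarrow> k \<le> q \<epsilon>))"

definition testable_on :: "nat graph set \<Rightarrow> nat graph set \<Rightarrow> bool" where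
  "testable_on \<P> \<G> \<longleftrightarrow> (\<exists>A q. one_sided_tester A \<P> \<G> \<and> query_bound A \<G> q)"

definition free_of :: "'b graph \<Rightarrow> 'a graph set" where
  "free_of H = {G. simple_graph G \<and> \<not> (\<exists>S. subgraph S G \<and> isomorphic S H)}"

definition H_testable :: "nat graph set \<Rightarrow> bool" where
  "H_testable \<F> \<longleftrightarrow> (\<forall>H :: nat graph. simple_graph H \<longrightarrow> testable_on (free_of H) \<F>)"

end

theory Submission
  imports Defs
begin

text \<open>
  Fix an order of \<open>G\<close> whose admissibility is bounded, so that weakly reachable sets have bounded
  size. If \<open>G\<close> is far from being \<open>H\<close>-free, it contains linearly many edge-disjoint copies of \<open>H\<close>.
  Colour coding keeps a constant fraction of them in which every vertex of \<open>H\<close> has its own colour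
  and the order of \<open>G\<close> induces the same order on \<open>H\<close>. This order yields an elimination forest of
  \<open>H\<close>, and in every copy the ancestors of a vertex \<open>x\<close> lie in the weakly reachable set of the image
  \<open>v\<close> of \<open>x\<close>. So there are boundedly many ways to fix the images of these ancestors, and deleting,
  for each of them and each edge \<open>xy\<close> of \<open>H\<close> that continues in less than a \<open>\<delta>\<close>-fraction of the
  neighbours of \<open>v\<close>, the few edges concerned costs only \<open>O(\<delta> n)\<close> edges. Afterwards, if some
  remaining copy maps \<open>x\<close> to \<open>v\<close>, a random neighbour of \<open>v\<close> is with probability at least \<open>\<delta>\<close> the
  image of \<open>y\<close> in a remaining copy that has the same ancestors of \<open>x\<close>.

  The search finds the vertices of a copy in increasing order. To find the image of \<open>y\<close>, it enters
  the subtree below \<open>y\<close> from the parent of \<open>y\<close> (or by a random vertex if \<open>y\<close> is a root) and walks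
  inside the subtree to \<open>y\<close>. The copies met on the way agree on the proper ancestors of \<open>y\<close>, so the
  last one can be glued into the partial copy known so far; colours make the result injective. Each
  step succeeds with probability of order \<open>\<epsilon>\<close>, and the number of steps depends on \<open>H\<close> only.
\<close>

section \<open>Weak reachability in graphs of bounded admissibility\<close>

text \<open>Degrees are unbounded, and the order, the colours and the surviving edges are invisible
  to the tester: they occur only in the analysis. So the tester makes nothing but uniform choices,
  and the analysis pays a constant factor for every choice that has to be right. Edge-disjointness
  matters twice. Each deleted edge destroys at most one copy of the packing, and many copies give
  many images of one fixed edge of \<open>H\<close>, hence many vertices from which the search can
  start, because small vertex sets span few edges. The order of the search is forced: an answer to a
  query of the image of \<open>x\<close> belongs to a new copy that may differ from the old one
  everywhere except on \<open>x\<close> and its ancestors. The vertices found earlier are safe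
  because they lie outside the subtree of the next vertex. Edges from \<open>y\<close> to smaller
  vertices need no separate argument: these vertices are ancestors of \<open>y\<close>, so the set
  of possible answers is a single known vertex, and robustness says that even this one is hit with
  constant probability. The radius is \<open>max 1 (card (verts H))\<close>, as a path inside a copy
  has at most \<open>card (verts H)\<close> vertices.\<close>

lemma is_path_appendD1: "is_path G (xs @ ys) \<Longrightarrow> xs \<noteq> [] \<Longrightarrow> is_path G xs"
  unfolding is_path_def
proof (elim conjE, intro conjI allI impI)
  fix i assume a: "\<forall>i. Suc i < length (xs @ ys) \<longrightarrow> {(xs @ ys) ! i, (xs @ ys) ! Suc i} \<in> edges G"
    and i: "Suc i < length xs"
  show "{xs ! i, xs ! Suc i} \<in> edges G" using a[rule_format, of i] i by (auto simp: nth_append)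
qed auto

lemma is_path_appendD2: "is_path G (xs @ ys) \<Longrightarrow> ys \<noteq> [] \<Longrightarrow> is_path G ys"
  unfolding is_path_def
proof (elim conjE, intro conjI allI impI)
  fix i assume a: "\<forall>i. Suc i < length (xs @ ys) \<longrightarrow> {(xs @ ys) ! i, (xs @ ys) ! Suc i} \<in> edges G"
    and i: "Suc i < length ys"
  show "{ys ! i, ys ! Suc i} \<in> edges G" using a[rule_format, of "length xs + i"] i
    by (auto simp: nth_append)
qed auto

lemma finite_paths: "simple_graph G \<Longrightarrow> finite {p. is_path G p}"
  by (rule finite_subset[OF _ finite_subset_distinct[of "verts G"]])
     (auto simp: is_path_def simple_graph_def)

lemma card_packing_le_pp:
  assumes "simple_graph G" "path_packing r G le v Q"
  shows "card Q \<le> pp r G le v"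
proof -
  have fin: "finite {card Q | Q. path_packing r G le v Q}"
  proof (rule finite_subset)
    show "{card Q | Q. path_packing r G le v Q} \<subseteq> card ` Pow {p. is_path G p}"
      by (auto simp: path_packing_def admissible_path_def)
    show "finite (card ` Pow {p. is_path G p})" using finite_paths[OF assms(1)] by simp
  qed
  show ?thesis unfolding pp_def by (rule Max_ge[OF fin]) (use assms(2) in auto)
qed

text \<open>A packing has at most \<open>p\<close> paths with at most \<open>Suc j\<close> vertices
  besides the root; each of these vertices contributes itself and what shorter paths reach from
  it.\<close>

primrec reach_bound :: "nat \<Rightarrow> nat \<Rightarrow> nat" where
  "reach_bound p 0 = 0"
| "reach_bound p (Suc j) = p * Suc j * Suc (reach_bound p j)"

locale adm_graph =
  fixes G :: "'a graph" and le :: "'a rel" and r p :: nat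
  assumes simple: "simple_graph G"
    and linear: "linear_order_on (verts G) le"
    and pp_le: "v \<in> verts G \<Longrightarrow> pp r G le v \<le> p"
begin

abbreviation less :: "'a \<Rightarrow> 'a \<Rightarrow> bool" (infix "\<sqsubset>" 50) where "x \<sqsubset> y \<equiv> less_in le x y"

lemma finite_verts: "finite (verts G)"
  using simple by (simp add: simple_graph_def)

lemma less_trans: "x \<sqsubset> y \<Longrightarrow> y \<sqsubset> z \<Longrightarrow> x \<sqsubset> z"
  using linear unfolding less_in_def order_on_defs
  by (metis antisymD transD)

lemma less_irrefl: "\<not> x \<sqsubset> x"
  by (simp add: less_in_def)

lemma less_total: "x \<in> verts G \<Longrightarrow> y \<in> verts G \<Longrightarrow> x \<noteq> y \<Longrightarrow> x \<sqsubset> y \<or> y \<sqsubset> x"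
  using linear unfolding less_in_def order_on_defs total_on_def by metis

text \<open>The threshold \<open>v\<close> is kept apart from the start \<open>w\<close>, because
  the induction on the length moves the start along a path while the threshold stays. For
  \<open>w = v\<close> these are the admissible paths of length at most \<open>j\<close>.\<close>

definition below_path :: "nat \<Rightarrow> 'a \<Rightarrow> 'a \<Rightarrow> 'a list \<Rightarrow> bool" where
  "below_path j v w q \<longleftrightarrow> is_path G q \<and>
     (\<exists>P x. q = w # P @ [x] \<and> x \<sqsubset> v \<and> (\<forall>z\<in>set P. v \<sqsubset> z) \<and> Suc (length P) \<le> j)"

text \<open>The path is cut at its first vertex below \<open>w\<close>. There is one, since the end
  lies below \<open>v\<close> and hence below \<open>w\<close>, and everything before the cut lies
  above \<open>w\<close>.\<close>

lemma below_path_truncate: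
  assumes "below_path j v w q" "v = w \<or> v \<sqsubset> w" "j \<le> r"
  shows "\<exists>q'. admissible_path r G le w q' \<and> set (tl q') \<subseteq> set (tl q)"
proof -
  from assms(1) obtain P x where q: "q = w # P @ [x]" "x \<sqsubset> v" "\<forall>z\<in>set P. v \<sqsubset> z" "Suc (length P) \<le> j"
    and path: "is_path G q" unfolding below_path_def by blast
  have xw: "x \<sqsubset> w" using q(2) assms(2) less_trans by blast
  obtain ys y zs where split: "P @ [x] = ys @ y # zs" "y \<sqsubset> w" "\<forall>z\<in>set ys. \<not> z \<sqsubset> w"
    using split_list_first_prop[of "P @ [x]" "\<lambda>z. z \<sqsubset> w"] xw by auto
  have "is_path G ((w # ys @ [y]) @ zs)" using path q(1) split(1) by simp
  from is_path_appendD1[OF this] have p': "is_path G (w # ys @ [y])" by simp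
  have gt: "w \<sqsubset> z" if "z \<in> set ys" for z
    using p' that split(3) less_total[of z w] unfolding is_path_def by auto
  have len: "length P + 1 = length ys + 1 + length zs" using arg_cong[OF split(1), of length] by simp
  have "admissible_path r G le w (w # ys @ [y])"
    unfolding admissible_path_def using p' gt split(2) len q(4) assms(3) by auto
  moreover have "set (ys @ [y]) \<subseteq> set (P @ [x])" unfolding split(1) by auto
  ultimately show ?thesis using q(1) by (intro exI[of _ "w # ys @ [y]"]) auto
qed

text \<open>Truncation shrinks tails, so they stay disjoint; being nonempty, they also show that it
  is injective. Thus the bound on admissible packings at \<open>w\<close> carries over to the
  threshold \<open>v\<close>.\<close>

lemma card_below_packing_le:
  assumes Q: "\<And>q. q \<in> Q \<Longrightarrow> below_path j v w q"
    and disj: "\<And>q q'. q \<in> Q \<Longrightarrow> q' \<in> Q \<Longrightarrow> q \<noteq> q' \<Longrightarrow> set (tl q) \<inter> set (tl q') = {}"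
    and w: "v = w \<or> v \<sqsubset> w" "w \<in> verts G" and j: "j \<le> r"
  shows "card Q \<le> p"
proof -
  have "\<forall>q\<in>Q. \<exists>q'. admissible_path r G le w q' \<and> set (tl q') \<subseteq> set (tl q)"
    using below_path_truncate Q w j by blast
  then obtain f where f: "\<And>q. q \<in> Q \<Longrightarrow> admissible_path r G le w (f q) \<and> set (tl (f q)) \<subseteq> set (tl q)"
    by metis
  have ne: "set (tl (f q)) \<noteq> {}" if "q \<in> Q" for q
    using f[OF that] unfolding admissible_path_def by auto
  have inj: "inj_on f Q" using f ne disj by (intro inj_onI) (metis Int_greatest subset_empty)
  have "path_packing r G le w (f ` Q)"
    unfolding path_packing_def
  proof (intro conjI ballI impI)
    fix a b assume "a \<in> f ` Q" "b \<in> f ` Q" "a \<noteq> b"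
    then obtain q q' where qq: "q \<in> Q" "q' \<in> Q" "a = f q" "b = f q'" "q \<noteq> q'" by auto
    then show "set (tl a) \<inter> set (tl b) = {}" using f[of q] f[of q'] disj[of q q'] by blast
  qed (use f in auto)
  from card_packing_le_pp[OF simple this] card_image[OF inj] pp_le[OF w(2)] show ?thesis by simp
qed

definition below_reach :: "nat \<Rightarrow> 'a \<Rightarrow> 'a \<Rightarrow> 'a set" where
  "below_reach j v w = {x. \<exists>q. below_path j v w q \<and> last q = x}"

lemma below_reach_subset: "below_reach j v w \<subseteq> verts G"
  unfolding below_reach_def below_path_def is_path_def by auto

lemma finite_below_reach: "finite (below_reach j v w)"
  by (rule finite_subset[OF below_reach_subset finite_verts])

text \<open>Every path from \<open>w\<close> meets a maximal packing, and continues from there by a shorter path.\<close>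

lemma card_below_reach:
  assumes "j \<le> r" "w \<in> verts G" "v = w \<or> v \<sqsubset> w"
  shows "card (below_reach j v w) \<le> reach_bound p j"
  using assms
proof (induction j arbitrary: w)
  case 0
  then show ?case by (simp add: below_reach_def below_path_def)
next
  case (Suc j)
  define packs where "packs = {Q. (\<forall>q\<in>Q. below_path (Suc j) v w q) \<and>
     (\<forall>q\<in>Q. \<forall>q'\<in>Q. q \<noteq> q' \<longrightarrow> set (tl q) \<inter> set (tl q') = {})}"
  have fin: "finite Q" if "Q \<in> packs" for Q
    using that finite_subset[OF _ finite_paths[OF simple]] unfolding packs_def below_path_def by auto
  have bound: "card Q \<le> p" if "Q \<in> packs" for Q
    using that Suc.prems unfolding packs_def by (intro card_below_packing_le[of Q "Suc j" v w]) auto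
  have "{} \<in> packs" by (simp add: packs_def)
  then obtain Q where Q: "Q \<in> packs" and max: "\<And>Q'. Q' \<in> packs \<Longrightarrow> card Q' \<le> card Q"
    using ex_has_greatest_nat[of "\<lambda>Q. Q \<in> packs" "{}" card "Suc p"] bound by (auto simp: le_imp_less_Suc)
  define X where "X = (\<Union>q\<in>Q. set (tl q))"
  have finX: "finite X" unfolding X_def using fin[OF Q] by auto
  have cardX: "card X \<le> p * Suc j"
  proof -
    have "card X \<le> (\<Sum>q\<in>Q. card (set (tl q)))" unfolding X_def by (rule card_UN_le[OF fin[OF Q]])
    also have "\<dots> \<le> (\<Sum>q\<in>Q. Suc j)"
    proof (rule sum_mono)
      fix q assume "q \<in> Q"
      then have "length (tl q) \<le> Suc j" using Q unfolding packs_def below_path_def by auto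
      then show "card (set (tl q)) \<le> Suc j" using card_length le_trans by blast
    qed
    also have "\<dots> \<le> p * Suc j" using bound[OF Q] by (simp add: mult_right_mono del: mult_Suc_right)
    finally show ?thesis .
  qed
  have hit: "set (tl q) \<inter> X \<noteq> {}" if q: "below_path (Suc j) v w q" for q
  proof
    assume e: "set (tl q) \<inter> X = {}"
    have "insert q Q \<in> packs" using Q q e unfolding packs_def X_def by auto
    moreover have "q \<notin> Q"
    proof
      assume "q \<in> Q"
      then have "set (tl q) \<subseteq> X" by (auto simp: X_def)
      then have "tl q = []" using e by (metis inf.absorb1 set_empty2)
      then show False using q unfolding below_path_def by force
    qed
    ultimately show False using max[of "insert q Q"] fin[OF Q] by auto
  qed
  \<comment> \<open>A vertex of the packing may be the end of the path and then counts only itself;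
    if it is an inner vertex, it lies above \<open>v\<close>, as the induction hypothesis
    requires.\<close>
  define U where "U = (\<lambda>x. insert x (if v \<sqsubset> x \<and> x \<in> verts G then below_reach j v x else {}))"
  have "below_reach (Suc j) v w \<subseteq> (\<Union>x\<in>X. U x)"
  proof
    fix u assume "u \<in> below_reach (Suc j) v w"
    then obtain q where q: "below_path (Suc j) v w q" "last q = u" by (auto simp: below_reach_def)
    then obtain P where P: "q = w # P @ [u]" "u \<sqsubset> v" "\<forall>z\<in>set P. v \<sqsubset> z" "length P \<le> j"
      and path: "is_path G q" unfolding below_path_def by auto
    from hit[OF q(1)] obtain x where x: "x \<in> X" "x \<in> set (P @ [u])" using P(1) by auto
    show "u \<in> (\<Union>x\<in>X. U x)"
    proof (cases "x = u")
      case True then show ?thesis using x unfolding U_def by auto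
    next
      case False
      then have "x \<in> set P" using x by simp
      then obtain P1 P2 where P12: "P = P1 @ x # P2" by (meson split_list)
      have "is_path G ((w # P1) @ (x # P2 @ [u]))" using path P(1) P12 by simp
      from is_path_appendD2[OF this] have px: "is_path G (x # P2 @ [u])" by simp
      then have "below_path j v x (x # P2 @ [u])"
        unfolding below_path_def using P P12 by auto
      then have "u \<in> below_reach j v x" unfolding below_reach_def by fastforce
      moreover have "v \<sqsubset> x" "x \<in> verts G" using P(3) P12 px by (auto simp: is_path_def)
      ultimately show ?thesis using x(1) unfolding U_def by auto
    qed
  qed
  moreover have "finite (\<Union>x\<in>X. U x)" using finX finite_below_reach unfolding U_def by auto
  ultimately have "card (below_reach (Suc j) v w) \<le> card (\<Union>x\<in>X. U x)" by (rule card_mono[rotated])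
  also have "\<dots> \<le> (\<Sum>x\<in>X. card (U x))" by (rule card_UN_le[OF finX])
  also have "\<dots> \<le> (\<Sum>x\<in>X. Suc (reach_bound p j))"
  proof (rule sum_mono)
    fix x
    show "card (U x) \<le> Suc (reach_bound p j)"
    proof (cases "v \<sqsubset> x \<and> x \<in> verts G")
      case True
      then have "card (below_reach j v x) \<le> reach_bound p j" using Suc by auto
      then show ?thesis using True unfolding U_def
        by (simp add: card_insert_if finite_below_reach)
    next
      case False
      then show ?thesis unfolding U_def by auto
    qed
  qed
  also have "\<dots> \<le> p * Suc j * Suc (reach_bound p j)" using cardX by (simp add: mult_right_mono del: mult_Suc_right)
  finally show ?case by simp
qed

text \<open>The strongly \<open>r\<close>-reachable set, without \<open>v\<close> itself.\<close>

definition reach :: "'a \<Rightarrow> 'a set" where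
  "reach v = below_reach r v v"

definition reach_card :: nat where
  "reach_card = reach_bound p r"

lemma reach_subset: "reach v \<subseteq> verts G"
  using below_reach_subset by (simp add: reach_def)

lemma finite_reach: "finite (reach v)"
  by (simp add: reach_def finite_below_reach)

lemma card_reach: "v \<in> verts G \<Longrightarrow> card (reach v) \<le> reach_card"
  using card_below_reach[of r v v] by (simp add: reach_def reach_card_def)

lemma reachI:
  assumes "is_path G (v # P @ [x])" "x \<sqsubset> v" "\<forall>z\<in>set P. v \<sqsubset> z" "Suc (length P) \<le> r"
  shows "x \<in> reach v"
  unfolding reach_def below_reach_def below_path_def
  by (rule CollectI, rule exI[of _ "v # P @ [x]"]) (use assms in auto)

lemma edge_reach:
  assumes "{u, v} \<in> edges G" "u \<sqsubset> v" "1 \<le> r"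
  shows "u \<in> reach v"
proof -
  have "u \<noteq> v" "u \<in> verts G" "v \<in> verts G" using assms(1,2) simple unfolding simple_graph_def less_in_def by auto
  then have "is_path G (v # [] @ [u])" using assms(1) unfolding is_path_def by (auto simp: insert_commute)
  then show ?thesis using assms(2,3) by (intro reachI[of v "[]"]) auto
qed

text \<open>Iterated strong reachability. For \<open>j \<le> r\<close> it contains the weakly
  \<open>j\<close>-reachable vertices, those that are the minimum of a path of length at most
  \<open>j\<close> from \<open>v\<close>.\<close>

primrec wreach :: "nat \<Rightarrow> 'a \<Rightarrow> 'a set" where
  "wreach 0 v = {v}"
| "wreach (Suc j) v = insert v (\<Union>u\<in>reach v. wreach j u)"

lemma finite_wreach: "finite (wreach j v)"
  by (induction j arbitrary: v) (auto simp: finite_reach)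

lemma card_wreach: "v \<in> verts G \<Longrightarrow> card (wreach j v) \<le> Suc reach_card ^ j"
proof (induction j arbitrary: v)
  case (Suc j)
  have "card (wreach (Suc j) v) \<le> Suc (card (\<Union>u\<in>reach v. wreach j u))"
    by (simp add: card_insert_if finite_reach finite_wreach)
  also have "card (\<Union>u\<in>reach v. wreach j u) \<le> (\<Sum>u\<in>reach v. card (wreach j u))"
    by (rule card_UN_le[OF finite_reach])
  also have "\<dots> \<le> (\<Sum>u\<in>reach v. Suc reach_card ^ j)"
    using Suc.IH reach_subset by (intro sum_mono) blast
  also have "\<dots> \<le> reach_card * Suc reach_card ^ j"
    using card_reach[OF Suc.prems] by simp
  also have "Suc (reach_card * Suc reach_card ^ j) \<le> Suc reach_card ^ Suc j" by simp
  finally show ?case by simp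
qed simp

text \<open>The first vertex below the start is strongly reachable from it; the rest of the path has
  the same minimum and is shorter, which costs one iteration less.\<close>

lemma path_to_min_wreach:
  assumes "is_path G (q @ [u])" "length q \<le> j" "j \<le> r" "\<forall>z\<in>set q. u \<sqsubset> z"
  shows "u \<in> wreach j (hd (q @ [u]))"
  using assms
proof (induction j arbitrary: q)
  case 0
  then show ?case by simp
next
  case (Suc j)
  show ?case
  proof (cases q)
    case Nil
    then show ?thesis by simp
  next
    case (Cons v P)
    have "u \<sqsubset> v" using Suc.prems(4) Cons by simp
    then obtain ys y zs where split: "P @ [u] = ys @ y # zs" "y \<sqsubset> v" "\<forall>z\<in>set ys. \<not> z \<sqsubset> v"
      using split_list_first_prop[of "P @ [u]" "\<lambda>z. z \<sqsubset> v"] by auto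
    have full: "is_path G (v # ys @ y # zs)" using Suc.prems(1) Cons split(1) by simp
    then have pv: "is_path G (v # ys @ [y])" using is_path_appendD1[of G "v # ys @ [y]" zs] by simp
    have gt: "v \<sqsubset> z" if "z \<in> set ys" for z
      using pv that split(3) less_total[of z v] unfolding is_path_def by auto
    have len: "length P + 1 = length ys + 1 + length zs" using arg_cong[OF split(1), of length] by simp
    have yv: "y \<in> reach v"
      using reachI[of v ys y] pv split(2) gt len Suc.prems(2,3) Cons by auto
    have py: "is_path G (y # zs)" using is_path_appendD2[of G "v # ys" "y # zs"] full by simp
    obtain q' u' where "y # zs = q' @ [u']" by (cases "y # zs" rule: rev_cases) auto
    with split(1) have q': "y # zs = q' @ [u]" and "P = ys @ q'" by (simp_all flip: append_assoc)
    then have "set q' \<subseteq> set P" by simp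
    moreover have "length q' = length zs" using arg_cong[OF q', of length] by simp
    ultimately have "u \<in> wreach j (hd (q' @ [u]))"
      using Suc.prems Cons len q' py by (intro Suc.IH) auto
    then have "u \<in> wreach j y" using arg_cong[OF q', of hd] by simp
    then show ?thesis using yv Cons by auto
  qed
qed

text \<open>Each edge is charged to its larger end, whose strongly reachable set contains the
  smaller end.\<close>

lemma card_edges_le:
  assumes "1 \<le> r" "E \<subseteq> edges G" "\<And>e. e \<in> E \<Longrightarrow> e \<subseteq> W" "W \<subseteq> verts G"
  shows "card E \<le> reach_card * card W"
proof -
  have finW: "finite W" using assms(4) finite_verts finite_subset by blast
  have "E \<subseteq> (\<Union>v\<in>W. (\<lambda>u. {u, v}) ` reach v)"
  proof
    fix e assume e: "e \<in> E"
    then have "card e = 2" "e \<subseteq> verts G" using assms(2) simple by (auto simp: simple_graph_def)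
    then obtain a b where ab: "e = {a, b}" "a \<noteq> b" by (auto simp: card_2_iff)
    then consider "a \<sqsubset> b" | "b \<sqsubset> a" using less_total[of a b] \<open>e \<subseteq> verts G\<close> by auto
    then show "e \<in> (\<Union>v\<in>W. (\<lambda>u. {u, v}) ` reach v)"
    proof cases
      case 1
      then have "a \<in> reach b" using edge_reach[of a b] e ab assms by auto
      then show ?thesis using ab assms(3)[OF e] by auto
    next
      case 2
      then have "b \<in> reach a" using edge_reach[of b a] e ab assms by (auto simp: insert_commute)
      then show ?thesis using ab assms(3)[OF e] by (auto simp: insert_commute)
    qed
  qed
  then have "card E \<le> card (\<Union>v\<in>W. (\<lambda>u. {u, v}) ` reach v)"
    by (intro card_mono) (auto simp: finW finite_reach)
  also have "\<dots> \<le> (\<Sum>v\<in>W. card ((\<lambda>u. {u, v}) ` reach v))" by (rule card_UN_le[OF finW])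
  also have "\<dots> \<le> (\<Sum>v\<in>W. reach_card)"
    using card_reach assms(4) by (intro sum_mono le_trans[OF card_image_le[OF finite_reach]]) blast
  finally show ?thesis by (simp add: mult.commute)
qed

end

text \<open>An infimum over a nonempty set of naturals is attained, so some order realises
  it.\<close>

lemma ex_adm_graph:
  assumes "G \<in> bounded_adm_class p r"
  shows "\<exists>le. adm_graph G le r p"
proof -
  have sg: "simple_graph G" and a: "adm r G \<le> p" using assms by (auto simp: bounded_adm_class_def)
  obtain le0 :: "'a rel" where "well_order_on (verts G) le0" using well_order_on by blast
  then have "{le. linear_order_on (verts G) le} \<noteq> {}" by (auto simp: well_order_on_def)
  then have "adm r G \<in> (\<lambda>le. adm_ordered r G le) ` {le. linear_order_on (verts G) le}"
    unfolding adm_def by (intro Inf_nat_def1) auto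
  then obtain le where le: "linear_order_on (verts G) le" "adm_ordered r G le \<le> p" using a by auto
  have "pp r G le v \<le> p" if "v \<in> verts G" for v
  proof -
    have "finite (verts G)" using sg by (simp add: simple_graph_def)
    then have "pp r G le v \<le> adm_ordered r G le"
      unfolding adm_ordered_def using that by (intro cSUP_upper) auto
    then show ?thesis using le(2) by simp
  qed
  then show ?thesis using sg le(1) by (intro exI[of _ le]) (unfold_locales, auto)
qed


section \<open>Elimination trees and robust subgraphs\<close>

text \<open>If the vertex to be prepended already occurs, the list is shortened so as to start at
  that occurrence.\<close>

lemma rtrancl_distinct_path:
  assumes "(a, b) \<in> R\<^sup>*"
  shows "\<exists>xs. distinct (xs @ [b]) \<and> hd (xs @ [b]) = a \<and> successively (\<lambda>x y. (x, y) \<in> R) (xs @ [b])"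
  using assms
proof (induction rule: converse_rtrancl_induct)
  case base
  then show ?case by (intro exI[of _ "[]"]) auto
next
  case (step a c)
  then obtain xs where xs: "distinct (xs @ [b])" "hd (xs @ [b]) = c"
    "successively (\<lambda>x y. (x, y) \<in> R) (xs @ [b])" by blast
  consider "a = b" | "a \<noteq> b" "a \<in> set xs" | "a \<noteq> b" "a \<notin> set xs" by blast
  then show ?case
  proof cases
    case 1
    then show ?thesis by (intro exI[of _ "[]"]) auto
  next
    case 2
    then obtain ys zs where "xs = ys @ a # zs" by (meson split_list)
    then show ?thesis using xs by (intro exI[of _ "a # zs"]) (auto simp: successively_append_iff)
  next
    case 3
    then show ?thesis using xs step(1)
      by (intro exI[of _ "a # xs"]) (auto simp: successively_Cons)
  qed
qed

section \<open>The elimination forest of an ordered pattern\<close>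

locale pattern =
  fixes K :: "'b set" and EH :: "'b set set" and \<rho> :: "'b \<Rightarrow> nat"
  assumes finite_K: "finite K"
    and EH: "e \<in> EH \<Longrightarrow> e \<subseteq> K \<and> card e = 2"
    and inj_\<rho>: "inj_on \<rho> K"
begin

lemma edge_in_K: "{a, b} \<in> EH \<Longrightarrow> a \<in> K \<and> b \<in> K \<and> a \<noteq> b"
  using EH[of "{a, b}"] by auto

definition step_above :: "'b \<Rightarrow> ('b \<times> 'b) set" where
  "step_above y = {(a, b). {a, b} \<in> EH \<and> \<rho> y \<le> \<rho> a \<and> \<rho> y \<le> \<rho> b}"

text \<open>The ancestor relation of the elimination forest: a walk from \<open>t\<close> to
  \<open>y\<close> exists on which \<open>y\<close> has the smallest rank. This is weak reachability
  inside \<open>H\<close> without a bound on the length.\<close>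

definition anc :: "'b \<Rightarrow> 'b \<Rightarrow> bool" where
  "anc y t \<longleftrightarrow> y \<in> K \<and> t \<in> K \<and> (t, y) \<in> (step_above y)\<^sup>*"

lemma sym_step_above: "sym ((step_above y)\<^sup>*)"
  by (rule sym_rtrancl) (auto simp: step_above_def sym_def insert_commute)

lemma step_above_mono: "\<rho> s \<le> \<rho> y \<Longrightarrow> (step_above y)\<^sup>* \<subseteq> (step_above s)\<^sup>*"
  by (rule rtrancl_mono) (auto simp: step_above_def)

lemma anc_refl: "x \<in> K \<Longrightarrow> anc x x"
  by (simp add: anc_def)

lemma anc_in_K: "anc s t \<Longrightarrow> s \<in> K \<and> t \<in> K"
  by (simp add: anc_def)

lemma anc_le: "anc y t \<Longrightarrow> \<rho> y \<le> \<rho> t"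
  unfolding anc_def by (auto elim!: converse_rtranclE simp: step_above_def)

lemma anc_less: "anc y t \<Longrightarrow> y \<noteq> t \<Longrightarrow> \<rho> y < \<rho> t"
  using anc_le anc_in_K inj_\<rho> by (metis inj_onD le_neq_implies_less)

lemma anc_trans: "anc s y \<Longrightarrow> anc y t \<Longrightarrow> anc s t"
  using anc_le[of s y] step_above_mono[of s y] unfolding anc_def
  by (meson rtrancl_trans subsetD)

text \<open>Reversing the walk from \<open>t\<close> to \<open>s\<close> and continuing from
  \<open>t\<close> to \<open>y\<close> never drops below the rank of \<open>y\<close>. So the
  ancestors of a vertex form a chain.\<close>

lemma anc_chain:
  assumes "anc s t" "anc y t" "\<rho> y \<le> \<rho> s"
  shows "anc y s"
  using assms step_above_mono[of y s] sym_step_above[of s] unfolding anc_def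
  by (meson rtrancl_trans subsetD symD)

text \<open>The step to \<open>u\<close> prolongs the walk without dropping below the rank of
  \<open>y\<close>; edges leave a subtree only downwards.\<close>

lemma anc_adj:
  assumes "{t, u} \<in> EH" "anc y t" "\<rho> y \<le> \<rho> u"
  shows "anc y u"
proof -
  have "(u, t) \<in> step_above y"
    using assms anc_le[OF assms(2)] by (simp add: step_above_def insert_commute)
  then show ?thesis using assms edge_in_K[OF assms(1)] unfolding anc_def
    by (meson converse_rtrancl_into_rtrancl)
qed

lemma anc_edge: "{s, t} \<in> EH \<Longrightarrow> \<rho> s \<le> \<rho> t \<Longrightarrow> anc s t"
  using anc_adj[of s t s] anc_refl[of s] edge_in_K by blast

text \<open>Prepares \<open>path_to_min_wreach\<close>: distinctness makes the image in
  \<open>G\<close> a path, and inner vertices in the subtree of \<open>s\<close> make the image of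
  \<open>s\<close> its minimum.\<close>

lemma anc_path:
  assumes "anc s t"
  shows "\<exists>xs. distinct (xs @ [s]) \<and> hd (xs @ [s]) = t \<and> set xs \<subseteq> K \<and>
    successively (\<lambda>x y. {x, y} \<in> EH) (xs @ [s]) \<and> (\<forall>x\<in>set xs. anc s x \<and> x \<noteq> s)"
proof -
  from assms obtain xs where xs: "distinct (xs @ [s])" "hd (xs @ [s]) = t"
    "successively (\<lambda>x y. (x, y) \<in> step_above s) (xs @ [s])"
    using rtrancl_distinct_path[of t s "step_above s"] by (auto simp: anc_def)
  have sK: "s \<in> K" using assms anc_in_K by blast
  \<comment> \<open>Membership in the subtree is propagated backwards, from the end \<open>s\<close>
    of the walk to its start.\<close>
  have *: "\<forall>x\<in>set ys. anc s x" if "successively (\<lambda>x y. (x, y) \<in> step_above s) (ys @ [s])" for ys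
    using that
  proof (induction ys)
    case (Cons a ys)
    have suc: "successively (\<lambda>x y. (x, y) \<in> step_above s) (ys @ [s])"
      and a: "(a, hd (ys @ [s])) \<in> step_above s"
      using Cons.prems by (cases ys; simp)+
    have "anc s (hd (ys @ [s]))" using Cons.IH[OF suc] anc_refl[OF sK] by (cases ys) auto
    then have "anc s a" using a anc_adj[of "hd (ys @ [s])" a s]
      by (simp add: step_above_def insert_commute)
    then show ?case using Cons.IH[OF suc] by simp
  qed simp
  have "successively (\<lambda>x y. {x, y} \<in> EH) (xs @ [s])"
    by (rule successively_mono[OF xs(3)]) (auto simp: step_above_def)
  then show ?thesis using xs *[OF xs(3)] anc_in_K by (intro exI[of _ xs]) auto
qed

end

section \<open>Coloured copies of the pattern and how to glue them\<close>

locale pattern_in_graph = adm_graph G le r p + pattern K EH \<rho>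
  for G :: "'a graph" and le r p and K :: "'b set" and EH and \<rho> :: "'b \<Rightarrow> nat" +
  fixes col :: "'a \<Rightarrow> 'b"
  assumes card_K: "card K \<le> r" and r_pos: "1 \<le> r"
begin

text \<open>The order is demanded only between ancestors and descendants, because gluing two copies
  may spoil it between unrelated vertices. The colours give injectivity, which therefore also
  survives gluing.\<close>

definition homs :: "'a set set \<Rightarrow> ('b \<Rightarrow> 'a) set" where
  "homs E = {\<phi> \<in> K \<rightarrow>\<^sub>E verts G. (\<forall>x\<in>K. col (\<phi> x) = x) \<and> (\<forall>a b. {a, b} \<in> EH \<longrightarrow> {\<phi> a, \<phi> b} \<in> E) \<and>
     (\<forall>s t. anc s t \<longrightarrow> s \<noteq> t \<longrightarrow> \<phi> s \<sqsubset> \<phi> t)}"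

lemma homs_mono: "E \<subseteq> E' \<Longrightarrow> homs E \<subseteq> homs E'"
  unfolding homs_def by (auto dest: subsetD)

lemma finite_homs: "finite (homs E)"
  unfolding homs_def by (rule finite_subset[of _ "K \<rightarrow>\<^sub>E verts G"])
    (auto intro: finite_PiE finite_K finite_verts)

lemma homs_verts: "\<phi> \<in> homs E \<Longrightarrow> x \<in> K \<Longrightarrow> \<phi> x \<in> verts G"
  unfolding homs_def by auto

lemma homs_inj: "\<phi> \<in> homs E \<Longrightarrow> inj_on \<phi> K"
  unfolding homs_def by (intro inj_onI) (auto, metis)

lemma homs_edge: "\<phi> \<in> homs E \<Longrightarrow> {a, b} \<in> EH \<Longrightarrow> {\<phi> a, \<phi> b} \<in> E"
  unfolding homs_def by auto

text \<open>A path inside the subtree of \<open>s\<close> is mapped to a path of \<open>G\<close>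
  with minimum \<open>\<phi> s\<close>, short enough because \<open>card K \<le> r\<close>.\<close>

lemma homs_anc_wreach:
  assumes "\<phi> \<in> homs E" "E \<subseteq> edges G" "anc s t"
  shows "\<phi> s \<in> wreach (card K) (\<phi> t)"
proof -
  obtain xs where xs: "distinct (xs @ [s])" "hd (xs @ [s]) = t" "set xs \<subseteq> K"
    "successively (\<lambda>x y. {x, y} \<in> EH) (xs @ [s])" "\<forall>x\<in>set xs. anc s x \<and> x \<noteq> s"
    using anc_path[OF assms(3)] by blast
  have sK: "s \<in> K" using anc_in_K assms(3) by blast
  have "is_path G (map \<phi> (xs @ [s]))"
    unfolding is_path_def
  proof (intro conjI allI impI)
    show "distinct (map \<phi> (xs @ [s]))"
      unfolding distinct_map
      using xs(1,3) sK inj_on_subset[OF homs_inj[OF assms(1)], of "set (xs @ [s])"] by simp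
    show "set (map \<phi> (xs @ [s])) \<subseteq> verts G"
      using homs_verts[OF assms(1)] xs sK by auto
    fix i assume "Suc i < length (map \<phi> (xs @ [s]))"
    then show "{map \<phi> (xs @ [s]) ! i, map \<phi> (xs @ [s]) ! Suc i} \<in> edges G"
      using homs_edge[OF assms(1)] assms(2) successively_nth[OF xs(4), of i]
      by (auto simp del: map_append)
  qed simp
  moreover have "length xs \<le> card K"
    using xs(1,3) by (metis card_mono distinct_append distinct_card finite_K)
  moreover have "\<forall>z\<in>set (map \<phi> xs). \<phi> s \<sqsubset> z"
    using assms(1) xs(5) unfolding homs_def by auto
  ultimately have "\<phi> s \<in> wreach (card K) (hd (map \<phi> xs @ [\<phi> s]))"
    using card_K by (intro path_to_min_wreach) auto
  moreover have "hd (map \<phi> xs @ [\<phi> s]) = \<phi> t" using xs(2) by (cases xs) auto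
  ultimately show ?thesis by simp
qed

text \<open>The subtree of \<open>y\<close> is joined to the rest of the pattern only through proper
  ancestors of \<open>y\<close>, and on these the two copies agree.\<close>

lemma homs_glue:
  assumes "\<phi> \<in> homs E" "\<phi>' \<in> homs E" "\<And>s. anc s y \<Longrightarrow> s \<noteq> y \<Longrightarrow> \<phi>' s = \<phi> s"
  shows "(\<lambda>t. if anc y t then \<phi>' t else \<phi> t) \<in> homs E"
proof -
  let ?\<psi> = "\<lambda>t. if anc y t then \<phi>' t else \<phi> t"
  \<comment> \<open>An ancestor \<open>s\<close> of a vertex of the subtree that is itself outside
    the subtree must, by the chain property, be a proper ancestor of \<open>y\<close>.\<close>
  have bd: "\<phi>' s = \<phi> s" if "anc s t" "anc y t" "\<not> anc y s" for s t
  proof -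
    have "\<not> \<rho> y \<le> \<rho> s" using anc_chain[OF that(1,2)] that(3) by blast
    then show ?thesis using anc_chain[OF that(2,1)] assms(3)[of s] by fastforce
  qed
  have 1: "?\<psi> \<in> K \<rightarrow>\<^sub>E verts G"
    using assms(1,2) anc_in_K unfolding homs_def PiE_def extensional_def by auto
  have edge: "{?\<psi> a, ?\<psi> b} \<in> E" if e: "{a, b} \<in> EH" "anc y a" for a b
  proof (cases "anc y b")
    case True
    then show ?thesis using that homs_edge[OF assms(2)] by auto
  next
    case False
    \<comment> \<open>An edge leaving the subtree goes down in rank, hence to an ancestor, where
      both copies agree.\<close>
    then have "\<not> \<rho> y \<le> \<rho> b" using anc_adj e by blast
    then have "anc b a" using anc_edge[of b a] e anc_le[OF e(2)] by (auto simp: insert_commute)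
    then have "\<phi>' b = \<phi> b" using bd e False by blast
    then show ?thesis using e False homs_edge[OF assms(2), of a b] by auto
  qed
  have 2: "{?\<psi> a, ?\<psi> b} \<in> E" if e: "{a, b} \<in> EH" for a b
  proof -
    consider "anc y a" | "anc y b" | "\<not> anc y a" "\<not> anc y b" by blast
    then show ?thesis
    proof cases
      case 1 then show ?thesis using edge[OF e] by simp
    next
      case 2
      have "{b, a} \<in> EH" using e by (simp add: insert_commute)
      from edge[OF this 2] show ?thesis by (simp only: insert_commute)
    next
      case 3 then show ?thesis using homs_edge[OF assms(1) e] by simp
    qed
  qed
  have 3: "?\<psi> s \<sqsubset> ?\<psi> t" if "anc s t" "s \<noteq> t" for s t
  proof (cases "anc y t")
    case True
    then have "?\<psi> s = \<phi>' s" using bd[OF that(1)] by auto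
    then show ?thesis using True assms(2) that unfolding homs_def by auto
  next
    case False
    then have "\<not> anc y s" using anc_trans that by blast
    then show ?thesis using False assms(1) that unfolding homs_def by auto
  qed
  have "\<forall>x\<in>K. col (?\<psi> x) = x" using assms(1,2) unfolding homs_def by auto
  then show ?thesis using 1 2 3 unfolding homs_def by blast
qed

section \<open>Robust edge sets\<close>

definition deg :: "'a \<Rightarrow> nat" where
  "deg v = card {u. {v, u} \<in> edges G}"

definition extensions :: "'a set set \<Rightarrow> ('b \<Rightarrow> 'a) \<Rightarrow> 'b \<Rightarrow> 'b \<Rightarrow> 'a set" where
  "extensions E \<phi> x y = {\<phi>' y | \<phi>'. \<phi>' \<in> homs E \<and> (\<forall>s. anc s x \<longrightarrow> \<phi>' s = \<phi> s)}"

text \<open>Divided by the degree: a random neighbour of \<open>\<phi> x\<close> continues the state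
  of \<open>\<phi>\<close> at \<open>x\<close> with probability at least
  \<open>\<delta>\<close>.\<close>

definition robust :: "real \<Rightarrow> 'a set set \<Rightarrow> bool" where
  "robust \<delta> E \<longleftrightarrow> (\<forall>\<phi>\<in>homs E. \<forall>x y. {x, y} \<in> EH \<longrightarrow>
     \<delta> * real (deg (\<phi> x)) \<le> real (card (extensions E \<phi> x y)))"

lemma finite_extensions: "finite (extensions E \<phi> x y)"
  unfolding extensions_def by (rule finite_subset[of _ "(\<lambda>\<phi>. \<phi> y) ` homs E"]) (auto simp: finite_homs)

lemma finite_edges: "finite (edges G)"
  by (rule finite_subset[of _ "Pow (verts G)"])
    (use simple finite_verts in \<open>auto simp: simple_graph_def\<close>)

text \<open>Only the values on the ancestors of \<open>x\<close> are kept, since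
  \<open>extensions\<close> depends on nothing else of \<open>\<phi>\<close>. This is what bounds
  the number of states at each vertex of \<open>G\<close>.\<close>

definition states :: "'a set set \<Rightarrow> ('b \<times> 'b \<times> ('b \<Rightarrow> 'a)) set" where
  "states E = {(x, y, restrict \<phi> {s. anc s x}) | x y \<phi>. \<phi> \<in> homs E \<and> {x, y} \<in> EH}"

lemma finite_states: "finite (states E)"
proof (rule finite_subset)
  show "states E \<subseteq> (\<lambda>(x, y, \<phi>). (x, y, restrict \<phi> {s. anc s x})) ` (K \<times> K \<times> homs E)"
  proof
    fix z assume "z \<in> states E"
    then obtain x y \<phi> where "z = (x, y, restrict \<phi> {s. anc s x})" "\<phi> \<in> homs E" "{x, y} \<in> EH"
      by (auto simp: states_def)
    then show "z \<in> (\<lambda>(x, y, \<phi>). (x, y, restrict \<phi> {s. anc s x})) ` (K \<times> K \<times> homs E)"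
      using edge_in_K[of x y] by (intro image_eqI[of _ _ "(x, y, \<phi>)"]) auto
  qed
qed (auto simp: finite_K finite_homs)

text \<open>Once \<open>x\<close>, \<open>y\<close> and the image \<open>v\<close> of
  \<open>x\<close> are fixed, a state maps at most \<open>card K\<close> ancestors into the weakly
  reachable set of \<open>v\<close>.\<close>

lemma sum_states_deg:
  "(\<Sum>(x, y, \<beta>)\<in>states (edges G). real (deg (\<beta> x))) \<le>
   real ((card K)\<^sup>2 * (Suc reach_card ^ card K) ^ card K) * (\<Sum>v\<in>verts G. real (deg v))"
proof -
  define w where "w = Suc reach_card ^ card K"
  define B where "B = (\<lambda>(x, y::'b, v). {\<beta> \<in> {s. anc s x} \<rightarrow>\<^sub>E wreach (card K) v. \<beta> x = v})"
  have finA: "finite {s. anc s x}" for x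
    by (rule finite_subset[OF _ finite_K]) (use anc_in_K in blast)
  have cardA: "card {s. anc s x} \<le> card K" for x
    by (rule card_mono[OF finite_K]) (use anc_in_K in blast)
  have finB: "finite (B z)" for z
  proof -
    obtain x y v where z: "z = (x, y, v)" by (cases z)
    have "B z \<subseteq> {s. anc s x} \<rightarrow>\<^sub>E wreach (card K) v" unfolding B_def z by auto
    then show ?thesis by (rule finite_subset) (intro finite_PiE finA finite_wreach)
  qed
  have cardB: "card (B (x, y, v)) \<le> w ^ card K" if "v \<in> verts G" for x y v
  proof -
    have "card (B (x, y, v)) \<le> card ({s. anc s x} \<rightarrow>\<^sub>E wreach (card K) v)"
      unfolding B_def by (rule card_mono) (auto intro!: finite_PiE finA finite_wreach)
    also have "\<dots> = card (wreach (card K) v) ^ card {s. anc s x}"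
      by (simp add: card_PiE finA)
    also have "\<dots> \<le> w ^ card {s. anc s x}"
      unfolding w_def by (rule power_mono[OF card_wreach[OF that]]) simp
    also have "\<dots> \<le> w ^ card K" by (rule power_increasing[OF cardA]) (simp add: w_def)
    finally show ?thesis .
  qed
  have "(\<Sum>(x, y, \<beta>)\<in>states (edges G). real (deg (\<beta> x))) \<le>
    (\<Sum>z\<in>Sigma (K \<times> K \<times> verts G) B. real (deg (snd (snd (fst z)))))"

  \<comment> \<open>The image \<open>v\<close> is determined by the state as
    \<open>\<beta> x\<close>; it is a coordinate of the larger index set only to be summed over, and
    the map drops it.\<close>
  proof (rule sum_le_included[where i = "\<lambda>((x, y, v), \<beta>). (x, y, \<beta>)"], goal_cases)
    case 4
    show ?case
    proof (intro ballI, goal_cases)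
      case (1 z)
      then obtain x y \<phi> where z: "z = (x, y, restrict \<phi> {s. anc s x})" "\<phi> \<in> homs (edges G)" "{x, y} \<in> EH"
        by (auto simp: states_def)
      have xy: "x \<in> K" "y \<in> K" using edge_in_K[OF z(3)] by auto
      have "restrict \<phi> {s. anc s x} \<in> B (x, y, \<phi> x)"
        unfolding B_def using homs_anc_wreach[OF z(2)] anc_refl[OF xy(1)] by auto
      then have "((x, y, \<phi> x), restrict \<phi> {s. anc s x}) \<in> Sigma (K \<times> K \<times> verts G) B"
        using xy homs_verts[OF z(2)] by auto
      then show ?case
        by (rule rev_bexI) (use z anc_refl[OF xy(1)] in auto)
    qed
  next
    case 2
    show ?case by (intro finite_SigmaI finB) (auto simp: finite_K finite_verts)
  qed (auto simp: finite_states)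
  also have "\<dots> = (\<Sum>z\<in>K \<times> K \<times> verts G. real (card (B z)) * real (deg (snd (snd z))))"
    using sum.Sigma[of "K \<times> K \<times> verts G" B "\<lambda>z _. real (deg (snd (snd z)))"]
    by (simp add: finite_K finite_verts finB case_prod_unfold)
  also have "\<dots> \<le> (\<Sum>z\<in>K \<times> K \<times> verts G. real (w ^ card K) * real (deg (snd (snd z))))"
    by (rule sum_mono) (auto intro!: mult_right_mono simp: of_nat_power[symmetric] cardB simp del: of_nat_power)
  also have "\<dots> = real (w ^ card K) * (\<Sum>z\<in>K \<times> K \<times> verts G. real (deg (snd (snd z))))"
    by (simp add: sum_distrib_left)
  also have "(\<Sum>z\<in>K \<times> K \<times> verts G. real (deg (snd (snd z)))) =
      real ((card K)\<^sup>2) * (\<Sum>v\<in>verts G. real (deg v))"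
    by (simp add: sum.cartesian_product' power2_eq_square)
  finally show ?thesis unfolding w_def by (simp add: ac_simps)
qed

text \<open>Handshaking, together with the linear bound on the number of edges.\<close>

lemma sum_deg: "(\<Sum>v\<in>verts G. real (deg v)) \<le> 2 * real reach_card * real (card (verts G))"
proof -
  have fin: "finite {u. {v, u} \<in> edges G}" for v
    by (rule finite_subset[OF _ finite_verts]) (use simple in \<open>auto simp: simple_graph_def\<close>)
  have deg_eq: "deg v = card {e \<in> edges G. v \<in> e}" for v
  proof -
    have "{e \<in> edges G. v \<in> e} = (\<lambda>u. {v, u}) ` {u. {v, u} \<in> edges G}"
    proof (intro equalityI subsetI)
      fix e assume e: "e \<in> {e \<in> edges G. v \<in> e}"
      then have "card e = 2" using simple by (auto simp: simple_graph_def)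
      then obtain a b where "e = {a, b}" by (auto simp: card_2_iff)
      then show "e \<in> (\<lambda>u. {v, u}) ` {u. {v, u} \<in> edges G}" using e by (auto simp: insert_commute)
    qed auto
    moreover have "inj_on (\<lambda>u. {v, u}) {u. {v, u} \<in> edges G}"
      by (auto simp: inj_on_def doubleton_eq_iff)
    ultimately show ?thesis by (simp add: deg_def card_image)
  qed
  have "(\<Sum>v\<in>verts G. deg v) = (\<Sum>v\<in>verts G. \<Sum>e\<in>edges G. if v \<in> e then 1 else 0)"
    unfolding deg_eq by (intro sum.cong refl) (simp add: sum.If_cases finite_edges Int_def)
  also have "\<dots> = (\<Sum>e\<in>edges G. \<Sum>v\<in>verts G. if v \<in> e then 1 else 0)" by (rule sum.swap)
  also have "\<dots> = (\<Sum>e\<in>edges G. 2)"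
  proof (rule sum.cong[OF refl])
    fix e assume "e \<in> edges G"
    then have "e \<subseteq> verts G" "card e = 2" using simple by (auto simp: simple_graph_def)
    moreover from this have "verts G \<inter> {v. v \<in> e} = e" by auto
    ultimately show "(\<Sum>v\<in>verts G. if v \<in> e then 1 else 0) = (2::nat)"
      by (simp add: sum.If_cases finite_verts)
  qed
  also have "\<dots> \<le> 2 * (reach_card * card (verts G))"
    using card_edges_le[OF r_pos order_refl, of "verts G"] simple by (auto simp: simple_graph_def)
  finally have "real (\<Sum>v\<in>verts G. deg v) \<le> real (2 * (reach_card * card (verts G)))"
    by (simp only: of_nat_le_iff)
  then show ?thesis by simp
qed

text \<open>A minimiser of the number of deleted edges plus the weighted number of realised states is
  robust: deleting the few edges of a violated condition kills a state of larger weight.\<close>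

lemma ex_robust:
  assumes "\<delta> \<ge> 0"
  shows "\<exists>E\<subseteq>edges G. robust \<delta> E \<and> real (card (edges G - E)) \<le>
    \<delta> * real ((card K)\<^sup>2 * (Suc reach_card ^ card K) ^ card K) * (2 * real reach_card * real (card (verts G)))"
proof -
  define wt where "wt = (\<lambda>(x, y::'b, \<beta>). \<delta> * real (deg ((\<beta> :: 'b \<Rightarrow> 'a) x)))"
  define f where "f = (\<lambda>E. real (card (edges G - E)) + sum wt (states E))"
  have "finite (Pow (edges G))" "Pow (edges G) \<noteq> {}" using finite_edges by auto
  from ex_is_arg_min_if_finite[OF this, of f] obtain E where
    "is_arg_min f (\<lambda>E. E \<in> Pow (edges G)) E" by blast
  then have E: "E \<subseteq> edges G" and min: "\<And>E'. E' \<subseteq> edges G \<Longrightarrow> f E \<le> f E'"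
    by (simp_all add: is_arg_min_linorder)
  have "robust \<delta> E"
    unfolding robust_def
  proof (intro ballI allI impI, rule ccontr)
    fix \<phi> x y assume \<phi>: "\<phi> \<in> homs E" and xy: "{x, y} \<in> EH"
      and "\<not> \<delta> * real (deg (\<phi> x)) \<le> real (card (extensions E \<phi> x y))"
    then have small: "real (card (extensions E \<phi> x y)) < \<delta> * real (deg (\<phi> x))" by simp
    define E' where "E' = E - (\<lambda>w. {\<phi> x, w}) ` extensions E \<phi> x y"
    define \<tau> where "\<tau> = (x, y, restrict \<phi> {s. anc s x})"
    have xK: "x \<in> K" using edge_in_K[OF xy] by blast
    have "edges G - E' \<subseteq> (edges G - E) \<union> (\<lambda>w. {\<phi> x, w}) ` extensions E \<phi> x y"
      unfolding E'_def by auto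
    then have "card (edges G - E') \<le> card ((edges G - E) \<union> (\<lambda>w. {\<phi> x, w}) ` extensions E \<phi> x y)"
      by (intro card_mono) (auto simp: finite_edges finite_extensions)
    also have "\<dots> \<le> card (edges G - E) + card (extensions E \<phi> x y)"
      using card_Un_le card_image_le[OF finite_extensions] by (meson add_left_mono le_trans)
    finally have removed: "card (edges G - E') \<le> card (edges G - E) + card (extensions E \<phi> x y)" .
    have sub: "E' \<subseteq> E" unfolding E'_def by auto
    have \<tau>_in: "\<tau> \<in> states E" unfolding states_def \<tau>_def using \<phi> xy by blast
    \<comment> \<open>A witness of a surviving state would map \<open>y\<close> to an extension, so
      it would use one of the edges just deleted.\<close>
    have "\<tau> \<notin> states E'"
    proof
      assume "\<tau> \<in> states E'"
      then obtain \<phi>' where \<phi>': "\<phi>' \<in> homs E'" "restrict \<phi> {s. anc s x} = restrict \<phi>' {s. anc s x}"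
        unfolding states_def \<tau>_def by auto
      have agree: "\<phi>' s = \<phi> s" if "anc s x" for s
        using fun_cong[OF \<phi>'(2), of s] that by simp
      have "\<phi>' y \<in> extensions E \<phi> x y"
        unfolding extensions_def using homs_mono[OF sub] \<phi>'(1) agree by blast
      moreover have "{\<phi> x, \<phi>' y} \<in> E'"
        using homs_edge[OF \<phi>'(1) xy] agree[OF anc_refl[OF xK]] by simp
      ultimately show False unfolding E'_def by blast
    qed
    moreover have "states E' \<subseteq> states E"
      unfolding states_def using homs_mono[OF sub] by blast
    ultimately have "states E' \<subseteq> states E - {\<tau>}" by blast
    then have "sum wt (states E') \<le> sum wt (states E - {\<tau>})"
      by (rule sum_mono2[rotated]) (auto simp: finite_states wt_def assms)
    also have "\<dots> = sum wt (states E) - wt \<tau>"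
      using \<tau>_in by (simp add: sum_diff1 finite_states)
    also have "wt \<tau> = \<delta> * real (deg (\<phi> x))"
      unfolding \<tau>_def wt_def using anc_refl[OF xK] by simp
    finally have "f E' < f E" using removed small unfolding f_def by linarith
    moreover have "E' \<subseteq> edges G" using sub E by simp
    ultimately show False using min[of E'] by simp
  qed
  moreover have "real (card (edges G - E)) \<le>
    \<delta> * real ((card K)\<^sup>2 * (Suc reach_card ^ card K) ^ card K) * (2 * real reach_card * real (card (verts G)))"
  proof -
    have "sum wt (states E) \<ge> 0" by (rule sum_nonneg) (auto simp: wt_def assms)
    then have "real (card (edges G - E)) \<le> f E" unfolding f_def by simp
    \<comment> \<open>The minimiser is compared with the full edge set, for which no edge is deleted
      and only the weight of the states remains.\<close>
    also have "\<dots> \<le> f (edges G)" by (rule min) simp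
    also have "\<dots> = \<delta> * (\<Sum>(x, y, \<beta>)\<in>states (edges G). real (deg (\<beta> x)))"
      unfolding f_def wt_def by (simp add: sum_distrib_left case_prod_unfold)
    also have "\<dots> \<le> \<delta> * (real ((card K)\<^sup>2 * (Suc reach_card ^ card K) ^ card K) * (\<Sum>v\<in>verts G. real (deg v)))"
      by (rule mult_left_mono[OF sum_states_deg assms])
    also have "\<dots> \<le> \<delta> * (real ((card K)\<^sup>2 * (Suc reach_card ^ card K) ^ card K) *
        (2 * real reach_card * real (card (verts G))))"
      by (intro mult_left_mono sum_deg assms) auto
    finally show ?thesis by (simp only: mult.assoc)
  qed
  ultimately show ?thesis using E by blast
qed

end


section \<open>Packing and colour coding\<close>

text \<open>Extensional functions, so that a map is determined by its values on
  \<open>verts H\<close> and counting makes sense.\<close>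

definition embeddings :: "'b graph \<Rightarrow> 'a graph \<Rightarrow> ('b \<Rightarrow> 'a) set" where
  "embeddings H G = {\<psi> \<in> verts H \<rightarrow>\<^sub>E verts G. inj_on \<psi> (verts H) \<and> (\<forall>e\<in>edges H. \<psi> ` e \<in> edges G)}"

lemma free_of_iff:
  assumes H: "simple_graph H" and G: "simple_graph G"
  shows "G \<in> free_of H \<longleftrightarrow> embeddings H G = {}"
proof -
  have "(\<exists>S. subgraph S G \<and> isomorphic S H) \<longleftrightarrow> embeddings H G \<noteq> {}"
  proof
    assume "\<exists>S. subgraph S G \<and> isomorphic S H"
    then obtain S \<phi> where S: "simple_graph S" "verts S \<subseteq> verts G" "edges S \<subseteq> edges G"
      and bij: "bij_betw \<phi> (verts S) (verts H)"
      and iso: "\<forall>u\<in>verts S. \<forall>v\<in>verts S. {u, v} \<in> edges S \<longleftrightarrow> {\<phi> u, \<phi> v} \<in> edges H"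
      unfolding subgraph_def isomorphic_def by blast
    define \<psi> where "\<psi> = restrict (the_inv_into (verts S) \<phi>) (verts H)"
    have inv: "the_inv_into (verts S) \<phi> x \<in> verts S" "\<phi> (the_inv_into (verts S) \<phi> x) = x"
      if "x \<in> verts H" for x
      using bij that by (auto simp: bij_betw_def the_inv_into_into f_the_inv_into_f)
    have "\<psi> ` e \<in> edges G" if e: "e \<in> edges H" for e
    proof -
      have "e \<subseteq> verts H" "card e = 2" using H e by (auto simp: simple_graph_def)
      then obtain a b where ab: "e = {a, b}" "a \<in> verts H" "b \<in> verts H" by (auto simp: card_2_iff)
      then have "{\<psi> a, \<psi> b} \<in> edges S" using iso inv e unfolding \<psi>_def by simp
      then show ?thesis using ab S(3) by auto
    qed
    moreover have "inj_on \<psi> (verts H)" unfolding \<psi>_def inj_on_def using inv by (metis restrict_apply')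
    moreover have "\<psi> \<in> verts H \<rightarrow>\<^sub>E verts G" unfolding \<psi>_def using inv S(2) by auto
    ultimately show "embeddings H G \<noteq> {}" unfolding embeddings_def by blast
  next
    assume "embeddings H G \<noteq> {}"
    then obtain \<psi> where \<psi>: "\<psi> \<in> verts H \<rightarrow>\<^sub>E verts G" "inj_on \<psi> (verts H)" "\<forall>e\<in>edges H. \<psi> ` e \<in> edges G"
      by (auto simp: embeddings_def)
    define S where "S = Graph (\<psi> ` verts H) ((`) \<psi> ` edges H)"
    have "card (\<psi> ` e) = 2" "\<psi> ` e \<subseteq> \<psi> ` verts H" if "e \<in> edges H" for e
    proof -
      have "e \<subseteq> verts H" "card e = 2" using H that by (auto simp: simple_graph_def)
      then show "card (\<psi> ` e) = 2" "\<psi> ` e \<subseteq> \<psi> ` verts H"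
        using card_image[of \<psi> e] inj_on_subset[OF \<psi>(2), of e] by auto
    qed
    then have "simple_graph S" using H unfolding S_def simple_graph_def by auto
    then have sub: "subgraph S G" unfolding subgraph_def S_def using \<psi> by auto
    define \<phi> where "\<phi> = the_inv_into (verts H) \<psi>"
    have inv: "\<phi> (\<psi> x) = x" if "x \<in> verts H" for x
      unfolding \<phi>_def by (rule the_inv_into_f_f[OF \<psi>(2) that])
    have "bij_betw \<phi> (verts S) (verts H)"
      unfolding S_def \<phi>_def using bij_betw_the_inv_into[OF inj_on_imp_bij_betw[OF \<psi>(2)]] by simp
    moreover have "{u, v} \<in> edges S \<longleftrightarrow> {\<phi> u, \<phi> v} \<in> edges H" if uv: "u \<in> verts S" "v \<in> verts S" for u v
    proof -
      obtain a b where ab: "u = \<psi> a" "v = \<psi> b" "a \<in> verts H" "b \<in> verts H"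
        using uv unfolding S_def by auto
      have "{u, v} \<in> edges S \<longleftrightarrow> (\<exists>e\<in>edges H. \<psi> ` e = \<psi> ` {a, b})"
        unfolding S_def using ab by auto
      also have "\<dots> \<longleftrightarrow> (\<exists>e\<in>edges H. e = {a, b})"
      proof (intro bex_cong refl)
        fix e assume "e \<in> edges H"
        then have "e \<subseteq> verts H" using H by (auto simp: simple_graph_def)
        then show "\<psi> ` e = \<psi> ` {a, b} \<longleftrightarrow> e = {a, b}"
          using inj_on_image_eq_iff[OF \<psi>(2), of e "{a, b}"] ab by simp
      qed
      finally show ?thesis using ab inv by simp
    qed
    ultimately have "isomorphic S H" unfolding isomorphic_def by blast
    then show "\<exists>S. subgraph S G \<and> isomorphic S H" using sub by blast
  qed
  then show ?thesis unfolding free_of_def using G by blast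
qed

lemma finite_embeddings: "simple_graph H \<Longrightarrow> simple_graph G \<Longrightarrow> finite (embeddings H G)"
  unfolding embeddings_def
  by (rule finite_subset[of _ "verts H \<rightarrow>\<^sub>E verts G"]) (auto simp: simple_graph_def intro: finite_PiE)

text \<open>Deleting all edges of a maximal packing leaves no copy, so by farness it costs at least
  \<open>\<epsilon>\<close> times the number of vertices; each copy contributes at most
  \<open>card (edges H)\<close> edges.\<close>

lemma ex_edge_disjoint_packing:
  assumes H: "simple_graph H" "edges H \<noteq> {}" and G: "simple_graph G" and far: "far \<epsilon> (free_of H) G"
  shows "\<exists>I\<subseteq>embeddings H G.
    (\<forall>\<phi>\<in>I. \<forall>\<phi>'\<in>I. \<phi> \<noteq> \<phi>' \<longrightarrow> (`) \<phi> ` edges H \<inter> (`) \<phi>' ` edges H = {}) \<and>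
    \<epsilon> * real (card (verts G)) \<le> real (card I * card (edges H))"
proof -
  define packs where "packs = {I. I \<subseteq> embeddings H G \<and>
    (\<forall>\<phi>\<in>I. \<forall>\<phi>'\<in>I. \<phi> \<noteq> \<phi>' \<longrightarrow> (`) \<phi> ` edges H \<inter> (`) \<phi>' ` edges H = {})}"
  have finEmb: "finite (embeddings H G)" using finite_embeddings H G by blast
  have finI: "finite I" if "I \<in> packs" for I
    using that finEmb unfolding packs_def by (auto intro: finite_subset)
  have "\<forall>I. I \<in> packs \<longrightarrow> card I < Suc (card (embeddings H G))"
    unfolding packs_def using card_mono[OF finEmb] by (auto simp: le_imp_less_Suc)
  moreover have "{} \<in> packs" by (simp add: packs_def)
  ultimately obtain I where I: "I \<in> packs" and max: "\<And>J. J \<in> packs \<Longrightarrow> card J \<le> card I"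
    using ex_has_greatest_nat[of "\<lambda>I. I \<in> packs" "{}" card] by blast
  define F where "F = (\<Union>\<phi>\<in>I. (`) \<phi> ` edges H)"
  have finEH: "finite (edges H)"
    by (rule finite_subset[of _ "Pow (verts H)"]) (use H in \<open>auto simp: simple_graph_def\<close>)
  have finF: "finite F" unfolding F_def using finI[OF I] finEH by auto
  have FG: "F \<subseteq> edges G" unfolding F_def using I by (auto simp: packs_def embeddings_def)
  define G' where "G' = Graph (verts G) (edges G - F)"
  have sG': "simple_graph G'" using G unfolding G'_def simple_graph_def by auto
  have "embeddings H G' = {}"
  proof (rule ccontr)
    assume "embeddings H G' \<noteq> {}"
    then obtain \<psi> where \<psi>: "\<psi> \<in> embeddings H G'" by blast
    then have e: "\<psi> \<in> embeddings H G" and d: "(`) \<psi> ` edges H \<inter> F = {}"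
      unfolding embeddings_def G'_def by auto
    \<comment> \<open>A member of \<open>I\<close> has all its edges in \<open>F\<close>, and as
      \<open>H\<close> has an edge it cannot avoid \<open>F\<close>.\<close>
    have "\<psi> \<notin> I" using d H(2) unfolding F_def by blast
    moreover have "insert \<psi> I \<in> packs"
      unfolding packs_def mem_Collect_eq
    proof (intro conjI ballI impI)
      show "insert \<psi> I \<subseteq> embeddings H G" using I e by (simp add: packs_def)
      have new: "(`) \<psi> ` edges H \<inter> (`) \<phi> ` edges H = {}" if "\<phi> \<in> I" for \<phi>
        using d that unfolding F_def by blast
      fix a b assume "a \<in> insert \<psi> I" "b \<in> insert \<psi> I" "a \<noteq> b"
      then consider "a = \<psi>" "b \<in> I" | "b = \<psi>" "a \<in> I" | "a \<in> I" "b \<in> I" by blast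
      then show "(`) a ` edges H \<inter> (`) b ` edges H = {}"
      proof cases
        case 1 then show ?thesis using new[of b] by simp
      next
        case 2 then show ?thesis using new[of a] by (simp add: Int_commute)
      next
        case 3 then show ?thesis using I \<open>a \<noteq> b\<close> by (simp add: packs_def)
      qed
    qed
    ultimately show False using max[of "insert \<psi> I"] finI[OF I] by simp
  qed
  then have "G' \<in> free_of H" using free_of_iff H sG' by blast
  then have "\<epsilon> * real (card (verts G)) \<le>
      real (card ((edges G - edges G') \<union> (edges G' - edges G)))"
    using far unfolding far_def by (auto simp: G'_def)
  also have "(edges G - edges G') \<union> (edges G' - edges G) = F" using FG by (auto simp: G'_def)
  also have "real (card F) \<le> real (card I * card (edges H))"
  proof -
    have "card F \<le> (\<Sum>\<phi>\<in>I. card ((`) \<phi> ` edges H))"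
      unfolding F_def by (rule card_UN_le[OF finI[OF I]])
    also have "\<dots> \<le> (\<Sum>\<phi>\<in>I. card (edges H))" by (intro sum_mono card_image_le finEH)
    finally show ?thesis by (simp only: sum_constant of_nat_id of_nat_le_iff)
  qed
  finally show ?thesis using I unfolding packs_def mem_Collect_eq by (intro exI[of _ I] conjI) simp_all
qed

section \<open>Averaging, colour coding and the space searched by the tester\<close>

lemma ex_popular:
  assumes "finite A" "finite T" "T \<noteq> {}" "\<And>i. i \<in> A \<Longrightarrow> a \<le> card {t\<in>T. R i t}"
  shows "\<exists>t\<in>T. card A * a \<le> card T * card {i\<in>A. R i t}"
proof (rule ccontr)
  assume "\<not> ?thesis"
  then have less: "card T * card {i\<in>A. R i t} < card A * a" if "t \<in> T" for t
    using that by (auto simp: not_le)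
  have "(\<Sum>t\<in>T. card {i\<in>A. R i t}) = (\<Sum>t\<in>T. \<Sum>i\<in>A. if R i t then 1 else 0)"
    by (intro sum.cong refl) (simp add: sum.If_cases assms Int_def)
  also have "\<dots> = (\<Sum>i\<in>A. \<Sum>t\<in>T. if R i t then 1 else 0)" by (rule sum.swap)
  also have "\<dots> = (\<Sum>i\<in>A. card {t\<in>T. R i t})"
    by (intro sum.cong refl) (simp add: sum.If_cases assms Int_def)
  finally have swap: "(\<Sum>t\<in>T. card {i\<in>A. R i t}) = (\<Sum>i\<in>A. card {t\<in>T. R i t})" .
  have "card T * (card A * a) \<le> card T * (\<Sum>i\<in>A. card {t\<in>T. R i t})"
    using sum_bounded_below[of A a "\<lambda>i. card {t\<in>T. R i t}"] assms(4) by simp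
  also have "\<dots> = (\<Sum>t\<in>T. card T * card {i\<in>A. R i t})"
    by (simp only: swap[symmetric] sum_distrib_left)
  also have "\<dots> < (\<Sum>t\<in>T. card A * a)"
    using assms(2,3) less by (rule sum_strict_mono)
  finally show False by simp
qed

text \<open>The colours of the \<open>card K\<close> image vertices are forced and all others are
  free. The product form avoids a difference in the exponent.\<close>

lemma card_colourings:
  assumes "finite V" "\<phi> \<in> K \<rightarrow> V" "inj_on \<phi> K" "finite K"
  shows "card {c \<in> V \<rightarrow>\<^sub>E K. \<forall>x\<in>K. c (\<phi> x) = x} * card K ^ card K = card K ^ card V"
proof -
  have sub: "\<phi> ` K \<subseteq> V" using assms(2) by auto
  have "{c \<in> V \<rightarrow>\<^sub>E K. \<forall>x\<in>K. c (\<phi> x) = x} =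
      (\<Pi>\<^sub>E v\<in>V. if v \<in> \<phi> ` K then {the_inv_into K \<phi> v} else K)"
  proof (intro equalityI subsetI)
    fix c assume "c \<in> {c \<in> V \<rightarrow>\<^sub>E K. \<forall>x\<in>K. c (\<phi> x) = x}"
    then show "c \<in> (\<Pi>\<^sub>E v\<in>V. if v \<in> \<phi> ` K then {the_inv_into K \<phi> v} else K)"
      using the_inv_into_f_f[OF assms(3)] by (auto simp: PiE_iff)
  next
    fix c assume c: "c \<in> (\<Pi>\<^sub>E v\<in>V. if v \<in> \<phi> ` K then {the_inv_into K \<phi> v} else K)"
    have "c v \<in> K" if "v \<in> V" for v
    proof (cases "v \<in> \<phi> ` K")
      case True
      then show ?thesis using PiE_mem[OF c that] the_inv_into_f_f[OF assms(3)] by auto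
    qed (use PiE_mem[OF c that] in simp)
    moreover have "c (\<phi> x) = x" if "x \<in> K" for x
      using PiE_mem[OF c, of "\<phi> x"] that sub the_inv_into_f_f[OF assms(3) that] by auto
    ultimately show "c \<in> {c \<in> V \<rightarrow>\<^sub>E K. \<forall>x\<in>K. c (\<phi> x) = x}" using c by (auto simp: PiE_iff)
  qed
  then have "card {c \<in> V \<rightarrow>\<^sub>E K. \<forall>x\<in>K. c (\<phi> x) = x} =
      (\<Prod>v\<in>V. card (if v \<in> \<phi> ` K then {the_inv_into K \<phi> v} else K))"
    by (simp add: card_PiE assms(1))
  also have "\<dots> = (\<Prod>v\<in>V. if v \<in> \<phi> ` K then 1 else card K)" by (intro prod.cong) auto
  also have "\<dots> = card K ^ card (V - \<phi> ` K)"
    using assms(1) by (simp add: prod.If_cases Diff_eq)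
  also have "card (V - \<phi> ` K) = card V - card K"
    using sub assms(4) by (simp add: card_Diff_subset card_image[OF assms(3)])
  moreover have "card K \<le> card V"
    using card_mono[OF assms(1) sub] by (simp add: card_image[OF assms(3)])
  ultimately show ?thesis by (simp flip: power_add)
qed

text \<open>All that the search needs to know about the surviving copies; the order of
  \<open>G\<close>, the colours and the reduced edge set no longer appear. The last assumption
  concerns only subtrees that contain an edge, so isolated vertices of the pattern get no starting
  points.\<close>

locale search_space = pattern K EH \<rho>
  for K :: "'b set" and EH and \<rho> :: "'b \<Rightarrow> nat" +
  fixes G :: "'a graph" and \<Phi> :: "('b \<Rightarrow> 'a) set" and \<theta> :: real
  assumes \<Phi>_ne: "\<Phi> \<noteq> {}"
    and \<Phi>_verts: "\<phi> \<in> \<Phi> \<Longrightarrow> x \<in> K \<Longrightarrow> \<phi> x \<in> verts G"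
    and \<Phi>_inj: "\<phi> \<in> \<Phi> \<Longrightarrow> inj_on \<phi> K"
    and \<Phi>_edge: "\<phi> \<in> \<Phi> \<Longrightarrow> {a, b} \<in> EH \<Longrightarrow> {\<phi> a, \<phi> b} \<in> edges G"
    and \<Phi>_glue: "\<phi> \<in> \<Phi> \<Longrightarrow> \<phi>' \<in> \<Phi> \<Longrightarrow> (\<And>s. anc s y \<Longrightarrow> s \<noteq> y \<Longrightarrow> \<phi>' s = \<phi> s) \<Longrightarrow>
      (\<lambda>t. if anc y t then \<phi>' t else \<phi> t) \<in> \<Phi>"
    and \<Phi>_robust: "\<phi> \<in> \<Phi> \<Longrightarrow> {x, y} \<in> EH \<Longrightarrow>
      \<theta> * real (card {u. {\<phi> x, u} \<in> edges G}) \<le>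
      real (card {\<phi>' y | \<phi>'. \<phi>' \<in> \<Phi> \<and> (\<forall>s. anc s x \<longrightarrow> \<phi>' s = \<phi> s)})"
    and \<Phi>_start: "{t, u} \<in> EH \<Longrightarrow> anc y t \<Longrightarrow> anc y u \<Longrightarrow>
      \<theta> * real (card (verts G)) \<le> real (card {\<phi> z | \<phi> z. \<phi> \<in> \<Phi> \<and> anc y z})"

text \<open>The factor \<open>m\<close> comes from counting edges instead of copies,
  \<open>k ^ k\<close> from guessing colours, \<open>Suc k ^ k\<close> from guessing ranks, and 2
  from the copies lost by deletion. The factor with \<open>k\<^sup>2\<close> is the deletion cost
  from \<open>ex_robust\<close>, and \<open>Suc c\<close> turns edges into vertices.\<close>

definition loss_const :: "nat \<Rightarrow> nat \<Rightarrow> nat \<Rightarrow> nat" where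
  "loss_const k m c = 2 * (m * (k ^ k * Suc k ^ k)) *
     Suc (k\<^sup>2 * (Suc c ^ k) ^ k * (2 * c)) * Suc c"

text \<open>The number of smaller images is the rank within the copy, so finitely many functions
  encode how the order of \<open>G\<close> can order \<open>H\<close>.\<close>

lemma (in adm_graph) card_lower_less_iff:
  assumes "simple_graph H" "\<phi> \<in> embeddings H G" and st: "s \<in> verts H" "t \<in> verts H"
  shows "card {b \<in> verts H. \<phi> b \<sqsubset> \<phi> s} < card {b \<in> verts H. \<phi> b \<sqsubset> \<phi> t} \<longleftrightarrow> \<phi> s \<sqsubset> \<phi> t"
proof -
  have fin: "finite {b \<in> verts H. \<phi> b \<sqsubset> \<phi> t}" for t using assms(1) by (simp add: simple_graph_def)
  have less: "card {b \<in> verts H. \<phi> b \<sqsubset> \<phi> s} < card {b \<in> verts H. \<phi> b \<sqsubset> \<phi> t}"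
    if "\<phi> s \<sqsubset> \<phi> t" "s \<in> verts H" for s t
    by (rule psubset_card_mono[OF fin]) (use that less_trans less_irrefl in blast)
  show ?thesis
  proof
    assume l: "card {b \<in> verts H. \<phi> b \<sqsubset> \<phi> s} < card {b \<in> verts H. \<phi> b \<sqsubset> \<phi> t}"
    then have "s \<noteq> t" by auto
    then have "\<phi> s \<noteq> \<phi> t" "\<phi> s \<in> verts G" "\<phi> t \<in> verts G"
      using assms(2) st unfolding embeddings_def by (auto dest: inj_onD)
    then show "\<phi> s \<sqsubset> \<phi> t" using less_total[of "\<phi> s" "\<phi> t"] less[of t s] l st by auto
  qed (use less st in blast)
qed

text \<open>Three losses are controlled one after the other: choosing the most popular colouring and
  ranking, making the edge set robust, and passing from many edges to many starting
  vertices.\<close>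

lemma (in adm_graph) ex_search_space:
  assumes H: "simple_graph H" "edges H \<noteq> {}" and k: "card (verts H) \<le> r" and r: "1 \<le> r"
    and \<epsilon>: "\<epsilon> > 0" and ne: "verts G \<noteq> {}" and far: "far \<epsilon> (free_of H) G"
  shows "\<exists>\<rho> \<Phi>. search_space (verts H) (edges H) \<rho> G \<Phi>
    (\<epsilon> / real (loss_const (card (verts H)) (card (edges H)) reach_card))"
proof -
  define K where "K = verts H"
  define EH where "EH = edges H"
  define k where "k = card K"
  define n where "n = card (verts G)"
  have finK: "finite K" using H by (simp add: K_def simple_graph_def)
  have EHp: "e \<subseteq> K \<and> card e = 2" if "e \<in> EH" for e
    using H that by (auto simp: simple_graph_def K_def EH_def)
  have finEH: "finite EH" by (rule finite_subset[of _ "Pow K"]) (use EHp finK in auto)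
  have Kne: "K \<noteq> {}" using H(2) EHp unfolding EH_def by fastforce
  have kpos: "k > 0" using Kne finK by (simp add: k_def card_gt_0_iff)
  have npos: "n > 0" using ne finite_verts by (simp add: n_def card_gt_0_iff)
  from ex_edge_disjoint_packing[OF H simple far] obtain I where I: "I \<subseteq> embeddings H G"
    and I_disj: "\<forall>\<phi>\<in>I. \<forall>\<phi>'\<in>I. \<phi> \<noteq> \<phi>' \<longrightarrow> (`) \<phi> ` edges H \<inter> (`) \<phi>' ` edges H = {}"
    and I_card: "\<epsilon> * real (card (verts G)) \<le> real (card I * card (edges H))" by (elim exE conjE)
  have disj: "(`) \<phi> ` EH \<inter> (`) \<phi>' ` EH = {}" if "\<phi> \<in> I" "\<phi>' \<in> I" "\<phi> \<noteq> \<phi>'" for \<phi> \<phi>'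
    using I_disj that unfolding EH_def by simp
  have cardI: "\<epsilon> * real n \<le> real (card I * card EH)" using I_card by (simp add: n_def EH_def)
  have finI: "finite I" by (rule finite_subset[OF I finite_embeddings[OF H(1) simple]])
  \<comment> \<open>Candidates for averaging: a colouring of \<open>G\<close> together with a
    ranking of \<open>H\<close>. A copy fits exactly one ranking and a \<open>1 / k ^ k\<close>
    fraction of the colourings.\<close>
  define T where "T = (verts G \<rightarrow>\<^sub>E K) \<times> (K \<rightarrow>\<^sub>E {..k})"
  define rk where "rk = (\<lambda>\<phi>. restrict (\<lambda>a. card {b \<in> K. \<phi> b \<sqsubset> \<phi> a}) K)"
  define R where "R = (\<lambda>\<phi> (c, \<rho>). (\<forall>x\<in>K. c (\<phi> x) = x) \<and> \<rho> = rk \<phi>)"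
  have finT: "finite T" unfolding T_def by (auto intro!: finite_PiE finK finite_verts)
  have cardT: "card T = k ^ n * Suc k ^ k"
    unfolding T_def by (simp add: card_cartesian_product card_PiE finK finite_verts k_def n_def)
  have Tne: "T \<noteq> {}" using cardT kpos by (auto dest: arg_cong[of _ _ card])
  have count: "k ^ n div k ^ k \<le> card {t\<in>T. R \<phi> t}" if "\<phi> \<in> I" for \<phi>
  proof -
    have \<phi>: "\<phi> \<in> K \<rightarrow> verts G" "inj_on \<phi> K" using I that by (auto simp: embeddings_def K_def)
    have "rk \<phi> \<in> K \<rightarrow>\<^sub>E {..k}" unfolding rk_def k_def by (auto intro!: card_mono finK)
    then have "{t\<in>T. R \<phi> t} = {c \<in> verts G \<rightarrow>\<^sub>E K. \<forall>x\<in>K. c (\<phi> x) = x} \<times> {rk \<phi>}"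
      unfolding T_def R_def by auto
    then have "card {t\<in>T. R \<phi> t} * k ^ k = k ^ n"
      using card_colourings[OF finite_verts \<phi> finK] by (simp add: card_cartesian_product k_def n_def)
    then show ?thesis using kpos by (metis nonzero_mult_div_cancel_right le_refl power_not_zero less_not_refl3)
  qed
  from ex_popular[of I T "k ^ n div k ^ k" R, OF finI finT Tne count] obtain t
    where "card I * (k ^ n div k ^ k) \<le> card T * card {\<phi> \<in> I. R \<phi> t}" by auto
  moreover obtain c \<rho> where "t = (c, \<rho>)" by (cases t)
  ultimately have pop: "card I * (k ^ n div k ^ k) \<le> card T * card {\<phi> \<in> I. R \<phi> (c, \<rho>)}" by simp
  define J where "J = {\<phi> \<in> I. R \<phi> (c, \<rho>)}"
  define A where "A = card EH * (k ^ k * Suc k ^ k)"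
  have \<epsilon>n: "0 < \<epsilon> * real n" using \<epsilon> npos by simp
  have Ine: "I \<noteq> {}" using cardI \<epsilon>n by auto
  then obtain \<phi>0 where "\<phi>0 \<in> I" by blast
  \<comment> \<open>Because some copy exists, \<open>k \<le> n\<close>, and the division by
    \<open>k ^ k\<close> is exact.\<close>
  then have "k \<le> n" using I card_inj_on_le[of \<phi>0 K "verts G"] finite_verts
    by (auto simp: embeddings_def K_def k_def n_def)
  then have dvd: "k ^ n = (k ^ n div k ^ k) * k ^ k" by (simp add: le_imp_power_dvd)
  have qpos: "k ^ n div k ^ k > 0" using dvd kpos by (metis mult_0 not_gr_zero power_not_zero)
  have "card I * (k ^ n div k ^ k) \<le> (k ^ n div k ^ k) * (k ^ k * Suc k ^ k * card J)"
    using pop unfolding cardT J_def[symmetric] by (subst (asm) (2) dvd) (simp only: ac_simps)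
  then have cardJ: "card I \<le> k ^ k * Suc k ^ k * card J" using qpos by simp
  have "\<epsilon> * real n \<le> real (card I * card EH)" by (rule cardI)
  also have "\<dots> \<le> real (A * card J)"
    using mult_right_mono[OF cardJ, of "card EH"] unfolding A_def of_nat_le_iff by (simp add: ac_simps)
  finally have epsJ: "\<epsilon> * real n \<le> real A * real (card J)" by simp
  then have "J \<noteq> {}" "A > 0" using \<epsilon>n by (auto intro: Nat.gr0I)
  have Jprop: "\<phi> \<in> embeddings H G" "\<forall>x\<in>K. c (\<phi> x) = x" "\<rho> = rk \<phi>" if "\<phi> \<in> J" for \<phi>
    using that I unfolding J_def R_def by auto
  have \<rho>_iff: "\<rho> s < \<rho> t \<longleftrightarrow> \<phi> s \<sqsubset> \<phi> t" if "\<phi> \<in> J" "s \<in> K" "t \<in> K" for \<phi> s t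
    using card_lower_less_iff[OF H(1) Jprop(1)[OF that(1)], of s t] that
    unfolding Jprop(3)[OF that(1)] rk_def K_def by simp
  have inj\<rho>: "inj_on \<rho> K"
  proof (rule inj_onI)
    fix s t assume st: "s \<in> K" "t \<in> K" "\<rho> s = \<rho> t"
    obtain \<phi> where \<phi>: "\<phi> \<in> J" using \<open>J \<noteq> {}\<close> by blast
    have "\<phi> s \<in> verts G" "\<phi> t \<in> verts G" "inj_on \<phi> K"
      using Jprop(1)[OF \<phi>] st by (auto simp: embeddings_def K_def)
    moreover have "\<not> \<phi> s \<sqsubset> \<phi> t" "\<not> \<phi> t \<sqsubset> \<phi> s"
      using \<rho>_iff[OF \<phi> st(1,2)] \<rho>_iff[OF \<phi> st(2,1)] st(3) by simp_all
    ultimately show "s = t" using less_total[of "\<phi> s" "\<phi> t"] inj_onD[of \<phi> K s t] st by blast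
  qed
  interpret pattern_in_graph G le r p K EH \<rho> c
    by unfold_locales (use finK EHp inj\<rho> k r in \<open>auto simp: K_def\<close>)
  define C where "C = loss_const k (card EH) reach_card"
  define X where "X = k\<^sup>2 * (Suc reach_card ^ k) ^ k * (2 * reach_card)"
  have C: "C = 2 * A * Suc X * Suc reach_card" by (simp add: C_def loss_const_def A_def X_def)
  have "C > 0" using \<open>A > 0\<close> unfolding C by simp
  then have Cpos: "real C > 0" by simp
  obtain E where E: "E \<subseteq> edges G" "robust (\<epsilon> / real C) E"
    and "real (card (edges G - E)) \<le> \<epsilon> / real C * real ((card K)\<^sup>2 * (Suc reach_card ^ card K) ^ card K) *
      (2 * real reach_card * real (card (verts G)))"
    using ex_robust[of "\<epsilon> / real C"] \<epsilon> Cpos by auto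
  then have removed: "real (card (edges G - E)) \<le> \<epsilon> / real C * real X * real n"
    by (simp add: X_def k_def n_def mult.assoc)
  define J' where "J' = {\<phi> \<in> J. (`) \<phi> ` EH \<subseteq> E}"
  have finJ: "finite J" using finI by (simp add: J_def)
  have "card (J - J') \<le> card (edges G - E)"
  proof -
    have "\<forall>\<phi>\<in>J - J'. \<exists>e. e \<in> (`) \<phi> ` EH - E" unfolding J'_def by blast
    \<comment> \<open>A deleted edge is chosen from each destroyed copy; edge-disjointness makes the
      choice injective.\<close>
    then obtain g where g: "\<And>\<phi>. \<phi> \<in> J - J' \<Longrightarrow> g \<phi> \<in> (`) \<phi> ` EH - E" by metis
    have "inj_on g (J - J')"
    proof (rule inj_onI, rule ccontr)
      fix \<phi> \<phi>' assume a: "\<phi> \<in> J - J'" "\<phi>' \<in> J - J'" "g \<phi> = g \<phi>'" "\<phi> \<noteq> \<phi>'"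
      then have "(`) \<phi> ` EH \<inter> (`) \<phi>' ` EH = {}" using disj[of \<phi> \<phi>'] unfolding J_def by blast
      then show False using g[OF a(1)] g[OF a(2)] a(3) by auto
    qed
    moreover have "g ` (J - J') \<subseteq> edges G - E"
      using g Jprop(1) unfolding embeddings_def EH_def by fastforce
    ultimately show ?thesis using card_inj_on_le finite_edges by blast
  qed
  then have "card J \<le> card J' + card (edges G - E)"
    using card_Diff_subset[of J' J] finJ card_mono[of J J'] unfolding J'_def by auto
  then have "real A * real (card J) \<le> real A * real (card J') + real A * real (card (edges G - E))"
    by (metis of_nat_add of_nat_le_iff mult_left_mono of_nat_0_le_iff distrib_left)
  moreover have "real A * real (card (edges G - E)) \<le> \<epsilon> * real n / 2"
  proof -
    have "real A * real (card (edges G - E)) \<le> real A * (\<epsilon> / real C * real X * real n)"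
      by (rule mult_left_mono[OF removed]) simp
    also have "\<dots> = (\<epsilon> * real n) * (real A * real X / real C)" by simp
    also have "\<dots> \<le> (\<epsilon> * real n) * (1 / 2)"
    proof (rule mult_left_mono)
      \<comment> \<open>The constant is chosen so that deletion destroys at most half of the
        \<open>\<epsilon> * n / A\<close> copies guaranteed in \<open>J\<close>.\<close>
      have "2 * A * X \<le> C" unfolding C by (simp add: algebra_simps)
      then have "real (2 * A * X) \<le> real C" by (simp only: of_nat_le_iff)
      then show "real A * real X / real C \<le> 1 / 2" using Cpos by (simp add: field_simps)
    qed (use \<epsilon> in simp)
    finally show ?thesis by simp
  qed
  ultimately have epsJ': "\<epsilon> * real n \<le> 2 * real A * real (card J')" using epsJ by linarith
  have J'_homs: "J' \<subseteq> homs E"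
  proof
    fix \<phi> assume "\<phi> \<in> J'"
    then have \<phi>: "\<phi> \<in> J" "\<And>e. e \<in> EH \<Longrightarrow> \<phi> ` e \<in> E" by (auto simp: J'_def)
    have "{\<phi> a, \<phi> b} \<in> E" if "{a, b} \<in> EH" for a b using \<phi>(2)[OF that] by simp
    moreover have "\<phi> s \<sqsubset> \<phi> t" if "anc s t" "s \<noteq> t" for s t
      using \<rho>_iff[OF \<phi>(1)] anc_less that anc_in_K by blast
    moreover have "\<phi> \<in> K \<rightarrow>\<^sub>E verts G" using Jprop(1)[OF \<phi>(1)] by (simp add: embeddings_def K_def)
    ultimately show "\<phi> \<in> homs E" using Jprop(2)[OF \<phi>(1)] unfolding homs_def by simp
  qed
  have start: "\<epsilon> / real C * real n \<le> real (card {\<phi> z | \<phi> z. \<phi> \<in> homs E \<and> anc y z})"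
    if tu: "{t, u} \<in> EH" "anc y t" "anc y u" for t u y
  proof -
    define W where "W = {\<phi> z | \<phi> z. \<phi> \<in> homs E \<and> anc y z}"
    have WV: "W \<subseteq> verts G" unfolding W_def using homs_verts anc_in_K by blast
    \<comment> \<open>Distinct copies send the edge \<open>{t, u}\<close> to distinct edges inside
      \<open>W\<close>, so \<open>W\<close> has to be large.\<close>
    have inj: "inj_on (\<lambda>\<phi>. {\<phi> t, \<phi> u}) J'"
    proof (rule inj_onI, rule ccontr)
      fix \<phi> \<phi>' assume a: "\<phi> \<in> J'" "\<phi>' \<in> J'" "{\<phi> t, \<phi> u} = {\<phi>' t, \<phi>' u}" "\<phi> \<noteq> \<phi>'"
      then have "(`) \<phi> ` EH \<inter> (`) \<phi>' ` EH = {}" using disj[of \<phi> \<phi>'] unfolding J'_def J_def by blast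
      moreover have "{\<phi> t, \<phi> u} \<in> (`) \<phi> ` EH" "{\<phi>' t, \<phi>' u} \<in> (`) \<phi>' ` EH"
        using imageI[OF tu(1), of "(`) \<phi>"] imageI[OF tu(1), of "(`) \<phi>'"] by auto
      ultimately show False using a(3) by auto
    qed
    have "card J' = card ((\<lambda>\<phi>. {\<phi> t, \<phi> u}) ` J')" by (rule card_image[OF inj, symmetric])
    also have "\<dots> \<le> reach_card * card W"
    proof (rule card_edges_le[OF r _ _ WV])
      show "(\<lambda>\<phi>. {\<phi> t, \<phi> u}) ` J' \<subseteq> edges G" using J'_homs homs_edge[OF _ tu(1)] E(1) by blast
      fix e assume "e \<in> (\<lambda>\<phi>. {\<phi> t, \<phi> u}) ` J'"
      then show "e \<subseteq> W" unfolding W_def using J'_homs tu by blast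
    qed
    finally have "2 * A * card J' \<le> 2 * A * (Suc X * Suc reach_card * card W)"
      by (intro mult_left_mono) (auto simp: algebra_simps intro: le_trans)
    then have "real (2 * A * card J') \<le> real (2 * A * (Suc X * Suc reach_card * card W))"
      by (simp only: of_nat_le_iff)
    also have "\<dots> = real C * real (card W)" unfolding C by (simp only: of_nat_mult[symmetric] ac_simps)
    finally have "\<epsilon> * real n \<le> real C * real (card W)" using epsJ' by simp
    then show ?thesis unfolding W_def using Cpos by (simp add: field_simps)
  qed
  have "card J' > 0" using epsJ' \<epsilon>n by (intro Nat.gr0I) auto
  then have "homs E \<noteq> {}" using J'_homs by auto
  then have "search_space K EH \<rho> G (homs E) (\<epsilon> / real C)"
  proof (unfold_locales, goal_cases)
    case (6 \<phi> x y)
    then show ?case using E(2) unfolding robust_def extensions_def deg_def by blast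
  next
    case (7 t u y)
    then show ?case using start unfolding n_def by blast
  qed (use homs_verts homs_inj homs_edge homs_glue E(1) in blast)+
  then show ?thesis unfolding C_def k_def K_def EH_def by blast
qed


section \<open>Random probes\<close>

lemma prob_bind_pmf:
  "measure_pmf.prob (bind_pmf p f) A = (\<integral>x. measure_pmf.prob (f x) A \<partial>measure_pmf p)"
proof -
  have prob: "measure_pmf.prob q A = pmf (map_pmf (\<lambda>y. y \<in> A) q) True" for q
    by (simp add: pmf_map vimage_def)
  show ?thesis unfolding prob map_bind_pmf pmf_bind ..
qed

text \<open>Total probability over the event \<open>W\<close>. With \<open>b = 0\<close> this chains
  successes; a positive \<open>b\<close> is the chance left after a failure, as used for
  repetition.\<close>

lemma prob_bind_pmf_ge:
  assumes "\<And>x. x \<in> set_pmf p \<Longrightarrow> x \<in> W \<Longrightarrow> a \<le> measure_pmf.prob (f x) A"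
    and "\<And>x. x \<in> set_pmf p \<Longrightarrow> x \<notin> W \<Longrightarrow> b \<le> measure_pmf.prob (f x) A"
  shows "a * measure_pmf.prob p W + b * (1 - measure_pmf.prob p W) \<le> measure_pmf.prob (bind_pmf p f) A"
proof -
  have int: "integrable (measure_pmf p) (indicat_real W)"
    by (rule measure_pmf.integrable_const_bound[of _ 1]) auto
  have "a * measure_pmf.prob p W + b * (1 - measure_pmf.prob p W) =
      (\<integral>x. b + (a - b) * indicator W x \<partial>measure_pmf p)"
    by (subst Bochner_Integration.integral_add) (auto simp: int measure_pmf.prob_space algebra_simps)
  also have "\<dots> \<le> (\<integral>x. measure_pmf.prob (f x) A \<partial>measure_pmf p)"
  proof (rule integral_mono_AE)
    show "integrable (measure_pmf p) (\<lambda>x. b + (a - b) * indicator W x)"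
      by (intro Bochner_Integration.integrable_add integrable_mult_right int) auto
    show "integrable (measure_pmf p) (\<lambda>x. measure_pmf.prob (f x) A)"
      by (rule measure_pmf.integrable_const_bound[of _ 1]) auto
    show "AE x in measure_pmf p. b + (a - b) * indicator W x \<le> measure_pmf.prob (f x) A"
      using assms by (auto simp: AE_measure_pmf_iff split: split_indicator)
  qed
  finally show ?thesis by (simp add: prob_bind_pmf)
qed

text \<open>The action code of a query of \<open>0\<close> would mean acceptance, hence the maximum.\<close>

definition target :: "nat list \<Rightarrow> nat" where
  "target t = max 1 (arg (arg 0 t) t)"

text \<open>A transcript consists of triples: a random vertex, a random offset and the answer to a query
  of the transcript entry at that offset, latest first.\<close>

fun found :: "nat list \<Rightarrow> nat set set" where
  "found (a # d # v # h) = (if a = 0 then {} else {{target (d # v # h), a}}) \<union> found h"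
| "found _ = {}"

text \<open>Offset 1 denotes the fresh random vertex and offset \<open>j + 2\<close> the entry
  \<open>h ! j\<close>. A probe can thus play either role, a random vertex or a query of a vertex
  seen before, without the tester knowing which one is needed.\<close>

definition probe :: "nat \<Rightarrow> nat \<Rightarrow> nat graph \<Rightarrow> nat list \<Rightarrow> nat list pmf" where
  "probe n B G h = bind_pmf (pmf_of_set {1..n}) (\<lambda>v. bind_pmf (pmf_of_set {1..B}) (\<lambda>d.
     map_pmf (\<lambda>a. answer_code a # d # v # h) (random_neighbour G (target (d # v # h)))))"

primrec probes :: "nat \<Rightarrow> nat \<Rightarrow> nat graph \<Rightarrow> nat \<Rightarrow> nat list \<Rightarrow> nat list pmf" where
  "probes n B G 0 h = return_pmf h"
| "probes n B G (Suc m) h = bind_pmf (probe n B G h) (probes n B G m)"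

lemma probes_add: "probes n B G (m + m') h = bind_pmf (probes n B G m h) (probes n B G m')"
proof (induction m arbitrary: h)
  case (Suc m)
  then have "probes n B G (m + m') = (\<lambda>h. bind_pmf (probes n B G m h) (probes n B G m'))"
    by (rule ext)
  then show ?case by (simp add: bind_assoc_pmf)
qed (simp add: bind_return_pmf)

lemma probes_one: "probes n B G 1 h = probe n B G h"
proof -
  have "probes n B G 0 = return_pmf" by (rule ext) simp
  then show ?thesis by (simp add: bind_return_pmf')
qed

definition neighbours :: "'a graph \<Rightarrow> 'a \<Rightarrow> 'a set" where
  "neighbours G v = {u. {v, u} \<in> edges G}"

lemma finite_neighbours: "simple_graph G \<Longrightarrow> finite (neighbours G v)"
  unfolding neighbours_def simple_graph_def by (rule finite_subset[of _ "verts G"]) auto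

text \<open>Isolated vertices of \<open>H\<close> show up in no recorded edge; they only need
  distinct places in \<open>{1..n}\<close>.\<close>

definition detects :: "'b graph \<Rightarrow> nat \<Rightarrow> nat list \<Rightarrow> bool" where
  "detects H n h \<longleftrightarrow> (\<exists>f. inj_on f (verts H) \<and> f ` verts H \<subseteq> {1..n} \<and> (\<forall>e\<in>edges H. f ` e \<in> found h))"

locale probing =
  fixes n B :: nat and G :: "nat graph"
  assumes simple: "simple_graph G" and verts: "verts G = {1..n}" and n_pos: "n > 0" and B_pos: "B > 0"
begin

lemma answer_cases:
  assumes "a \<in> set_pmf (random_neighbour G u)"
  obtains "answer_code a = 0" | "answer_code a \<in> neighbours G u"
  using assms finite_neighbours[OF simple, of u]
  by (auto simp: random_neighbour_def Let_def neighbours_def answer_code_def split: if_splits)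

lemma probe_support:
  assumes "h' \<in> set_pmf (probe n B G h)"
  shows "\<exists>a d v. h' = a # d # v # h \<and> found h \<subseteq> found h' \<and> found h' \<subseteq> found h \<union> edges G"
proof -
  from assms obtain v d a where h': "h' = answer_code a # d # v # h"
    and a: "a \<in> set_pmf (random_neighbour G (target (d # v # h)))"
    unfolding probe_def by auto
  from a show ?thesis
    by (cases rule: answer_cases) (auto simp: h' neighbours_def)
qed

lemma probes_support:
  "h' \<in> set_pmf (probes n B G m h) \<Longrightarrow>
    \<exists>l. h' = l @ h \<and> length l = 3 * m \<and> found h \<subseteq> found h' \<and> found h' \<subseteq> found h \<union> edges G"
proof (induction m arbitrary: h)
  case (Suc m)
  then obtain h1 where h1: "h1 \<in> set_pmf (probe n B G h)" "h' \<in> set_pmf (probes n B G m h1)" by auto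
  from probe_support[OF h1(1)] Suc.IH[OF h1(2)] show ?case by force
qed simp

text \<open>Whatever the random choices, only edges of \<open>G\<close> are recorded; this is why
  the error is one-sided.\<close>

lemma detects_sound:
  assumes "h \<in> set_pmf (probes n B G m [])" "detects H n h" "simple_graph H"
  shows "G \<notin> free_of H"
proof -
  obtain f where f: "inj_on f (verts H)" "f ` verts H \<subseteq> {1..n}" "\<forall>e\<in>edges H. f ` e \<in> found h"
    using assms(2) by (auto simp: detects_def)
  have "found h \<subseteq> edges G" using probes_support[OF assms(1)] by auto
  moreover have "restrict f (verts H) ` e = f ` e" if "e \<in> edges H" for e
    using that assms(3) by (intro image_cong) (auto simp: simple_graph_def)
  ultimately have "restrict f (verts H) \<in> embeddings H G"
    unfolding embeddings_def using f verts by auto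
  then show ?thesis using free_of_iff[OF assms(3) simple] by blast
qed

section \<open>Success probabilities of sequences of probes\<close>

definition likely :: "nat \<Rightarrow> real \<Rightarrow> nat list \<Rightarrow> (nat list \<Rightarrow> bool) \<Rightarrow> bool" where
  "likely m q h P \<longleftrightarrow> q \<le> measure_pmf.prob (probes n B G m h) {h'. P h'}"

lemma likely_trans:
  assumes "likely m q h P" "0 \<le> q'"
    and "\<And>h'. h' \<in> set_pmf (probes n B G m h) \<Longrightarrow> P h' \<Longrightarrow> likely m' q' h' Q"
  shows "likely (m + m') (q * q') h Q"
proof -
  have "q * q' \<le> q' * measure_pmf.prob (probes n B G m h) {h'. P h'}"
    using assms(1,2) unfolding likely_def by (metis mult.commute mult_left_mono)
  also have "\<dots> \<le> measure_pmf.prob (bind_pmf (probes n B G m h) (probes n B G m')) {h'. Q h'}"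
    using prob_bind_pmf_ge[of "probes n B G m h" "{h'. P h'}" q' "probes n B G m'" "{h'. Q h'}" 0] assms(3)
    unfolding likely_def by auto
  finally show ?thesis unfolding likely_def probes_add .
qed

lemma likely_one:
  assumes "\<And>h'. h' \<in> set_pmf (probes n B G m h) \<Longrightarrow> P h'"
  shows "likely m 1 h P"
proof -
  have "AE h' in measure_pmf (probes n B G m h). h' \<in> {h'. P h'}"
    using assms by (simp add: AE_measure_pmf_iff)
  then have "measure_pmf.prob (probes n B G m h) {h'. P h'} = 1"
    by (subst measure_pmf.prob_eq_1) auto
  then show ?thesis unfolding likely_def by simp
qed

lemma likely_mono:
  assumes "likely m q h P" "q' \<le> q" "\<And>h'. h' \<in> set_pmf (probes n B G m h) \<Longrightarrow> P h' \<Longrightarrow> Q h'"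
  shows "likely m q' h Q"
proof -
  have "measure_pmf.prob (probes n B G m h) {h'. P h'} \<le> measure_pmf.prob (probes n B G m h) {h'. Q h'}"
    by (rule measure_pmf.finite_measure_mono_AE) (auto simp: AE_measure_pmf_iff assms(3))
  then show ?thesis using assms(1,2) unfolding likely_def by linarith
qed

lemma detects_mono: "detects H n h \<Longrightarrow> found h \<subseteq> found h' \<Longrightarrow> detects H n h'"
  unfolding detects_def by blast

text \<open>A detection is never lost, since recorded edges only accumulate, and a failed attempt is
  followed by another from whatever transcript it left behind; hence the assumption for all
  \<open>h\<close>.\<close>

lemma likely_repeat:
  assumes q: "0 \<le> q" "q \<le> 1" and likely: "\<And>h. likely m q h (detects H n)"
  shows "likely (i * m) (1 - (1 - q) ^ i) h (detects H n)"
proof (induction i arbitrary: h)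
  case 0
  then show ?case by (simp add: likely_def)
next
  case (Suc i)
  let ?p = "measure_pmf.prob (probes n B G m h) {h'. detects H n h'}"
  let ?b = "1 - (1 - q) ^ i"
  have 1: "1 \<le> measure_pmf.prob (probes n B G (i * m) h') {h'. detects H n h'}" if "detects H n h'" for h'
    using likely_one[of "i * m" h' "detects H n"] detects_mono[OF that] probes_support
    unfolding likely_def by blast
  have "1 * ?p + ?b * (1 - ?p) \<le>
      measure_pmf.prob (bind_pmf (probes n B G m h) (probes n B G (i * m))) {h'. detects H n h'}"
    by (rule prob_bind_pmf_ge) (use 1 Suc.IH in \<open>auto simp: likely_def\<close>)
  moreover have "1 - (1 - q) ^ Suc i \<le> 1 * ?p + ?b * (1 - ?p)"
  proof -
    have "(1 - ?p) * (1 - q) ^ i \<le> (1 - q) * (1 - q) ^ i"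
      using likely[of h] q by (intro mult_right_mono) (auto simp: likely_def)
    then show ?thesis by (simp add: algebra_simps)
  qed
  ultimately show ?case unfolding likely_def by (simp add: probes_add)
qed



lemma likely_random_vertex:
  assumes W: "W \<subseteq> {1..n}" "\<theta> * real n \<le> real (card W)"
  shows "likely 1 \<theta> h (\<lambda>h'. \<exists>v\<in>W. v \<in> set (take 3 h'))"
proof -
  have 1: "\<theta> \<le> measure_pmf.prob (pmf_of_set {1..n}) W"
    using W n_pos by (simp add: measure_pmf_of_set Int_absorb1 pos_le_divide_eq)
  have 2: "1 \<le> measure_pmf.prob (bind_pmf (pmf_of_set {1..B}) (\<lambda>d.
     map_pmf (\<lambda>a. answer_code a # d # v # h) (random_neighbour G (target (d # v # h)))))
     {h'. \<exists>v\<in>W. v \<in> set (take 3 h')}" (is "1 \<le> measure_pmf.prob ?M ?S") if "v \<in> W" for v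
  proof -
    have "AE h' in measure_pmf ?M. h' \<in> ?S" using that by (auto simp: AE_measure_pmf_iff)
    then have "measure_pmf.prob ?M ?S = 1" by (subst measure_pmf.prob_eq_1) auto
    then show ?thesis by linarith
  qed
  have "\<theta> \<le> 1 * measure_pmf.prob (pmf_of_set {1..n}) W +
      0 * (1 - measure_pmf.prob (pmf_of_set {1..n}) W)" using 1 by simp
  also have "\<dots> \<le> measure_pmf.prob (probe n B G h) {h'. \<exists>v\<in>W. v \<in> set (take 3 h')}"
    unfolding probe_def by (rule prob_bind_pmf_ge) (use 2 in auto)
  finally show ?thesis unfolding likely_def probes_one .
qed

text \<open>The offset points to \<open>u\<close> with probability \<open>1 / B\<close>, and then
  the answer lies in \<open>Z\<close> with probability at least \<open>\<theta>\<close>.\<close>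

lemma likely_query:
  assumes u: "u \<in> set (take c h)" "u \<ge> 1" "c + 1 \<le> B"
    and Z: "Z \<subseteq> neighbours G u" "Z \<noteq> {}" "\<theta> * real (card (neighbours G u)) \<le> real (card Z)"
    and \<theta>: "0 \<le> \<theta>"
  shows "likely 1 (\<theta> / real B) h (\<lambda>h'. \<exists>w\<in>Z. w \<in> set (take 3 h') \<and> {u, w} \<in> found h')"
proof -
  let ?S = "{h'. \<exists>w\<in>Z. w \<in> set (take 3 h') \<and> {u, w} \<in> found h'}"
  obtain j where j: "j < c" "j < length h" "h ! j = u" using u(1) by (auto simp: in_set_conv_nth)
  \<comment> \<open>Two entries, the offset and the random vertex, precede \<open>h\<close> when the
    target is read.\<close>
  have target: "target ((j + 2) # v # h) = u" for v
    using j u(2) by (simp add: target_def arg_def)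
  \<comment> \<open>The answer 0 stands for a missing neighbour and records no edge, so vertices
    have to be positive.\<close>
  have pos: "0 < w" if "w \<in> Z" for w
    using that Z(1) simple verts unfolding neighbours_def simple_graph_def by fastforce
  have fin: "finite (neighbours G u)" by (rule finite_neighbours[OF simple])
  have ne: "neighbours G u \<noteq> {}" using Z by auto
  have answers: "random_neighbour G u = map_pmf Some (pmf_of_set (neighbours G u))"
    using ne by (auto simp: random_neighbour_def neighbours_def Let_def)
  have answer: "\<theta> \<le> measure_pmf.prob (map_pmf (\<lambda>a. answer_code a # (j + 2) # v # h)
      (random_neighbour G (target ((j + 2) # v # h)))) ?S" for v
  proof -
    have "\<theta> \<le> measure_pmf.prob (pmf_of_set (neighbours G u)) Z"
      using Z fin ne by (simp add: measure_pmf_of_set Int_absorb1 pos_le_divide_eq card_gt_0_iff)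
    also have "\<dots> \<le> measure_pmf.prob (pmf_of_set (neighbours G u))
        {w. w # (j + 2) # v # h \<in> ?S}"
    proof (intro measure_pmf.finite_measure_mono subsetI)
      fix w assume w: "w \<in> Z"
      have "{u, w} \<in> found (w # (j + 2) # v # h)"
        using pos[OF w] target[of v] by (simp only: found.simps) simp
      then show "w \<in> {w. w # (j + 2) # v # h \<in> ?S}" using w by (auto simp del: found.simps)
    qed simp
    also have "\<dots> = measure_pmf.prob (map_pmf (\<lambda>a. answer_code a # (j + 2) # v # h)
      (random_neighbour G (target ((j + 2) # v # h)))) ?S"
      unfolding target answers by (simp add: vimage_def answer_code_def del: found.simps)
    finally show ?thesis .
  qed
  have offset: "\<theta> / real B \<le> measure_pmf.prob (bind_pmf (pmf_of_set {1..B}) (\<lambda>d.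
     map_pmf (\<lambda>a. answer_code a # d # v # h) (random_neighbour G (target (d # v # h))))) ?S" for v
  proof -
    have "measure_pmf.prob (pmf_of_set {1..B}) {j + 2} = 1 / real B"
      using j(1) u(3) by (simp add: measure_pmf_of_set B_pos)
    then have "\<theta> / real B = \<theta> * measure_pmf.prob (pmf_of_set {1..B}) {j + 2} +
        0 * (1 - measure_pmf.prob (pmf_of_set {1..B}) {j + 2})" by simp
    also have "\<dots> \<le> measure_pmf.prob (bind_pmf (pmf_of_set {1..B}) (\<lambda>d.
     map_pmf (\<lambda>a. answer_code a # d # v # h) (random_neighbour G (target (d # v # h))))) ?S"
      by (rule prob_bind_pmf_ge) (use answer[of v] in auto)
    finally show ?thesis .
  qed
  \<comment> \<open>The random vertex drawn first is irrelevant to a query of an older entry, hence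
    the event \<open>UNIV\<close>.\<close>
  have "\<theta> / real B \<le> \<theta> / real B * measure_pmf.prob (pmf_of_set {1..n}) UNIV +
      0 * (1 - measure_pmf.prob (pmf_of_set {1..n}) UNIV)" by simp
  also have "\<dots> \<le> measure_pmf.prob (probe n B G h) ?S"
    unfolding probe_def by (rule prob_bind_pmf_ge) (use offset in auto)
  finally show ?thesis unfolding likely_def probes_one .
qed

end


section \<open>The search\<close>

locale search = search_space K EH \<rho> G \<Phi> \<theta> + probing n B G
  for K :: "'b set" and EH and \<rho> :: "'b \<Rightarrow> nat" and G \<Phi> \<theta> n B +
  assumes \<theta>_nonneg: "0 \<le> \<theta>" and \<theta>_le: "\<theta> \<le> 1"
begin

definition q where "q = \<theta> / real B"

lemma q_nonneg: "0 \<le> q"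
  using \<theta>_nonneg by (simp add: q_def)

lemma q_le: "q \<le> 1" "q \<le> \<theta>"
proof -
  have "q \<le> \<theta> / 1" unfolding q_def
    using B_pos \<theta>_nonneg by (intro divide_left_mono) auto
  then show "q \<le> \<theta>" "q \<le> 1" using \<theta>_le by auto
qed

text \<open>The first argument of a window predicate is the number of latest transcript entries that it
  may refer to.\<close>

definition persistent :: "(nat \<Rightarrow> nat list \<Rightarrow> bool) \<Rightarrow> bool" where
  "persistent P \<longleftrightarrow> (\<forall>c h l. P c h \<longrightarrow> found h \<subseteq> found (l @ h) \<longrightarrow> P (c + length l) (l @ h))"

text \<open>Every probe costs a factor \<open>q\<close> and three transcript entries. With this
  convention both the probability and the window follow from the number of probes, and plans compose
  by adding these numbers.\<close>

definition achieves :: "nat \<Rightarrow> nat \<Rightarrow> nat list \<Rightarrow> (nat \<Rightarrow> nat list \<Rightarrow> bool) \<Rightarrow> bool" where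
  "achieves m c h P \<longleftrightarrow> likely m (q ^ m) h (P (c + 3 * m))"

lemma achieves_trans:
  assumes "achieves m c h P"
    and "\<And>l. found h \<subseteq> found (l @ h) \<Longrightarrow> length l = 3 * m \<Longrightarrow> P (c + 3 * m) (l @ h) \<Longrightarrow>
      achieves m' (c + 3 * m) (l @ h) Q"
  shows "achieves (m + m') c h Q"
proof -
  have "likely (m + m') (q ^ m * q ^ m') h (Q (c + 3 * m + 3 * m'))"
  proof (rule likely_trans)
    show "likely m (q ^ m) h (P (c + 3 * m))" using assms(1) by (simp add: achieves_def)
    show "0 \<le> q ^ m'" using q_nonneg by simp
    fix h' assume "h' \<in> set_pmf (probes n B G m h)" "P (c + 3 * m) h'"
    then show "likely m' (q ^ m') h' (Q (c + 3 * m + 3 * m'))"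
      using probes_support assms(2) unfolding achieves_def by blast
  qed
  then show ?thesis by (simp add: achieves_def power_add algebra_simps)
qed

text \<open>Idle probes do no harm to a persistent goal, so phases can be padded to a fixed
  length.\<close>

lemma achieves_now: "persistent P \<Longrightarrow> P c h \<Longrightarrow> achieves m c h P"
proof -
  assume P: "persistent P" "P c h"
  have "likely m 1 h (P (c + 3 * m))"
    by (rule likely_one) (use P probes_support in \<open>unfold persistent_def, metis\<close>)
  then show ?thesis unfolding achieves_def
    using q_nonneg q_le by (rule_tac likely_mono) (auto intro: power_le_one)
qed

lemma achieves_zero: "P c h \<Longrightarrow> achieves 0 c h P"
  by (simp add: achieves_def likely_def)

lemma achieves_mono:
  assumes "achieves m c h P" "\<And>c h. P c h \<Longrightarrow> Q c h" "persistent Q" "m \<le> m'"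
  shows "achieves m' c h Q"
proof -
  have "achieves (m + (m' - m)) c h Q"
    by (rule achieves_trans[OF assms(1)]) (use assms(2,3) achieves_now in blast)
  then show ?thesis using assms(4) by simp
qed

section \<open>Moving from copy to copy\<close>

definition known :: "nat \<Rightarrow> nat list \<Rightarrow> nat \<Rightarrow> bool" where
  "known c h u \<longleftrightarrow> u \<in> set (take c h)"

lemma known_append: "known c h u \<Longrightarrow> known (c + length l) (l @ h) u"
  by (simp add: known_def)

lemma known_take: "u \<in> set (take 3 h) \<Longrightarrow> known (c + 3) h u"
  unfolding known_def using set_take_subset_set_take[of 3 "c + 3" h] by auto

lemma \<Phi>_pos: "\<phi> \<in> \<Phi> \<Longrightarrow> x \<in> K \<Longrightarrow> 1 \<le> \<phi> x"
  using \<Phi>_verts[of \<phi> x] verts by simp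

text \<open>Robustness at the state of \<open>\<phi>\<close> and \<open>x\<close>. The answer is
  explained by some other copy, which keeps \<open>x\<close> and its ancestors but possibly nothing
  else.\<close>

lemma achieves_query:
  assumes \<phi>: "\<phi> \<in> \<Phi>" and xy: "{x, y} \<in> EH" and k: "known c h (\<phi> x)" and c: "c + 1 \<le> B"
  shows "achieves 1 c h (\<lambda>c h. \<exists>\<phi>'\<in>\<Phi>. (\<forall>s. anc s x \<longrightarrow> \<phi>' s = \<phi> s) \<and> known c h (\<phi>' y) \<and>
    {\<phi> x, \<phi>' y} \<in> found h)"
proof -
  let ?Z = "{\<phi>' y | \<phi>'. \<phi>' \<in> \<Phi> \<and> (\<forall>s. anc s x \<longrightarrow> \<phi>' s = \<phi> s)}"
  have x: "x \<in> K" using edge_in_K[OF xy] by blast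
  have sub: "?Z \<subseteq> neighbours G (\<phi> x)"
  proof
    fix w assume "w \<in> ?Z"
    then obtain \<phi>' where "w = \<phi>' y" "\<phi>' \<in> \<Phi>" "\<forall>s. anc s x \<longrightarrow> \<phi>' s = \<phi> s" by blast
    then show "w \<in> neighbours G (\<phi> x)"
      using \<Phi>_edge[of \<phi>' x y] xy anc_refl[OF x] by (simp add: neighbours_def)
  qed
  have "\<phi> y \<in> ?Z" using \<phi> by blast
  then have ne: "?Z \<noteq> {}" by blast
  have "likely 1 (\<theta> / real B) h (\<lambda>h'. \<exists>w\<in>?Z. w \<in> set (take 3 h') \<and> {\<phi> x, w} \<in> found h')"
    by (rule likely_query[of _ c]) (use k \<Phi>_pos[OF \<phi> x] c sub ne \<Phi>_robust[OF \<phi> xy] \<theta>_nonneg in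
      \<open>auto simp: known_def neighbours_def\<close>)
  then show ?thesis unfolding achieves_def
  proof (rule likely_mono)
    fix h' assume "\<exists>w\<in>?Z. w \<in> set (take 3 h') \<and> {\<phi> x, w} \<in> found h'"
    then obtain \<phi>' where "\<phi>' \<in> \<Phi>" "\<forall>s. anc s x \<longrightarrow> \<phi>' s = \<phi> s" "\<phi>' y \<in> set (take 3 h')"
      "{\<phi> x, \<phi>' y} \<in> found h'" by blast
    then show "\<exists>\<phi>'\<in>\<Phi>. (\<forall>s. anc s x \<longrightarrow> \<phi>' s = \<phi> s) \<and> known (c + 3 * 1) h' (\<phi>' y) \<and>
        {\<phi> x, \<phi>' y} \<in> found h'" using known_take by auto
  qed (simp add: q_def)
qed

definition steps where "steps = card K * card K"

text \<open>The ancestors of \<open>y\<close> are ancestors of every vertex of the walk, as the walk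
  stays in the subtree of \<open>y\<close>. So no query on the way changes their images.\<close>

lemma achieves_walk:
  assumes "(z, y) \<in> step_above y ^^ i" "anc y z" "\<phi> \<in> \<Phi>" "known c h (\<phi> z)" "c + 3 * i + 1 \<le> B"
  shows "achieves i c h (\<lambda>c h. \<exists>\<phi>'\<in>\<Phi>. (\<forall>s. anc s y \<longrightarrow> s \<noteq> y \<longrightarrow> \<phi>' s = \<phi> s) \<and> known c h (\<phi>' y))"
  using assms
proof (induction i arbitrary: z \<phi> c h)
  case 0
  then have "\<exists>\<phi>'\<in>\<Phi>. (\<forall>s. anc s y \<longrightarrow> s \<noteq> y \<longrightarrow> \<phi>' s = \<phi> s) \<and> known c h (\<phi>' y)" by auto
  then show ?case by (rule achieves_zero)
next
  case (Suc i)
  from relpow_Suc_D2[OF Suc.prems(1)] obtain z' where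
    z': "(z, z') \<in> step_above y" "(z', y) \<in> step_above y ^^ i" by blast
  then have e: "{z, z'} \<in> EH" "\<rho> y \<le> \<rho> z'" by (auto simp: step_above_def)
  have az': "anc y z'" using anc_adj[OF e(1) Suc.prems(2) e(2)] .
  let ?P = "\<lambda>c h. \<exists>\<phi>'\<in>\<Phi>. (\<forall>s. anc s z \<longrightarrow> \<phi>' s = \<phi> s) \<and> known c h (\<phi>' z') \<and> {\<phi> z, \<phi>' z'} \<in> found h"
  let ?Q = "\<lambda>\<phi> c h. \<exists>\<phi>'\<in>\<Phi>. (\<forall>s. anc s y \<longrightarrow> s \<noteq> y \<longrightarrow> \<phi>' s = \<phi> s) \<and> known c h (\<phi>' y)"
  have "achieves 1 c h ?P" using Suc.prems e by (intro achieves_query) auto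
  then have "achieves (1 + i) c h (?Q \<phi>)"
  proof (rule achieves_trans)
    fix l assume "?P (c + 3 * 1) (l @ h)"
    then obtain \<phi>1 where \<phi>1: "\<phi>1 \<in> \<Phi>" "\<forall>s. anc s z \<longrightarrow> \<phi>1 s = \<phi> s" "known (c + 3) (l @ h) (\<phi>1 z')"
      by auto
    have "achieves i (c + 3) (l @ h) (?Q \<phi>1)"
      using Suc.prems by (intro Suc.IH[OF z'(2) az' \<phi>1(1,3)]) auto
    moreover have "?Q \<phi>1 = ?Q \<phi>"
    proof -
      have "\<phi>1 s = \<phi> s" if "anc s y" for s using anc_trans[OF that Suc.prems(2)] \<phi>1(2) by blast
      then show ?thesis by (intro ext bex_cong refl) auto
    qed
    ultimately show "achieves i (c + 3 * 1) (l @ h) (?Q \<phi>)" by simp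
  qed
  then show ?case by simp
qed

lemma persistent_ex_known:
  "persistent (\<lambda>c h. \<exists>\<phi>'\<in>\<Phi>. R \<phi>' \<and> known c h (\<phi>' y))"
  unfolding persistent_def using known_append by blast

text \<open>A shortest walk uses each pair of the step relation at most once, and there are at most
  \<open>card K * card K\<close> pairs; padding makes the number of probes uniform.\<close>

lemma achieves_walk':
  assumes "anc y z" "\<phi> \<in> \<Phi>" "known c h (\<phi> z)" "c + 3 * steps + 1 \<le> B"
  shows "achieves steps c h (\<lambda>c h. \<exists>\<phi>'\<in>\<Phi>. (\<forall>s. anc s y \<longrightarrow> s \<noteq> y \<longrightarrow> \<phi>' s = \<phi> s) \<and> known c h (\<phi>' y))"
proof -
  have sub: "step_above y \<subseteq> K \<times> K" unfolding step_above_def using edge_in_K by auto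
  have fin: "finite (step_above y)" by (rule finite_subset[OF sub]) (simp add: finite_K)
  have card: "card (step_above y) \<le> steps"
    unfolding steps_def using card_mono[OF _ sub] finite_K by (simp add: card_cartesian_product)
  obtain j where "(z, y) \<in> step_above y ^^ j"
    using assms(1) rtrancl_imp_relpow[where R = "step_above y"] unfolding anc_def by blast
  then obtain i where i: "(z, y) \<in> step_above y ^^ i" "i \<le> steps"
    using relpow_finite_bounded[OF fin, of j] card by fastforce
  have "achieves i c h (\<lambda>c h. \<exists>\<phi>'\<in>\<Phi>. (\<forall>s. anc s y \<longrightarrow> s \<noteq> y \<longrightarrow> \<phi>' s = \<phi> s) \<and> known c h (\<phi>' y))"
    using assms i by (intro achieves_walk) auto
  then show ?thesis by (rule achieves_mono) (use i persistent_ex_known in auto)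
qed

text \<open>Here \<open>x\<close> is the parent of \<open>y\<close>. Where a walk to
  \<open>x\<close> leaves the subtree of \<open>y\<close>, it meets an ancestor of \<open>y\<close>
  of rank at most \<open>\<rho> x\<close>; since the walk never drops below that rank, this ancestor
  is \<open>x\<close>.\<close>

lemma ex_parent_edge:
  assumes "(t, x) \<in> (step_above x)\<^sup>*" "anc y t" "\<rho> x < \<rho> y"
    and max: "\<And>s. anc s y \<Longrightarrow> s \<noteq> y \<Longrightarrow> \<rho> s \<le> \<rho> x"
  shows "\<exists>z. anc y z \<and> {x, z} \<in> EH"
  using assms(1,2)
proof (induction rule: converse_rtrancl_induct)
  case base
  then show ?case using anc_le assms(3) by (meson not_le)
next
  case (step t t')
  then have e: "{t, t'} \<in> EH" "\<rho> x \<le> \<rho> t" "\<rho> x \<le> \<rho> t'" by (auto simp: step_above_def)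
  show ?case
  proof (cases "\<rho> y \<le> \<rho> t'")
    case True
    then show ?thesis using step anc_adj[OF e(1)] by blast
  next
    case False
    have "anc t' t" using anc_edge[of t' t] e(1) False anc_le[OF step.prems] by (auto simp: insert_commute)
    then have "anc t' y" using anc_chain[OF step.prems, of t'] False by simp
    then have "\<rho> t' \<le> \<rho> x" using max False by auto
    then have "\<rho> t' = \<rho> x" using e(3) by simp
    moreover have "x \<in> K" using step(1,2) edge_in_K[OF e(1)]
      by (auto elim: rtranclE simp: step_above_def dest: edge_in_K)
    ultimately have "t' = x" using inj_\<rho> edge_in_K[OF e(1)] by (auto dest: inj_onD)
    then show ?thesis using step.prems e(1) by (auto simp: insert_commute)
  qed
qed

text \<open>Isolated pattern vertices are never searched for, as no edge has to be recorded for
  them.\<close>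

definition touched :: "'b \<Rightarrow> bool" where
  "touched x \<longleftrightarrow> (\<exists>u. {x, u} \<in> EH)"

text \<open>A root of the forest puts no constraint on the new copy, so a random vertex serves;
  otherwise the parent is known and has a neighbour in the subtree of \<open>y\<close>.\<close>

lemma achieves_enter:
  assumes y: "touched y" and \<phi>: "\<phi> \<in> \<Phi>" and c: "c + 1 \<le> B"
    and k: "\<And>s. anc s y \<Longrightarrow> s \<noteq> y \<Longrightarrow> touched s \<Longrightarrow> known c h (\<phi> s)"
  shows "achieves 1 c h (\<lambda>c h. \<exists>\<phi>'\<in>\<Phi>. \<exists>z. anc y z \<and> (\<forall>s. anc s y \<longrightarrow> s \<noteq> y \<longrightarrow> \<phi>' s = \<phi> s) \<and> known c h (\<phi>' z))"
proof -
  define A where "A = {s. anc s y \<and> s \<noteq> y}"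
  obtain u where u: "{y, u} \<in> EH" using y by (auto simp: touched_def)
  have yK: "y \<in> K" using edge_in_K[OF u] by blast
  show ?thesis
  proof (cases "A = {}")
    case True
    have "\<rho> y \<le> \<rho> u"
    proof (rule ccontr)
      assume "\<not> ?thesis"
      then have "anc u y" using anc_edge[of u y] u by (simp add: insert_commute)
      then show False using True edge_in_K[OF u] by (auto simp: A_def)
    qed
    then have "anc y u" using anc_edge[OF u] by blast
    from \<Phi>_start[OF u anc_refl[OF yK] this]
    have "likely 1 \<theta> h (\<lambda>h'. \<exists>v\<in>{\<phi> z | \<phi> z. \<phi> \<in> \<Phi> \<and> anc y z}. v \<in> set (take 3 h'))"
      using \<Phi>_verts verts anc_in_K by (intro likely_random_vertex) auto
    then show ?thesis unfolding achieves_def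
    proof (rule likely_mono)
      fix h' assume "\<exists>v\<in>{\<phi> z | \<phi> z. \<phi> \<in> \<Phi> \<and> anc y z}. v \<in> set (take 3 h')"
      then obtain \<phi>' z where "\<phi>' \<in> \<Phi>" "anc y z" "\<phi>' z \<in> set (take 3 h')" by blast
      then show "\<exists>\<phi>'\<in>\<Phi>. \<exists>z. anc y z \<and> (\<forall>s. anc s y \<longrightarrow> s \<noteq> y \<longrightarrow> \<phi>' s = \<phi> s) \<and> known (c + 3 * 1) h' (\<phi>' z)"
        using known_take True unfolding A_def by fastforce
    qed (use q_le in simp)
  next
    case False
    \<comment> \<open>The parent of \<open>y\<close> is its proper ancestor of largest rank.\<close>
    have finA: "finite A" by (rule finite_subset[OF _ finite_K]) (auto simp: A_def anc_in_K)
    then have "Max (\<rho> ` A) \<in> \<rho> ` A" using False by (intro Max_in) auto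
    then obtain x where x: "x \<in> A" "Max (\<rho> ` A) = \<rho> x" by blast
    have x_max: "\<rho> s \<le> \<rho> x" if "s \<in> A" for s
      using that finA unfolding x(2)[symmetric] by simp
    from x(1) have ax: "anc x y" "x \<noteq> y" by (auto simp: A_def)
    have "\<exists>z. anc y z \<and> {x, z} \<in> EH"
      by (rule ex_parent_edge[of y])
        (use ax x_max anc_less[OF ax] anc_refl[OF yK] in \<open>auto simp: A_def anc_def\<close>)
    then obtain z where z: "anc y z" "{x, z} \<in> EH" by blast
    have "known c h (\<phi> x)" using k ax z(2) by (auto simp: touched_def)
    from achieves_query[OF \<phi> z(2) this c] show ?thesis
    proof (rule achieves_mono)
      fix c h assume "\<exists>\<phi>'\<in>\<Phi>. (\<forall>s. anc s x \<longrightarrow> \<phi>' s = \<phi> s) \<and> known c h (\<phi>' z) \<and> {\<phi> x, \<phi>' z} \<in> found h"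
      then obtain \<phi>' where \<phi>': "\<phi>' \<in> \<Phi>" "\<forall>s. anc s x \<longrightarrow> \<phi>' s = \<phi> s" "known c h (\<phi>' z)" by blast
      \<comment> \<open>Ancestors form a chain, so every proper ancestor of \<open>y\<close> is an
        ancestor of its parent, where the new copy agrees.\<close>
      have "\<phi>' s = \<phi> s" if "anc s y" "s \<noteq> y" for s
        using anc_chain[OF ax(1) that(1)] x_max[of s] that \<phi>'(2) by (auto simp: A_def)
      then show "\<exists>\<phi>'\<in>\<Phi>. \<exists>z. anc y z \<and> (\<forall>s. anc s y \<longrightarrow> s \<noteq> y \<longrightarrow> \<phi>' s = \<phi> s) \<and> known c h (\<phi>' z)"
        using \<phi>'(1,3) z(1) by blast
    qed (auto simp: persistent_def dest: known_append)
  qed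
qed

text \<open>The vertices of \<open>U\<close> are ancestors of \<open>y\<close>. A copy agreeing with
  \<open>\<psi>\<close> on the ancestors of \<open>y\<close> maps them as \<open>\<psi>\<close>
  does, so a successful query records exactly the wanted edge.\<close>

lemma achieves_edges:
  assumes "finite U" "\<And>s. s \<in> U \<Longrightarrow> {y, s} \<in> EH \<and> \<rho> s \<le> \<rho> y" "\<psi> \<in> \<Phi>" "known c h (\<psi> y)"
    "c + 3 * card U + 1 \<le> B"
  shows "achieves (card U) c h (\<lambda>c h. known c h (\<psi> y) \<and> (\<forall>s\<in>U. {\<psi> y, \<psi> s} \<in> found h))"
  using assms
proof (induction U arbitrary: c h rule: finite_induct)
  case empty
  show ?case unfolding card.empty by (rule achieves_zero) (use empty in auto)
next
  case (insert s U)
  let ?P = "\<lambda>c h. known c h (\<psi> y) \<and> {\<psi> y, \<psi> s} \<in> found h"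
  have e: "{y, s} \<in> EH" "\<rho> s \<le> \<rho> y" using insert.prems(1)[of s] by auto
  then have "anc s y" using anc_edge[of s y] by (simp add: insert_commute)
  moreover have "achieves 1 c h (\<lambda>c h. \<exists>\<phi>'\<in>\<Phi>. (\<forall>s. anc s y \<longrightarrow> \<phi>' s = \<psi> s) \<and> known c h (\<phi>' s) \<and>
      {\<psi> y, \<phi>' s} \<in> found h)"
    using insert by (intro achieves_query[OF _ e(1)]) auto
  ultimately have "achieves 1 c h (\<lambda>c h. {\<psi> y, \<psi> s} \<in> found h)"
    by (elim achieves_mono) (auto simp: persistent_def)
  then have "achieves (1 + card U) c h (\<lambda>c h. known c h (\<psi> y) \<and> (\<forall>s\<in>insert s U. {\<psi> y, \<psi> s} \<in> found h))"
  proof (rule achieves_trans)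
    fix l assume l: "found h \<subseteq> found (l @ h)" "length l = 3 * 1" "{\<psi> y, \<psi> s} \<in> found (l @ h)"
    have k: "known (c + 3 * 1) (l @ h) (\<psi> y)" using known_append[OF insert.prems(3), of l] l(2) by simp
    have "achieves (card U) (c + 3 * 1) (l @ h) (\<lambda>c h. known c h (\<psi> y) \<and> (\<forall>s\<in>U. {\<psi> y, \<psi> s} \<in> found h))"
      using insert.prems insert.hyps k by (intro insert.IH) auto
    then have "likely (card U) (q ^ card U) (l @ h)
        (\<lambda>h'. known (c + 3 * 1 + 3 * card U) h' (\<psi> y) \<and> (\<forall>s\<in>U. {\<psi> y, \<psi> s} \<in> found h'))"
      by (simp add: achieves_def)
    then show "achieves (card U) (c + 3 * 1) (l @ h)
        (\<lambda>c h. known c h (\<psi> y) \<and> (\<forall>s\<in>insert s U. {\<psi> y, \<psi> s} \<in> found h))"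
      unfolding achieves_def by (rule likely_mono) (use l(3) probes_support in auto)
  qed
  then show ?case using insert.hyps by simp
qed

section \<open>One round of probes for each pattern vertex\<close>

definition round_len where "round_len = Suc (steps + card K)"

text \<open>The witnessing copy is not fixed in advance: a later round may replace it, but only
  outside \<open>S\<close>.\<close>

definition partial :: "'b set \<Rightarrow> nat \<Rightarrow> nat list \<Rightarrow> bool" where
  "partial S c h \<longleftrightarrow> (\<exists>\<phi>\<in>\<Phi>. (\<forall>x\<in>S. touched x \<longrightarrow> known c h (\<phi> x)) \<and>
     (\<forall>a\<in>S. \<forall>b\<in>S. {a, b} \<in> EH \<longrightarrow> {\<phi> a, \<phi> b} \<in> found h))"

lemma persistent_partial: "persistent (partial S)"
  unfolding persistent_def partial_def using known_append by (meson subsetD)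

text \<open>A round enters the subtree of \<open>y\<close>, walks to \<open>y\<close> and records
  the edges to smaller neighbours. As \<open>S\<close> has smaller ranks, it avoids the subtree, and
  gluing there leaves it intact.\<close>

lemma achieves_extend:
  assumes y: "y \<in> K" and S: "\<And>s. s \<in> S \<Longrightarrow> s \<in> K \<and> \<rho> s < \<rho> y"
    and initial: "\<And>s. s \<in> K \<Longrightarrow> \<rho> s < \<rho> y \<Longrightarrow> s \<in> S"
    and part: "partial S c h" and c: "c + 3 * round_len + 1 \<le> B"
  shows "achieves round_len c h (partial (insert y S))"
proof (cases "touched y")
  case False
  then have "{a, b} \<notin> EH" if "a = y \<or> b = y" for a b
    using that by (auto simp: touched_def insert_commute)
  then have "partial (insert y S) c h" using part False unfolding partial_def by auto
  then show ?thesis using achieves_now persistent_partial by blast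
next
  case True
  obtain \<phi> where \<phi>: "\<phi> \<in> \<Phi>" "\<And>x. x \<in> S \<Longrightarrow> touched x \<Longrightarrow> known c h (\<phi> x)"
    "\<And>a b. a \<in> S \<Longrightarrow> b \<in> S \<Longrightarrow> {a, b} \<in> EH \<Longrightarrow> {\<phi> a, \<phi> b} \<in> found h"
    using part unfolding partial_def by blast
  have c': "c + 3 * steps + 3 * card K + 4 \<le> B" using c by (simp add: round_len_def)
  have "achieves 1 c h (\<lambda>c h. \<exists>\<phi>'\<in>\<Phi>. \<exists>z. anc y z \<and> (\<forall>s. anc s y \<longrightarrow> s \<noteq> y \<longrightarrow> \<phi>' s = \<phi> s) \<and> known c h (\<phi>' z))"
    (is "achieves 1 c h ?P")
  proof (rule achieves_enter[OF True \<phi>(1)])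
    fix s assume "anc s y" "s \<noteq> y" "touched s"
    then show "known c h (\<phi> s)" using \<phi>(2) initial anc_less anc_in_K by blast
  qed (use c' in simp)
  then have "achieves (1 + (steps + card K)) c h (partial (insert y S))"
  proof (rule achieves_trans)
    fix l1 assume l1: "found h \<subseteq> found (l1 @ h)" "length l1 = 3 * 1" "?P (c + 3 * 1) (l1 @ h)"
    then obtain \<phi>1 z where \<phi>1: "\<phi>1 \<in> \<Phi>" "anc y z" "\<And>s. anc s y \<Longrightarrow> s \<noteq> y \<Longrightarrow> \<phi>1 s = \<phi> s"
      "known (c + 3 * 1) (l1 @ h) (\<phi>1 z)" by blast
    have "achieves steps (c + 3 * 1) (l1 @ h)
      (\<lambda>c h. \<exists>\<phi>'\<in>\<Phi>. (\<forall>s. anc s y \<longrightarrow> s \<noteq> y \<longrightarrow> \<phi>' s = \<phi>1 s) \<and> known c h (\<phi>' y))"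
      (is "achieves _ _ _ ?Q")
      by (rule achieves_walk'[OF \<phi>1(2,1,4)]) (use c' in simp)
    then show "achieves (steps + card K) (c + 3 * 1) (l1 @ h) (partial (insert y S))"
    proof (rule achieves_trans)
      fix l2 assume l2: "found (l1 @ h) \<subseteq> found (l2 @ l1 @ h)" "length l2 = 3 * steps"
        "?Q (c + 3 * 1 + 3 * steps) (l2 @ l1 @ h)"
      let ?c = "c + 3 * 1 + 3 * steps" and ?h = "l2 @ l1 @ h"
      from l2(3) obtain \<phi>2 where \<phi>2: "\<phi>2 \<in> \<Phi>" "\<And>s. anc s y \<Longrightarrow> s \<noteq> y \<Longrightarrow> \<phi>2 s = \<phi>1 s"
        "known ?c ?h (\<phi>2 y)" by blast
      \<comment> \<open>The copy met last agrees with \<open>\<phi>\<close> on the proper ancestors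
        of \<open>y\<close>, passing through \<open>\<phi>1\<close>, which is exactly the condition
        for gluing.\<close>
      define \<psi> where "\<psi> = (\<lambda>t. if anc y t then \<phi>2 t else \<phi> t)"
      have \<psi>: "\<psi> \<in> \<Phi>" unfolding \<psi>_def
        by (rule \<Phi>_glue[OF \<phi>(1) \<phi>2(1)]) (simp add: \<phi>2(2) \<phi>1(3))
      have \<psi>y: "\<psi> y = \<phi>2 y" using anc_refl[OF y] by (simp add: \<psi>_def)
      have \<psi>S: "\<psi> s = \<phi> s" if "s \<in> S" for s
        using anc_le[of y s] S[OF that] by (auto simp: \<psi>_def)
      define U where "U = {s. {y, s} \<in> EH \<and> \<rho> s \<le> \<rho> y}"
      have UK: "U \<subseteq> K" unfolding U_def using edge_in_K by blast
      have cU: "card U \<le> card K" by (rule card_mono[OF finite_K UK])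
      have "achieves (card U) ?c ?h (\<lambda>c h. known c h (\<psi> y) \<and> (\<forall>s\<in>U. {\<psi> y, \<psi> s} \<in> found h))"
        (is "achieves _ _ _ ?R")
        using \<phi>2(3) \<psi> \<psi>y c' cU finite_subset[OF UK finite_K] by (intro achieves_edges) (auto simp: U_def)
      \<comment> \<open>Padding gives all rounds the same length, however many smaller neighbours
        \<open>y\<close> has.\<close>
      then have "achieves (card U + (card K - card U)) ?c ?h (partial (insert y S))"
      proof (rule achieves_trans)
        fix l3 assume l3: "found ?h \<subseteq> found (l3 @ ?h)" "length l3 = 3 * card U"
          "?R (?c + 3 * card U) (l3 @ ?h)"
        have sub: "found h \<subseteq> found (l3 @ ?h)" using l1(1) l2(1) l3(1) by blast
        have "known (?c + 3 * card U) (l3 @ ?h) (\<psi> x)" if "x \<in> S" "touched x" for x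
          using known_append[OF \<phi>(2)[OF that], of "l3 @ l2 @ l1"] l1(2) l2(2) l3(2) \<psi>S[OF that(1)]
          by (simp add: algebra_simps)
        moreover have "{\<psi> a, \<psi> b} \<in> found (l3 @ ?h)" if "a \<in> S" "b \<in> S" "{a, b} \<in> EH" for a b
          using \<phi>(3)[OF that] sub \<psi>S that by auto
        moreover have new: "{\<psi> y, \<psi> b} \<in> found (l3 @ ?h)" if "b \<in> S" "{y, b} \<in> EH" for b
          using l3(3) that S[OF that(1)] by (auto simp: U_def)
        moreover have "{\<psi> a, \<psi> y} \<in> found (l3 @ ?h)" if "a \<in> S" "{a, y} \<in> EH" for a
          using new[of a] that by (simp add: insert_commute)
        moreover have "{y, y} \<notin> EH" using edge_in_K by blast
        ultimately have "partial (insert y S) (?c + 3 * card U) (l3 @ ?h)"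
          unfolding partial_def using \<psi> l3(3) by (intro bexI[of _ \<psi>]) blast+
        then show "achieves (card K - card U) (?c + 3 * card U) (l3 @ ?h) (partial (insert y S))"
          using achieves_now persistent_partial by blast
      qed
      then show "achieves (card K) ?c ?h (partial (insert y S))" using cU by simp
    qed
  qed
  then show ?thesis by (simp add: round_len_def)
qed

text \<open>Induction along the ranks through initial segments, so that all proper ancestors of the
  next vertex have been treated.\<close>

lemma achieves_partial:
  assumes "S \<subseteq> K" "\<And>s t. s \<in> K \<Longrightarrow> t \<in> S \<Longrightarrow> \<rho> s < \<rho> t \<Longrightarrow> s \<in> S" "3 * (round_len * card K) + 1 \<le> B"
  shows "achieves (round_len * card S) 0 h (partial S)"
proof -
  have "finite S" using assms(1) finite_K by (rule finite_subset)
  then show ?thesis using assms(1,2)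
  proof (induction S rule: finite_ranking_induct[where f = \<rho>])
    case empty
    obtain \<phi> where "\<phi> \<in> \<Phi>" using \<Phi>_ne by blast
    then have "partial {} 0 h" unfolding partial_def by auto
    then show ?case by (simp add: achieves_zero)
  next
    case (insert y S)
    show ?case
    proof (cases "y \<in> S")
      case True
      then have "insert y S = S" by blast
      then show ?thesis using insert.IH insert.prems by simp
    next
      case False
      have less: "s \<in> K \<and> \<rho> s < \<rho> y" if "s \<in> S" for s
        using insert.hyps(2)[OF that] insert.prems(1) that False inj_\<rho>
        by (metis inj_on_contraD insertCI le_neq_implies_less subsetD)
      have "achieves (round_len * card S) 0 h (partial S)"
      proof (rule insert.IH)
        fix s t assume "s \<in> K" "t \<in> S" "\<rho> s < \<rho> t"
        then show "s \<in> S" using insert.prems(2)[of s t] less[of t] by auto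
      qed (use insert.prems in auto)
      moreover have "achieves round_len (0 + 3 * (round_len * card S)) (l @ h) (partial (insert y S))"
        if "partial S (0 + 3 * (round_len * card S)) (l @ h)" for l
      proof (rule achieves_extend[OF _ less _ that])
        show "y \<in> K" using insert.prems(1) by blast
        show "s \<in> S" if "s \<in> K" "\<rho> s < \<rho> y" for s using insert.prems(2)[of s y] that by auto
        have "Suc (card S) \<le> card K"
          using card_mono[OF finite_K insert.prems(1)] False insert.hyps(1) by simp
        then have "round_len * Suc (card S) \<le> round_len * card K" by (rule mult_le_mono2)
        then have "round_len * card S + round_len \<le> round_len * card K" by simp
        then show "0 + 3 * (round_len * card S) + 3 * round_len + 1 \<le> B" using assms(3) by linarith
      qed
      ultimately have "achieves (round_len * card S + round_len) 0 h (partial (insert y S))"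
        by (rule achieves_trans)
      then show ?thesis using False insert.hyps(1) by (simp add: algebra_simps)
    qed
  qed
qed

lemma likely_detects:
  assumes "verts H = K" "edges H = EH" "3 * (round_len * card K) + 1 \<le> B"
  shows "likely (round_len * card K) (q ^ (round_len * card K)) h (detects H n)"
proof -
  have "achieves (round_len * card K) 0 h (partial K)" by (rule achieves_partial) (use assms in auto)
  then show ?thesis unfolding achieves_def
  proof (rule likely_mono)
    fix h' assume "partial K (0 + 3 * (round_len * card K)) h'"
    then obtain \<phi> where \<phi>: "\<phi> \<in> \<Phi>" "\<forall>a\<in>K. \<forall>b\<in>K. {a, b} \<in> EH \<longrightarrow> {\<phi> a, \<phi> b} \<in> found h'"
      unfolding partial_def by blast
    have "\<phi> ` e \<in> found h'" if e: "e \<in> EH" for e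
    proof -
      obtain a b where "e = {a, b}" "a \<in> K" "b \<in> K" using EH[OF e] by (auto simp: card_2_iff)
      then show ?thesis using \<phi>(2) e by simp
    qed
    moreover have "\<phi> ` K \<subseteq> {1..n}" using \<Phi>_verts[OF \<phi>(1)] verts by auto
    ultimately show "detects H n h'" unfolding detects_def using \<Phi>_inj[OF \<phi>(1)] assms(1,2) by auto
  qed simp
qed

end


section \<open>General recursive functions\<close>

lemma arg_Cons_0 [simp]: "arg 0 (x # xs) = x"
  by (simp add: arg_def)

lemma arg_Cons_Suc [simp]: "arg (Suc i) (x # xs) = arg i xs"
  by (simp add: arg_def)

lemma arg_tl [simp]: "arg i (tl xs) = arg (Suc i) xs"
  by (cases xs) (simp_all add: arg_def)

lemma arg_drop [simp]: "arg i (drop j xs) = arg (j + i) xs"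
  by (auto simp: arg_def)

lemma arg_map_upt: "i < N \<Longrightarrow> arg i (map f [0..<N]) = f i"
  by (simp add: arg_def)

text \<open>Composition supplies a fixed number of arguments, whereas later constructions pass on
  the whole list. Since only finitely many arguments are ever read, finitely many projections can
  imitate the list.\<close>

lemma general_recursive_finite_support:
  assumes "general_recursive F"
  shows "\<exists>N. \<forall>xs ys. (\<forall>i<N. arg i xs = arg i ys) \<longrightarrow> F xs = F ys"
  using assms
proof induction
  case (comp f gs)
  have "\<exists>N. \<forall>xs ys. (\<forall>i<N. arg i xs = arg i ys) \<longrightarrow> map (\<lambda>g. g xs) gs = map (\<lambda>g. g ys) gs"
    using comp.IH(2)
  proof (induction gs)
    case (Cons g gs)
    from Cons.prems obtain N1 where N1: "\<And>xs ys. (\<forall>i<N1. arg i xs = arg i ys) \<Longrightarrow> g xs = g ys" by auto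
    from Cons obtain N2 where
      N2: "\<And>xs ys. (\<forall>i<N2. arg i xs = arg i ys) \<Longrightarrow> map (\<lambda>g. g xs) gs = map (\<lambda>g. g ys) gs" by auto
    show ?case
    proof (intro exI allI impI)
      fix xs ys assume "\<forall>i<max N1 N2. arg i xs = arg i ys"
      then show "map (\<lambda>g. g xs) (g # gs) = map (\<lambda>g. g ys) (g # gs)"
        using N1[of xs ys] N2[of xs ys] by simp
    qed
  qed simp
  then show ?case by metis
next
  case (prim_rec f g)
  from prim_rec.IH obtain N1 N2 where N1: "\<And>xs ys. (\<forall>i<N1. arg i xs = arg i ys) \<Longrightarrow> f xs = f ys"
    and N2: "\<And>xs ys. (\<forall>i<N2. arg i xs = arg i ys) \<Longrightarrow> g xs = g ys" by metis
  show ?case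
  proof (intro exI allI impI)
    fix xs ys assume a: "\<forall>i<Suc (N1 + N2). arg i xs = arg i ys"
    then have "f (tl xs) = f (tl ys)" by (intro N1) auto
    moreover have "g (m # y # tl xs) = g (m # y # tl ys)" for m y
    proof (intro N2 allI impI)
      fix i assume "i < N2"
      moreover obtain j where "i = 0 \<or> i = Suc 0 \<or> i = Suc (Suc j)" by (metis not0_implies_Suc)
      ultimately show "arg i (m # y # tl xs) = arg i (m # y # tl ys)" using a by auto
    qed
    ultimately show "rec_nat (f (tl xs)) (\<lambda>m y. g (m # y # tl xs)) (arg 0 xs) =
        rec_nat (f (tl ys)) (\<lambda>m y. g (m # y # tl ys)) (arg 0 ys)"
      using a by simp
  qed
next
  case (minimise f)
  from minimise.IH obtain N where N: "\<And>xs ys. (\<forall>i<N. arg i xs = arg i ys) \<Longrightarrow> f xs = f ys" by metis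
  show ?case
  proof (intro exI allI impI)
    fix xs ys assume a: "\<forall>i<N. arg i xs = arg i ys"
    have "f (m # xs) = f (m # ys)" for m
    proof (intro N allI impI)
      fix i assume "i < N"
      then show "arg i (m # xs) = arg i (m # ys)" using a by (cases i) auto
    qed
    then show "(LEAST m. f (m # xs) = 0) = (LEAST m. f (m # ys) = 0)" by simp
  qed
next
  case succ
  show ?case by (rule exI[of _ 1]) simp
next
  case (proj i)
  show ?case by (rule exI[of _ "Suc i"]) simp
qed simp

lemma recursive_Cons:
  assumes "general_recursive F" "general_recursive c"
  shows "general_recursive (\<lambda>xs. F (c xs # xs))"
proof -
  obtain N where N: "\<And>xs ys. (\<forall>i<N. arg i xs = arg i ys) \<Longrightarrow> F xs = F ys"
    using general_recursive_finite_support[OF assms(1)] by blast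
  have "general_recursive (\<lambda>xs. F (map (\<lambda>g. g xs) (c # map arg [0..<N])))"
    by (rule general_recursive.comp[OF assms(1)]) (auto intro: assms(2) general_recursive.proj)
  moreover have "F (map (\<lambda>g. g xs) (c # map arg [0..<N])) = F (c xs # xs)" for xs
  proof (intro N allI impI)
    fix i assume "i < N"
    then show "arg i (map (\<lambda>g. g xs) (c # map arg [0..<N])) = arg i (c xs # xs)"
      by (cases i) (simp_all add: arg_map_upt comp_def)
  qed
  ultimately show ?thesis by simp
qed

lemma recursive_tl:
  assumes "general_recursive F"
  shows "general_recursive (\<lambda>xs. F (tl xs))"
proof -
  obtain N where N: "\<And>xs ys. (\<forall>i<N. arg i xs = arg i ys) \<Longrightarrow> F xs = F ys"
    using general_recursive_finite_support[OF assms(1)] by blast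
  have "general_recursive (\<lambda>xs. F (map (\<lambda>g. g xs) (map (\<lambda>i. arg (Suc i)) [0..<N])))"
    by (rule general_recursive.comp[OF assms(1)]) (auto intro: general_recursive.proj)
  moreover have "F (map (\<lambda>g. g xs) (map (\<lambda>i. arg (Suc i)) [0..<N])) = F (tl xs)" for xs
    by (rule N) (simp add: arg_map_upt comp_def)
  ultimately show ?thesis by simp
qed

named_theorems recursive_intros

lemmas [recursive_intros] = general_recursive.proj

lemma recursive_compose:
  assumes "general_recursive (\<lambda>xs. g (arg 0 xs))" "general_recursive f"
  shows "general_recursive (\<lambda>xs. g (f xs))"
  using general_recursive.comp[OF assms(1), of "[f]"] assms(2) by simp

lemma recursive_Suc [recursive_intros]: "general_recursive f \<Longrightarrow> general_recursive (\<lambda>xs. Suc (f xs))"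
  by (rule recursive_compose[OF general_recursive.succ])

lemma recursive_const [recursive_intros]: "general_recursive (\<lambda>xs. c)"
proof (induction c)
  case (Suc c)
  then show ?case by (rule recursive_Suc)
qed (rule general_recursive.zero)

text \<open>In the step function the outer arguments sit behind the counter and the accumulator,
  hence \<open>tl (tl ys)\<close>.\<close>

lemma recursive_rec_nat [recursive_intros]:
  assumes "general_recursive f" "general_recursive (\<lambda>ys. g (arg 0 ys) (arg 1 ys) (tl (tl ys)))"
    "general_recursive c"
  shows "general_recursive (\<lambda>xs. rec_nat (f xs) (\<lambda>m y. g m y xs) (c xs))"
  using recursive_Cons[OF general_recursive.prim_rec[OF assms(1,2)] assms(3)] by simp

lemma recursive_add [recursive_intros]:
  assumes "general_recursive f" "general_recursive g"
  shows "general_recursive (\<lambda>xs. f xs + g xs)"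
proof -
  have "x + k = rec_nat x (\<lambda>m y. Suc y) k" for x k :: nat by (induction k) auto
  moreover have "general_recursive (\<lambda>xs. rec_nat (f xs) (\<lambda>m y. Suc y) (g xs))"
    by (intro recursive_intros assms)
  ultimately show ?thesis by simp
qed

lemma recursive_mult [recursive_intros]:
  assumes "general_recursive f" "general_recursive g"
  shows "general_recursive (\<lambda>xs. f xs * g xs)"
proof -
  have "x * k = rec_nat 0 (\<lambda>m y. y + x) k" for x k :: nat by (induction k) auto
  moreover have "general_recursive (\<lambda>xs. rec_nat 0 (\<lambda>m y. y + f xs) (g xs))"
    by (intro recursive_intros recursive_tl assms)
  ultimately show ?thesis by simp
qed

lemma recursive_power [recursive_intros]:
  assumes "general_recursive f" "general_recursive g"
  shows "general_recursive (\<lambda>xs. f xs ^ g xs)"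
proof -
  have "x ^ k = rec_nat 1 (\<lambda>m y. y * x) k" for x k :: nat by (induction k) auto
  moreover have "general_recursive (\<lambda>xs. rec_nat 1 (\<lambda>m y. y * f xs) (g xs))"
    by (intro recursive_intros recursive_tl assms)
  ultimately show ?thesis by simp
qed

lemma recursive_diff [recursive_intros]:
  assumes "general_recursive f" "general_recursive g"
  shows "general_recursive (\<lambda>xs. f xs - g xs)"
proof -
  have pred: "rec_nat 0 (\<lambda>m y. m) y = y - 1" for y :: nat by (cases y) auto
  have "x - k = rec_nat x (\<lambda>m y. rec_nat 0 (\<lambda>m y. m) y) k" for x k :: nat
    unfolding pred by (induction k) auto
  moreover have "general_recursive (\<lambda>xs. rec_nat (f xs) (\<lambda>m y. rec_nat 0 (\<lambda>m y. m) y) (g xs))"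
    by (intro recursive_intros assms)
  ultimately show ?thesis by simp
qed

section \<open>Decidable predicates and bounded search\<close>

definition decidable :: "(nat list \<Rightarrow> bool) \<Rightarrow> bool" where
  "decidable P \<longleftrightarrow> general_recursive (\<lambda>xs. of_bool (P xs))"

lemma recursive_If [recursive_intros]:
  assumes "decidable P" "general_recursive f" "general_recursive g"
  shows "general_recursive (\<lambda>xs. if P xs then f xs else g xs)"
proof -
  have "general_recursive (\<lambda>xs. of_bool (P xs) * f xs + (1 - of_bool (P xs)) * g xs)"
    using assms unfolding decidable_def by (intro recursive_intros)
  then show ?thesis by (rule back_subst[of general_recursive]) auto
qed

lemma decidable_const [recursive_intros]: "decidable (\<lambda>xs. b)"
  unfolding decidable_def by (rule recursive_const)

lemma decidable_not [recursive_intros]: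
  assumes "decidable P"
  shows "decidable (\<lambda>xs. \<not> P xs)"
proof -
  have "general_recursive (\<lambda>xs. 1 - of_bool (P xs))"
    by (intro recursive_intros assms[unfolded decidable_def])
  then show ?thesis unfolding decidable_def by (rule back_subst[of general_recursive]) auto
qed

lemma decidable_conj [recursive_intros]:
  assumes "decidable P" "decidable Q"
  shows "decidable (\<lambda>xs. P xs \<and> Q xs)"
  unfolding decidable_def of_bool_conj
  by (intro recursive_intros assms[unfolded decidable_def])

lemma decidable_disj [recursive_intros]:
  assumes "decidable P" "decidable Q"
  shows "decidable (\<lambda>xs. P xs \<or> Q xs)"
proof -
  have "decidable (\<lambda>xs. \<not> (\<not> P xs \<and> \<not> Q xs))" by (intro recursive_intros assms)
  then show ?thesis by simp
qed

lemma decidable_imp [recursive_intros]: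
  assumes "decidable P" "decidable Q"
  shows "decidable (\<lambda>xs. P xs \<longrightarrow> Q xs)"
proof -
  have "decidable (\<lambda>xs. \<not> (P xs \<and> \<not> Q xs))" by (intro recursive_intros assms)
  then show ?thesis by simp
qed

lemma decidable_le [recursive_intros]:
  assumes "general_recursive f" "general_recursive g"
  shows "decidable (\<lambda>xs. f xs \<le> g xs)"
proof -
  have "general_recursive (\<lambda>xs. 1 - (f xs - g xs))" by (intro recursive_intros assms)
  then show ?thesis unfolding decidable_def by (rule back_subst[of general_recursive]) auto
qed

lemma decidable_less [recursive_intros]:
  "general_recursive f \<Longrightarrow> general_recursive g \<Longrightarrow> decidable (\<lambda>xs. f xs < g xs)"
  unfolding Suc_le_eq[symmetric] by (intro recursive_intros)

lemma decidable_eq [recursive_intros]: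
  fixes f :: "nat list \<Rightarrow> nat"
  shows "general_recursive f \<Longrightarrow> general_recursive g \<Longrightarrow> decidable (\<lambda>xs. f xs = g xs)"
  unfolding eq_iff by (intro recursive_intros)

text \<open>Primitive recursion counts the witnesses, and one exists iff the count is
  positive.\<close>

lemma decidable_ex_le [recursive_intros]:
  assumes "decidable (\<lambda>ys. P (arg 0 ys) (tl ys))" "general_recursive c"
  shows "decidable (\<lambda>xs. \<exists>i\<le>c xs. P i xs)"
proof -
  have "0 < rec_nat (0::nat) (\<lambda>m y. y + of_bool (P m xs)) k \<longleftrightarrow> (\<exists>i<k. P i xs)" for xs k
    by (induction k) (auto simp: less_Suc_eq)
  then have eq: "(\<exists>i\<le>c xs. P i xs) \<longleftrightarrow> 0 < rec_nat (0::nat) (\<lambda>m y. y + of_bool (P m xs)) (Suc (c xs))" for xs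
    by (simp add: less_Suc_eq_le del: nat.rec)
  \<comment> \<open>The accumulator is the second entry of \<open>ys\<close> and must be hidden from
    \<open>P\<close>, which expects the outer arguments directly behind the counter.\<close>
  have "general_recursive (\<lambda>ys. of_bool (P (arg 0 (arg 0 ys # tl (tl ys))) (tl (arg 0 ys # tl (tl ys)))))"
  proof -
    obtain N where N: "\<And>xs ys. (\<forall>i<N. arg i xs = arg i ys) \<Longrightarrow>
        (of_bool (P (arg 0 xs) (tl xs)) :: nat) = of_bool (P (arg 0 ys) (tl ys))"
      using general_recursive_finite_support[OF assms(1)[unfolded decidable_def]] by blast
    have "general_recursive (\<lambda>ys. (\<lambda>ys. of_bool (P (arg 0 ys) (tl ys)))
        (map (\<lambda>g. g ys) (arg 0 # map (\<lambda>i. arg (i + 2)) [0..<N])))"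
      by (rule general_recursive.comp[OF assms(1)[unfolded decidable_def]])
        (auto intro: general_recursive.proj)
    moreover have "(\<lambda>ys. of_bool (P (arg 0 ys) (tl ys)))
        (map (\<lambda>g. g ys) (arg 0 # map (\<lambda>i. arg (i + 2)) [0..<N])) =
        (of_bool (P (arg 0 (arg 0 ys # tl (tl ys))) (tl (arg 0 ys # tl (tl ys)))) :: nat)" for ys
    proof (intro N allI impI)
      fix i assume "i < N"
      then show "arg i (map (\<lambda>g. g ys) (arg 0 # map (\<lambda>i. arg (i + 2)) [0..<N])) =
          arg i (arg 0 ys # tl (tl ys))"
        by (cases i) (simp_all add: arg_map_upt comp_def)
    qed
    ultimately show ?thesis by simp
  qed
  then have "decidable (\<lambda>xs. 0 < rec_nat (0::nat) (\<lambda>m y. y + of_bool (P m xs)) (Suc (c xs)))"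
    by (intro recursive_intros assms(2)) simp
  then show ?thesis unfolding eq .
qed

lemma recursive_LEAST [recursive_intros]:
  assumes "decidable (\<lambda>ys. P (arg 0 ys) (tl ys))" "\<And>xs. \<exists>m. P m xs"
  shows "general_recursive (\<lambda>xs. LEAST m. P m xs)"
proof -
  have "general_recursive (\<lambda>ys. of_bool (\<not> P (arg 0 ys) (tl ys)))"
    using decidable_not[OF assms(1)] by (simp only: decidable_def)
  from general_recursive.minimise[OF this] show ?thesis using assms(2) by simp
qed

lemma decidable_all_less:
  fixes k :: nat
  assumes "\<And>i. i < k \<Longrightarrow> decidable (P i)"
  shows "decidable (\<lambda>xs. \<forall>i<k. P i xs)"
  using assms
proof (induction k)
  case 0
  then show ?case by (simp add: decidable_const)
next
  case (Suc k)
  have "decidable (\<lambda>xs. (\<forall>i<k. P i xs) \<and> P k xs)"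
    by (intro decidable_conj Suc.IH Suc.prems) auto
  moreover have "(\<forall>i<Suc k. P i xs) \<longleftrightarrow> (\<forall>i<k. P i xs) \<and> P k xs" for xs
    by (auto simp: less_Suc_eq)
  ultimately show ?case by simp
qed

text \<open>Nested bounded quantifiers, each prepending its witness. The bound therefore moves one
  place further for each, and the outermost witness ends up last in \<open>ys\<close>.\<close>

lemma decidable_ex_list:
  assumes "decidable P"
  shows "decidable (\<lambda>xs. \<exists>ys. length ys = k \<and> (\<forall>y\<in>set ys. y \<le> arg j xs) \<and> P (ys @ xs))"
proof (induction k arbitrary: j)
  case 0
  then show ?case using assms by simp
next
  case (Suc k)
  let ?Q = "\<lambda>zs. \<exists>ys. length ys = k \<and> (\<forall>y\<in>set ys. y \<le> arg (Suc j) zs) \<and> P (ys @ zs)"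
  have "(\<exists>ys. length ys = Suc k \<and> (\<forall>y\<in>set ys. y \<le> arg j xs) \<and> P (ys @ xs)) \<longleftrightarrow>
      (\<exists>i\<le>arg j xs. ?Q (i # xs))" for xs
  proof
    assume "\<exists>ys. length ys = Suc k \<and> (\<forall>y\<in>set ys. y \<le> arg j xs) \<and> P (ys @ xs)"
    then obtain ys where ys: "length ys = Suc k" "\<forall>y\<in>set ys. y \<le> arg j xs" "P (ys @ xs)" by blast
    then obtain zs i where "ys = zs @ [i]" by (cases ys rule: rev_cases) auto
    then show "\<exists>i\<le>arg j xs. ?Q (i # xs)" using ys by (intro exI[of _ i]) auto
  next
    assume "\<exists>i\<le>arg j xs. ?Q (i # xs)"
    then obtain i zs where "i \<le> arg j xs" "length zs = k" "\<forall>y\<in>set zs. y \<le> arg j xs" "P (zs @ i # xs)"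
      by auto
    then show "\<exists>ys. length ys = Suc k \<and> (\<forall>y\<in>set ys. y \<le> arg j xs) \<and> P (ys @ xs)"
      by (intro exI[of _ "zs @ [i]"]) auto
  qed
  moreover have "decidable (\<lambda>xs. \<exists>i\<le>arg j xs. ?Q (i # xs))"
  proof (rule decidable_ex_le)
    obtain N where N: "\<And>xs ys. (\<forall>i<N. arg i xs = arg i ys) \<Longrightarrow> (of_bool (?Q xs) :: nat) = of_bool (?Q ys)"
      using general_recursive_finite_support[OF Suc.IH[of "Suc j", unfolded decidable_def]] by blast
    \<comment> \<open>The lists differ only for empty \<open>ys\<close>; a missing argument counts
      as 0, so no recursive predicate can tell them apart.\<close>
    have "?Q (arg 0 ys # tl ys) = ?Q ys" for ys
    proof -
      have "(of_bool (?Q (arg 0 ys # tl ys)) :: nat) = of_bool (?Q ys)"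
      proof (intro N allI impI)
        fix i show "arg i (arg 0 ys # tl ys) = arg i ys" by (cases i) simp_all
      qed
      then show ?thesis by (simp only: of_bool_eq_iff)
    qed
    then show "decidable (\<lambda>ys. ?Q (arg 0 ys # tl ys))" using Suc.IH[of "Suc j"] by simp
  qed (rule general_recursive.proj)
  ultimately show ?case by simp
qed

section \<open>Decoding pairs and lists\<close>

lemma recursive_triangle [recursive_intros]:
  assumes "general_recursive f"
  shows "general_recursive (\<lambda>xs. triangle (f xs))"
proof -
  have "triangle k = rec_nat 0 (\<lambda>m y. y + Suc m) k" for k by (induction k) auto
  moreover have "general_recursive (\<lambda>xs. rec_nat 0 (\<lambda>m y. y + Suc m) (f xs))"
    by (intro recursive_intros assms)
  ultimately show ?thesis by simp
qed

lemma triangle_mono: "i \<le> j \<Longrightarrow> triangle i \<le> triangle j"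
  by (induction rule: dec_induct) auto

text \<open>In the Cantor pairing \<open>c = triangle (a + b) + a\<close>. The least
  \<open>s\<close> is the diagonal \<open>a + b\<close>, which bounded arithmetic recovers from
  \<open>c\<close>.\<close>

lemma prod_decode_eq:
  defines "s \<equiv> \<lambda>c. LEAST s. c < triangle (Suc s)"
  shows "prod_decode c = (c - triangle (s c), s c - (c - triangle (s c)))"
proof -
  obtain a b where ab: "prod_decode c = (a, b)" by (cases "prod_decode c")
  then have c: "c = triangle (a + b) + a"
    using prod_decode_inverse[of c] by (simp add: prod_encode_def)
  have "s c = a + b"
    unfolding s_def
  proof (rule Least_equality)
    show "c < triangle (Suc (a + b))" by (simp add: c)
    fix t assume "c < triangle (Suc t)"
    then have "\<not> triangle (Suc t) \<le> triangle (a + b)" using c by linarith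
    then show "a + b \<le> t" using triangle_mono[of "Suc t" "a + b"] by linarith
  qed
  then show ?thesis unfolding ab by (simp add: c)
qed

lemma ex_less_triangle: "\<exists>s. c < triangle (Suc s)"
proof -
  have "c < triangle (Suc c)" by simp
  then show ?thesis by blast
qed

lemma recursive_prod_decode [recursive_intros]:
  assumes "general_recursive f"
  shows "general_recursive (\<lambda>xs. fst (prod_decode (f xs)))" "general_recursive (\<lambda>xs. snd (prod_decode (f xs)))"
  unfolding prod_decode_eq fst_conv snd_conv
  by (intro recursive_intros recursive_tl assms ex_less_triangle)+

lemma prod_decode_0: "prod_decode 0 = (0, 0)"
  using prod_encode_inverse[of "(0, 0)"] by (simp add: prod_encode_def)

lemma arg_Nil [simp]: "arg i [] = 0"
  by (simp add: arg_def)

text \<open>Codes of nonempty lists are shifted by one. The empty list has code 0, where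
  \<open>c - 1\<close> is again 0 and decodes to the default value.\<close>

lemma arg_0_list_decode: "arg 0 (list_decode c) = fst (prod_decode (c - 1))"
  by (cases c) (simp_all add: prod_decode_0 split: prod.split)

lemma tl_list_decode: "tl (list_decode c) = list_decode (snd (prod_decode (c - 1)))"
  by (cases c) (simp_all add: prod_decode_0 split: prod.split)

lemma drop_list_decode: "drop i (list_decode c) = list_decode (rec_nat c (\<lambda>m y. snd (prod_decode (y - 1))) i)"
proof (induction i)
  case (Suc i)
  have "drop (Suc i) (list_decode c) = tl (drop i (list_decode c))" by (simp add: drop_Suc tl_drop)
  then show ?case by (simp only: Suc.IH tl_list_decode nat.rec)
qed simp

lemma recursive_arg_list_decode [recursive_intros]:
  assumes "general_recursive f" "general_recursive g"
  shows "general_recursive (\<lambda>xs. arg (f xs) (list_decode (g xs)))"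
proof -
  have "arg i (list_decode c) = fst (prod_decode (rec_nat c (\<lambda>m y. snd (prod_decode (y - 1))) i - 1))" for i c
    using arg_drop[of 0 i "list_decode c"] by (simp only: drop_list_decode arg_0_list_decode add_0_right)
  moreover have "general_recursive
      (\<lambda>xs. fst (prod_decode (rec_nat (g xs) (\<lambda>m y. snd (prod_decode (y - 1))) (f xs) - 1)))"
    by (intro recursive_intros assms)
  ultimately show ?thesis by simp
qed

lemma list_decode_eq_Nil: "list_decode c = [] \<longleftrightarrow> c = 0"
  by (metis list_decode.simps(1) list_decode_inverse)

text \<open>The length is the least number of tails after which the code is 0, that of the empty
  list.\<close>

lemma recursive_length_list_decode [recursive_intros]:
  assumes "general_recursive g"
  shows "general_recursive (\<lambda>xs. length (list_decode (g xs)))"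
proof -
  let ?d = "\<lambda>c. rec_nat c (\<lambda>m y. snd (prod_decode (y - 1)))"
  have zero: "?d c i = 0 \<longleftrightarrow> length (list_decode c) \<le> i" for c i
    using drop_list_decode[of i c] list_decode_eq_Nil[of "?d c i"] by (metis drop_eq_Nil)
  then have "length (list_decode c) = (LEAST i. ?d c i = 0)" for c
    by (intro Least_equality[symmetric]) auto
  moreover have "general_recursive (\<lambda>xs. LEAST i. ?d (g xs) i = 0)"
  proof (intro recursive_intros recursive_tl assms)
    show "\<exists>i. ?d (g xs) i = 0" for xs using zero by blast
  qed
  ultimately show ?thesis by simp
qed


section \<open>The tester\<close>

lemma target_drop: "target (drop i h) = max 1 (arg (i + arg i h) h)"
  by (simp add: target_def)

text \<open>Answers occupy the positions divisible by 3, counted from the latest entry. The bound on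
  \<open>j\<close> makes the quantifier a bounded one, as decidability requires.\<close>

lemma found_iff:
  "e \<in> found h \<longleftrightarrow> (\<exists>j\<le>length h. 3 * j + 2 < length h \<and> arg (3 * j) h \<noteq> 0 \<and>
     e = {target (drop (3 * j + 1) h), arg (3 * j) h})"
proof (induction h rule: found.induct)
  case (1 a d v h)
  let ?R = "\<lambda>h j. 3 * j + 2 < length h \<and> arg (3 * j) h \<noteq> 0 \<and>
     e = {target (drop (3 * j + 1) h), arg (3 * j) h}"
  have le: "(\<exists>j\<le>length h. ?R h j) \<longleftrightarrow> (\<exists>j. ?R h j)" for h
  proof
    assume "\<exists>j. ?R h j"
    then obtain j where j: "?R h j" ..
    then have "j \<le> length h" by linarith
    then show "\<exists>j\<le>length h. ?R h j" using j by blast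
  qed blast
  have shift: "?R (a # d # v # h) (Suc j) \<longleftrightarrow> ?R h j" for j
    by (simp add: numeral_3_eq_3 target_def)
  have "e \<in> found (a # d # v # h) \<longleftrightarrow> a \<noteq> 0 \<and> e = {target (d # v # h), a} \<or> e \<in> found h" by simp
  also have "e \<in> found h \<longleftrightarrow> (\<exists>j. ?R h j)" unfolding 1 by (rule le)
  also have "a \<noteq> 0 \<and> e = {target (d # v # h), a} \<longleftrightarrow> ?R (a # d # v # h) 0" by simp
  also have "?R (a # d # v # h) 0 \<or> (\<exists>j. ?R h j) \<longleftrightarrow> (\<exists>j. ?R (a # d # v # h) j)"
    unfolding shift[symmetric] by (metis not0_implies_Suc)
  finally show ?case unfolding le .
qed auto

lemma recursive_max [recursive_intros]:
  assumes "general_recursive f" "general_recursive g"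
  shows "general_recursive (\<lambda>xs. max (f xs) (g xs))"
  unfolding max_def by (intro recursive_intros assms)

lemma decidable_found:
  assumes "general_recursive f" "general_recursive g" "general_recursive h"
  shows "decidable (\<lambda>xs. {f xs, g xs} \<in> found (list_decode (h xs)))"
  unfolding found_iff target_drop doubleton_eq_iff
  by (intro recursive_intros recursive_tl assms)

text \<open>The map is replaced by its list of values, so that the search ranges over finitely many
  lists of numbers.\<close>

lemma detects_iff:
  assumes "simple_graph H" and ks: "distinct ks" "set ks = verts H"
  shows "detects H n h \<longleftrightarrow> (\<exists>ys. length ys = length ks \<and> (\<forall>y\<in>set ys. y \<le> n) \<and>
     (\<forall>i<length ks. 1 \<le> arg i ys) \<and>
     (\<forall>i<length ks. \<forall>j<length ks. i \<noteq> j \<longrightarrow> arg i ys \<noteq> arg j ys) \<and>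
     (\<forall>i<length ks. \<forall>j<length ks. {ks ! i, ks ! j} \<in> edges H \<longrightarrow> {arg i ys, arg j ys} \<in> found h))"
    (is "_ \<longleftrightarrow> (\<exists>ys. ?P ys)")
proof
  assume "detects H n h"
  then obtain f where f: "inj_on f (verts H)" "f ` verts H \<subseteq> {1..n}" "\<forall>e\<in>edges H. f ` e \<in> found h"
    by (auto simp: detects_def)
  have in_H: "ks ! i \<in> verts H" if "i < length ks" for i using that ks(2) nth_mem by blast
  have arg: "arg i (map f ks) = f (ks ! i)" if "i < length ks" for i using that by (simp add: arg_def)
  have "?P (map f ks)"
  proof (intro conjI allI impI)
    show "\<forall>y\<in>set (map f ks). y \<le> n" using f(2) ks(2) by auto
    show "1 \<le> arg i (map f ks)" if "i < length ks" for i
      using f(2) in_H[OF that] arg[OF that] by auto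
    show "arg i (map f ks) \<noteq> arg j (map f ks)" if "i < length ks" "j < length ks" "i \<noteq> j" for i j
      using that arg inj_onD[OF f(1)] in_H ks(1) by (metis nth_eq_iff_index_eq)
    show "{arg i (map f ks), arg j (map f ks)} \<in> found h"
      if "i < length ks" "j < length ks" "{ks ! i, ks ! j} \<in> edges H" for i j
      using f(3) that arg by fastforce
  qed simp
  then show "\<exists>ys. ?P ys" by blast
next
  assume "\<exists>ys. ?P ys"
  then obtain ys where ys: "?P ys" ..
  have len: "length ys = length ks" using ys by blast
  define f where "f = (\<lambda>x. ys ! (THE i. i < length ks \<and> ks ! i = x))"
  have f: "f (ks ! i) = arg i ys" if "i < length ks" for i
  proof -
    have "(THE i'. i' < length ks \<and> ks ! i' = ks ! i) = i"
      using that ks(1) by (intro the_equality) (auto simp: nth_eq_iff_index_eq)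
    then show ?thesis using that len by (simp add: f_def arg_def)
  qed
  have ex: "\<exists>i<length ks. x = ks ! i" if "x \<in> verts H" for x
    using that ks(2) by (metis in_set_conv_nth)
  have "inj_on f (verts H)"
  proof (rule inj_onI)
    fix x y assume "x \<in> verts H" "y \<in> verts H" "f x = f y"
    then obtain i j where "i < length ks" "j < length ks" "x = ks ! i" "y = ks ! j" "f x = f y"
      using ex by metis
    then show "x = y" using f ys by metis
  qed
  moreover have "f ` verts H \<subseteq> {1..n}"
  proof
    fix y assume "y \<in> f ` verts H"
    then obtain i where i: "i < length ks" "y = f (ks ! i)" using ex by blast
    then have y: "y = arg i ys" using f by simp
    then have "y \<in> set ys" using i(1) len by (simp add: arg_def)
    moreover have "1 \<le> y" using ys i(1) y by blast
    ultimately show "y \<in> {1..n}" using ys by simp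
  qed
  moreover have "f ` e \<in> found h" if e: "e \<in> edges H" for e
  proof -
    have "e \<subseteq> verts H" "card e = 2" using assms(1) e by (auto simp: simple_graph_def)
    then obtain a b where ab: "e = {a, b}" "a \<in> verts H" "b \<in> verts H" by (auto simp: card_2_iff)
    obtain i where i: "i < length ks" "a = ks ! i" using ex[OF ab(2)] by blast
    obtain j where j: "j < length ks" "b = ks ! j" using ex[OF ab(3)] by blast
    have "{arg i ys, arg j ys} \<in> found h" using ys i j e ab(1) by blast
    then show ?thesis using ab(1) i j f by simp
  qed
  ultimately show "detects H n h" unfolding detects_def by blast
qed

lemma arg_append: "i < length ys \<Longrightarrow> arg i (ys @ xs) = arg i ys"
  by (simp add: arg_def nth_append)

lemma arg_append_shift: "length ys = k \<Longrightarrow> arg (k + i) (ys @ xs) = arg i xs"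
  by (simp add: arg_def nth_append)

lemma decidable_detects:
  assumes H: "simple_graph H"
  shows "decidable (\<lambda>xs. detects H (arg 0 xs) (list_decode (arg 2 xs)))"
proof -
  have "finite (verts H)" using H by (simp add: simple_graph_def)
  then obtain ks where ks: "distinct ks" "set ks = verts H" using finite_distinct_list by metis
  define k where "k = length ks"
  \<comment> \<open>The \<open>k\<close> guessed images precede the input, which moves the
    transcript from position 2 to position \<open>k + 2\<close>.\<close>
  define P where "P = (\<lambda>zs. (\<forall>i<k. 1 \<le> arg i zs) \<and>
     (\<forall>i<k. \<forall>j<k. i \<noteq> j \<longrightarrow> arg i zs \<noteq> arg j zs) \<and>
     (\<forall>i<k. \<forall>j<k. {ks ! i, ks ! j} \<in> edges H \<longrightarrow> {arg i zs, arg j zs} \<in> found (list_decode (arg (k + 2) zs))))"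
  have "decidable P"
    unfolding P_def by (intro decidable_conj decidable_all_less decidable_imp decidable_const
        decidable_le decidable_not decidable_eq decidable_found recursive_const general_recursive.proj)
  then have "decidable (\<lambda>xs. \<exists>ys. length ys = k \<and> (\<forall>y\<in>set ys. y \<le> arg 0 xs) \<and> P (ys @ xs))"
    by (rule decidable_ex_list)
  moreover have "P (ys @ xs) \<longleftrightarrow> (\<forall>i<k. 1 \<le> arg i ys) \<and>
     (\<forall>i<k. \<forall>j<k. i \<noteq> j \<longrightarrow> arg i ys \<noteq> arg j ys) \<and>
     (\<forall>i<k. \<forall>j<k. {ks ! i, ks ! j} \<in> edges H \<longrightarrow> {arg i ys, arg j ys} \<in> found (list_decode (arg 2 xs)))"
    if "length ys = k" for ys xs
    unfolding P_def arg_append_shift[OF that] by (simp add: arg_append that cong: imp_cong)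
  ultimately show ?thesis unfolding detects_iff[OF H ks] k_def[symmetric] by (simp cong: conj_cong)
qed

text \<open>A round of \<open>M\<close> probes succeeds with probability at least \<open>1 / (C * k) ^ M\<close>, and a probe adds three
  entries to the transcript.\<close>

definition run_length :: "nat \<Rightarrow> nat \<Rightarrow> nat \<Rightarrow> nat" where
  "run_length C M k = 3 * (2 * (C * k) ^ M * M)"

text \<open>The input is \<open>n\<close>, the rounded inverse of \<open>\<epsilon>\<close>, and the
  transcript. Its length modulo 3 tells which part of a probe is due; bounded quantifiers express
  this remainder. Even values are draws and odd ones queries.\<close>

definition algorithm :: "nat graph \<Rightarrow> nat \<Rightarrow> nat \<Rightarrow> nat \<Rightarrow> nat list \<Rightarrow> nat" where
  "algorithm H C M B xs =
     (if run_length C M (arg 1 xs) \<le> length (list_decode (arg 2 xs)) then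
        (if detects H (arg 0 xs) (list_decode (arg 2 xs)) then 0 else 1)
      else if \<exists>j\<le>length (list_decode (arg 2 xs)). length (list_decode (arg 2 xs)) = 3 * j then 2 * arg 0 xs
      else if \<exists>j\<le>length (list_decode (arg 2 xs)). length (list_decode (arg 2 xs)) = 3 * j + 1 then 2 * B
      else Suc (2 * max 1 (arg (arg 0 (list_decode (arg 2 xs))) (list_decode (arg 2 xs)))))"

lemma recursive_algorithm:
  assumes "simple_graph H"
  shows "general_recursive (algorithm H C M B)"
proof -
  have "general_recursive (\<lambda>xs. algorithm H C M B xs)"
    unfolding algorithm_def run_length_def
    by (intro recursive_intros recursive_tl decidable_detects assms)
  then show ?thesis by simp
qed

section \<open>Runs of the algorithm as sequences of probes\<close>

lemma run_queries_le:
  assumes "\<And>h. L \<le> length h \<Longrightarrow> \<delta> h \<in> {Accept, Reject}"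
    and "Some (b, k) \<in> set_pmf (run \<delta> oracle t h)" "length h \<le> L"
  shows "k + length h \<le> L"
  using assms(2,3)
proof (induction t arbitrary: h b k)
  case (Suc t)
  show ?case
  proof (cases "\<delta> h")
    case (Draw m)
    then have "length h < L" using assms(1)[of h] by fastforce
    moreover obtain x where "Some (b, k) \<in> set_pmf (run \<delta> oracle t (x # h))"
      using Suc.prems(1) Draw by auto
    ultimately show ?thesis using Suc.IH[of b k "x # h"] by simp
  next
    case (Query v)
    then have "length h < L" using assms(1)[of h] by fastforce
    moreover obtain x k' where "Some (b, k') \<in> set_pmf (run \<delta> oracle t (x # h))" "k = Suc k'"
      using Suc.prems(1) Query by auto
    ultimately show ?thesis using Suc.IH[of b k' "x # h"] by simp
  qed (use Suc.prems in auto)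
qed simp

definition verdict :: "(bool \<times> nat) option pmf \<Rightarrow> bool option pmf" where
  "verdict = map_pmf (map_option fst)"

lemma verdict_run_Suc:
  "verdict (run \<delta> oracle (Suc t) h) =
     (case \<delta> h of
        Accept \<Rightarrow> return_pmf (Some True)
      | Reject \<Rightarrow> return_pmf (Some False)
      | Draw m \<Rightarrow> bind_pmf (pmf_of_set {1..m}) (\<lambda>x. verdict (run \<delta> oracle t (x # h)))
      | Query v \<Rightarrow> bind_pmf (oracle v) (\<lambda>a. verdict (run \<delta> oracle t (answer_code a # h))))"
proof -
  have "map_option fst (map_option (\<lambda>(b, k). (b, Suc k)) z) = map_option fst z" for z :: "(bool \<times> nat) option"
    by (cases z) auto
  then show ?thesis
    by (auto simp: verdict_def map_bind_pmf pmf.map_comp comp_def split: action.split)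
qed

definition strategy :: "nat graph \<Rightarrow> nat \<Rightarrow> nat \<Rightarrow> nat \<Rightarrow> nat \<Rightarrow> nat \<Rightarrow> nat list \<Rightarrow> action" where
  "strategy H C M B n k h = decode_action (algorithm H C M B [n, k, list_encode h])"

lemma strategy_eq:
  assumes "n > 0" "B > 0"
  shows "strategy H C M B n k h =
     (if run_length C M k \<le> length h then (if detects H n h then Reject else Accept)
      else if 3 dvd length h then Draw n
      else if length h mod 3 = 1 then Draw B
      else Query (target h))"
proof -
  have "(\<exists>j\<le>m. m = 3 * j) \<longleftrightarrow> 3 dvd m" for m :: nat by (auto simp: dvd_def)
  moreover have "(\<exists>j\<le>m. m = 3 * j + 1) \<longleftrightarrow> m mod 3 = 1" for m :: nat by presburger
  moreover have "decode_action (2 * m) = Draw m" if "m > 0" for m using that by (simp add: decode_action_def)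
  moreover have "decode_action (Suc (2 * target h)) = Query (target h)"
    by (simp add: decode_action_def target_def)
  moreover have "decode_action 0 = Reject" "decode_action 1 = Accept" by (simp_all add: decode_action_def)
  moreover have "arg 0 [n, k, c] = n" "arg 1 [n, k, c] = k" "arg 2 [n, k, c] = c" for c
    by (simp_all add: arg_def)
  ultimately show ?thesis
    using assms unfolding strategy_def algorithm_def target_def[symmetric]
    by (simp only: list_encode_inverse if_distrib[of decode_action])
qed

text \<open>Three actions make up a probe, and the one action beyond \<open>3 * m\<close> delivers
  the verdict.\<close>

lemma verdict_run_eq_probes:
  assumes "n > 0" "B > 0" "length h + 3 * m = run_length C M k"
  shows "verdict (run (strategy H C M B n k) (random_neighbour G) (Suc (3 * m)) h) =
    map_pmf (\<lambda>h'. Some (\<not> detects H n h')) (probes n B G m h)"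
  using assms(3)
proof (induction m arbitrary: h)
  case 0
  then show ?case by (simp add: verdict_run_Suc strategy_eq[OF assms(1,2)] del: run.simps)
next
  case (Suc m)
  have "3 dvd run_length C M k" by (simp add: run_length_def)
  then have dvd: "3 dvd length h" using Suc.prems by (metis dvd_add_left_iff dvd_triv_left)
  then have mods: "Suc (length h) mod 3 = 1" "\<not> 3 dvd Suc (length h)"
    "\<not> 3 dvd Suc (Suc (length h))" "Suc (Suc (length h)) mod 3 \<noteq> 1" by presburger+
  have less: "length h < run_length C M k" "Suc (length h) < run_length C M k"
    "Suc (Suc (length h)) < run_length C M k" using Suc.prems by auto
  let ?r = "\<lambda>t h. verdict (run (strategy H C M B n k) (random_neighbour G) t h)"
  have 1: "strategy H C M B n k h = Draw n"
    using less dvd by (simp add: strategy_eq[OF assms(1,2)])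
  have 2: "strategy H C M B n k (v # h) = Draw B" for v
    using less mods by (simp add: strategy_eq[OF assms(1,2)])
  have 3: "strategy H C M B n k (d # v # h) = Query (target (d # v # h))" for d v
    using less mods by (simp add: strategy_eq[OF assms(1,2)])
  have IH: "?r (Suc (3 * m)) (a # d # v # h) =
      map_pmf (\<lambda>h'. Some (\<not> detects H n h')) (probes n B G m (a # d # v # h))" for a d v
    by (rule Suc.IH) (use Suc.prems in simp)
  have four: "Suc (3 * Suc m) = Suc (Suc (Suc (Suc (3 * m))))" by simp
  have "?r (Suc (3 * Suc m)) h = bind_pmf (probe n B G h)
      (\<lambda>h'. map_pmf (\<lambda>h'. Some (\<not> detects H n h')) (probes n B G m h'))"
    unfolding four
    by (simp only: verdict_run_Suc[of _ _ "Suc (Suc (Suc (3 * m)))"] verdict_run_Suc[of _ _ "Suc (Suc (3 * m))"]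
        verdict_run_Suc[of _ _ "Suc (3 * m)"] 1 2 3 IH action.case probe_def bind_assoc_pmf bind_map_pmf)
  then show ?case by (simp add: map_bind_pmf)
qed

text \<open>Attempts that succeed with probability \<open>1 / x\<close> all fail in
  \<open>2 * x\<close> trials with probability at most \<open>exp (- 2)\<close>.\<close>

lemma one_minus_inverse_power_le:
  assumes "x \<ge> 1"
  shows "(1 - 1 / real x) ^ (2 * x) \<le> 1 / 3"
proof -
  have "(1 - 1 / real x) ^ (2 * x) \<le> exp (- (1 / real x)) ^ (2 * x)"
    using assms exp_ge_add_one_self[of "- (1 / real x)"] by (intro power_mono) auto
  also have "\<dots> = exp (- 2)"
    using assms by (simp flip: exp_of_nat_mult)
  also have "\<dots> \<le> 1 / 3"
  proof -
    have "3 \<le> exp (2 :: real)" using exp_ge_add_one_self[of 2] by simp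
    then show ?thesis by (simp add: exp_minus field_simps)
  qed
  finally show ?thesis .
qed

lemma far_antimono: "far \<epsilon> \<P> G \<Longrightarrow> \<epsilon>' \<le> \<epsilon> \<Longrightarrow> far \<epsilon>' \<P> G"
  unfolding far_def by (meson mult_right_mono of_nat_0_le_iff order_trans)

lemma loss_const_pos: "k > 0 \<Longrightarrow> m > 0 \<Longrightarrow> loss_const k m c > 0"
  by (simp add: loss_const_def)

text \<open>An attempt needs \<open>M\<close> probes, one round per vertex of \<open>H\<close>. The
  window \<open>B = 3 * M + 1\<close> spans the transcript of a whole attempt, and \<open>C\<close>
  collects the loss of the search space and the guess of the offset.\<close>

lemma detection_with_edges:
  fixes G :: "nat graph"
  assumes H: "simple_graph H" "edges H \<noteq> {}" and G: "G \<in> bounded_adm_class p r"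
    and verts: "verts G = {1..n}" "n > 0" and r: "1 \<le> r" "card (verts H) \<le> r"
    and far: "far (1 / real \<kappa>) (free_of H) G" and \<kappa>: "\<kappa> \<ge> 1"
    and M: "M = Suc (card (verts H) * card (verts H) + card (verts H)) * card (verts H)"
    and B: "B = 3 * M + 1"
    and C: "C = loss_const (card (verts H)) (card (edges H)) (reach_bound p r) * B"
  shows "probing.likely n B G (2 * (C * \<kappa>) ^ M * M) (2 / 3) h (detects H n)"
proof -
  define D where "D = loss_const (card (verts H)) (card (edges H)) (reach_bound p r)"
  obtain le where "adm_graph G le r p" using ex_adm_graph[OF G] by blast
  then interpret adm_graph G le r p .
  have finH: "finite (verts H)" "finite (edges H)"
    using H(1) finite_subset[of "edges H" "Pow (verts H)"] by (auto simp: simple_graph_def)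
  have "verts H \<noteq> {}" using H by (fastforce simp: simple_graph_def)
  then have "D > 0" unfolding D_def using finH H(2) by (intro loss_const_pos) (auto simp: card_gt_0_iff)
  obtain \<rho> \<Phi> where "search_space (verts H) (edges H) \<rho> G \<Phi> (1 / real \<kappa> / real D)"
    using ex_search_space[OF H r(2,1) _ _ far] \<kappa> verts unfolding D_def reach_card_def by fastforce
  then interpret search_space "verts H" "edges H" \<rho> G \<Phi> "1 / real \<kappa> / real D" .
  interpret search "verts H" "edges H" \<rho> G \<Phi> "1 / real \<kappa> / real D" n B
  proof unfold_locales
    have "1 \<le> real \<kappa> * real D" using \<kappa> \<open>D > 0\<close> by (simp flip: of_nat_mult)
    then show "1 / real \<kappa> / real D \<le> 1" by simp
  qed (use simple verts B in auto)
  have round: "round_len * card (verts H) = M" by (simp add: round_len_def steps_def M)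
  \<comment> \<open>The inverse of the success probability of one attempt; \<open>2 * x\<close>
    attempts are made.\<close>
  define x where "x = (C * \<kappa>) ^ M"
  have q: "q ^ M = 1 / real x"
    unfolding q_def x_def C D_def[symmetric] by (simp add: power_one_over ac_simps)
  have "C * \<kappa> \<ge> 1" using \<kappa> \<open>D > 0\<close> B C unfolding D_def[symmetric] by simp
  then have pos: "x \<ge> 1" by (simp add: x_def)
  have "likely M (1 / real x) h (detects H n)" for h
    using likely_detects[of H h] q round B by simp
  then have "likely (2 * x * M) (1 - (1 - 1 / real x) ^ (2 * x)) h (detects H n)"
    using pos by (intro likely_repeat) auto
  then show ?thesis unfolding x_def[symmetric]
    by (rule likely_mono) (use one_minus_inverse_power_le[OF pos] in auto)
qed

text \<open>Being far excludes being \<open>H\<close>-free, so a copy exists; without edges nothing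
  has to be recorded to detect it.\<close>

lemma detection_without_edges:
  fixes G :: "nat graph"
  assumes H: "simple_graph H" "edges H = {}" and G: "simple_graph G" "verts G = {1..n}" "n > 0"
    and far: "far \<epsilon> (free_of H) G" and \<epsilon>: "\<epsilon> > 0"
  shows "detects H n h"
proof -
  have "G \<notin> free_of H"
  proof
    assume "G \<in> free_of H"
    then have "\<epsilon> * real n \<le> 0" using far G(2) unfolding far_def by fastforce
    then show False using \<epsilon> G(3) by (simp add: mult_le_0_iff)
  qed
  then obtain \<psi> where "\<psi> \<in> embeddings H G" using free_of_iff[OF H(1) G(1)] by blast
  then show ?thesis unfolding detects_def embeddings_def using H(2) G(2)
    by (intro exI[of _ \<psi>]) auto
qed

lemma ex_detection_constants:
  assumes H: "simple_graph H" and r: "1 \<le> r" "card (verts H) \<le> r"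
  shows "\<exists>M B C. B > 0 \<and> (\<forall>(G :: nat graph) n \<kappa>. G \<in> bounded_adm_class p r \<longrightarrow> verts G = {1..n} \<longrightarrow>
     n > 0 \<longrightarrow> \<kappa> \<ge> 1 \<longrightarrow> far (1 / real \<kappa>) (free_of H) G \<longrightarrow>
     2 / 3 \<le> measure_pmf.prob (probes n B G (2 * (C * \<kappa>) ^ M * M) []) {h. detects H n h})"
proof (cases "edges H = {}")
  case True
  have "2 / 3 \<le> measure_pmf.prob (probes n 1 G m []) {h. detects H n h}"
    if "G \<in> bounded_adm_class p r" "verts G = {1..n}" "n > 0" "\<kappa> \<ge> 1" "far (1 / real \<kappa>) (free_of H) G"
    for G :: "nat graph" and n \<kappa> m
  proof -
    have "simple_graph G" using that(1) by (simp add: bounded_adm_class_def)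
    then have "{h. detects H n h} = UNIV"
      using detection_without_edges[OF H True _ that(2,3,5)] that(4) by auto
    then show ?thesis by simp
  qed
  \<comment> \<open>With \<open>M = 0\<close> the verdict is given immediately, without any
    query.\<close>
  then show ?thesis by (intro exI[of _ 0] exI[of _ 1]) simp
next
  case False
  define M where "M = Suc (card (verts H) * card (verts H) + card (verts H)) * card (verts H)"
  define B where "B = 3 * M + 1"
  define C where "C = loss_const (card (verts H)) (card (edges H)) (reach_bound p r) * B"
  have "2 / 3 \<le> measure_pmf.prob (probes n B G (2 * (C * \<kappa>) ^ M * M) []) {h. detects H n h}"
    if "G \<in> bounded_adm_class p r" "verts G = {1..n}" "n > 0" "\<kappa> \<ge> 1" "far (1 / real \<kappa>) (free_of H) G"
    for G :: "nat graph" and n \<kappa>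
  proof -
    have "probing n B G"
      by unfold_locales (use that in \<open>auto simp: bounded_adm_class_def B_def\<close>)
    from detection_with_edges[OF H False that(1,2,3) r that(5,4) M_def B_def C_def, of "[]"]
    show ?thesis unfolding probing.likely_def[OF \<open>probing n B G\<close>] .
  qed
  then show ?thesis by (intro exI[of _ M] exI[of _ B] exI[of _ C]) (simp add: B_def)
qed

lemma prob_verdict:
  "measure_pmf.prob p {Some (b, k) | k. True} = measure_pmf.prob (verdict p) {Some b}"
proof -
  have "{Some (b, k) | k. True} = map_option fst -` {Some b}" by auto
  then show ?thesis unfolding verdict_def measure_map_pmf by (rule arg_cong)
qed

theorem theorem1:
  fixes \<F> :: "nat graph set"
  assumes "universally_bounded_admissibility \<F>"
  shows "H_testable \<F>"
  unfolding H_testable_def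
proof (intro allI impI)
  fix H :: "nat graph" assume H: "simple_graph H"
  \<comment> \<open>The radius covers every path inside a copy of \<open>H\<close>; the maximum
    serves the assumption on the family, which speaks of \<open>r \<ge> 1\<close>.\<close>
  define r where "r = max 1 (card (verts H))"
  obtain f where "\<forall>r\<ge>1. \<F> \<subseteq> bounded_adm_class (f r) r"
    using assms unfolding universally_bounded_admissibility_def by blast
  then have \<F>: "\<F> \<subseteq> bounded_adm_class (f r) r" by (simp add: r_def)
  have r: "1 \<le> r" "card (verts H) \<le> r" by (simp_all add: r_def)
  obtain M B C where "B > 0" and all: "\<forall>(G :: nat graph) n \<kappa>. G \<in> bounded_adm_class (f r) r \<longrightarrow>
     verts G = {1..n} \<longrightarrow> n > 0 \<longrightarrow> \<kappa> \<ge> 1 \<longrightarrow> far (1 / real \<kappa>) (free_of H) G \<longrightarrow>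
     2 / 3 \<le> measure_pmf.prob (probes n B G (2 * (C * \<kappa>) ^ M * M) []) {h. detects H n h}"
    using ex_detection_constants[OF H r, of "f r"] by (elim exE conjE)
  note detection = all[rule_format]
  define A where "A = algorithm H C M B"
  define L where "L = (\<lambda>\<epsilon> :: real. run_length C M (nat \<lceil>1 / \<epsilon>\<rceil>))"
  have exec: "execution A n \<epsilon> G = (\<lambda>t. run (strategy H C M B n (nat \<lceil>1 / \<epsilon>\<rceil>)) (random_neighbour G) t [])"
    for n \<epsilon> G
    by (intro ext) (simp add: execution_def A_def strategy_def[abs_def])
  have "one_sided_tester A (free_of H) \<F>"
    unfolding one_sided_tester_def
  proof (intro conjI allI impI ballI)
    show "general_recursive A" unfolding A_def by (rule recursive_algorithm[OF H])
    fix \<epsilon> :: real and n :: nat and G :: "nat graph"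
    assume \<epsilon>: "\<epsilon> > 0" and n: "n > 0" and G: "G \<in> \<F>" "verts G = {1..n}"
    define \<kappa> where "\<kappa> = nat \<lceil>1 / \<epsilon>\<rceil>"
    define m where "m = 2 * (C * \<kappa>) ^ M * M"
    have "0 < 1 / \<epsilon>" using \<epsilon> by simp
    then have "0 < \<lceil>1 / \<epsilon>\<rceil>" by (simp only: zero_less_ceiling)
    then have \<kappa>: "\<kappa> \<ge> 1" and "1 / \<epsilon> \<le> real \<kappa>" unfolding \<kappa>_def by linarith+
    \<comment> \<open>The tester works with the smaller parameter \<open>1 / real \<kappa>\<close>,
      for which the graph is still far.\<close>
    then have \<kappa>_le: "1 / real \<kappa> \<le> \<epsilon>" using \<epsilon> by (simp add: field_simps)
    have Gcl: "G \<in> bounded_adm_class (f r) r" using G(1) \<F> by blast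
    interpret probing n B G
      by unfold_locales (use Gcl G n \<open>B > 0\<close> in \<open>auto simp: bounded_adm_class_def\<close>)
    let ?E = "execution A n \<epsilon> G (Suc (3 * m))"
    have v: "verdict ?E = map_pmf (\<lambda>h'. Some (\<not> detects H n h')) (probes n B G m [])"
      unfolding exec \<kappa>_def[symmetric]
      by (rule verdict_run_eq_probes[OF n \<open>B > 0\<close>]) (simp add: run_length_def m_def)
    have "None \<notin> set_pmf (verdict ?E)" unfolding v by auto
    then have "None \<notin> set_pmf ?E" unfolding verdict_def by force
    moreover have "measure_pmf.prob ?E {Some (True, k) | k. True} = 1" if "G \<in> free_of H"
    proof -
      have "set_pmf (verdict ?E) \<subseteq> {Some True}"
        unfolding v using detects_sound[OF _ _ H] that by auto
      then show ?thesis unfolding prob_verdict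
        by (subst measure_pmf.prob_eq_1) (auto simp: AE_measure_pmf_iff)
    qed
    moreover have "2 / 3 \<le> measure_pmf.prob ?E {Some (False, k) | k. True}" if "far \<epsilon> (free_of H) G"
    proof -
      have "2 / 3 \<le> measure_pmf.prob (probes n B G m []) {h. detects H n h}"
        unfolding m_def by (rule detection[OF Gcl G(2) n \<kappa> far_antimono[OF that \<kappa>_le]])
      then show ?thesis unfolding prob_verdict v by (simp add: vimage_def)
    qed
    ultimately show "\<exists>t. None \<notin> set_pmf (execution A n \<epsilon> G t) \<and>
        (G \<in> free_of H \<longrightarrow> measure_pmf.prob (execution A n \<epsilon> G t) {Some (True, k) | k. True} = 1) \<and>
        (far \<epsilon> (free_of H) G \<longrightarrow>
          2 / 3 \<le> measure_pmf.prob (execution A n \<epsilon> G t) {Some (False, k) | k. True})"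
      by blast
  qed
  moreover have "query_bound A \<F> L"
    unfolding query_bound_def
  proof (intro allI impI ballI)
    fix \<epsilon> :: real and n t b k and G :: "nat graph"
    assume n: "n > 0" and "Some (b, k) \<in> set_pmf (execution A n \<epsilon> G t)"
    then have "k + length ([] :: nat list) \<le> L \<epsilon>"
      unfolding exec
      by (intro run_queries_le) (auto simp: strategy_eq[OF n \<open>B > 0\<close>] L_def)
    then show "k \<le> L \<epsilon>" by simp
  qed
  ultimately show "testable_on (free_of H) \<F>" unfolding testable_on_def by blast
qed

end
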